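(* There exists $\bar\sigma(\cdot)\in\Sigma[\alpha,\beta]$ with $\lambda_{\bar\sigma(\cdot)}=\sup_{\sigma(\cdot)\in\Sigma[\alpha,\beta]}\lambda_{\sigma(\cdot)}$ (an optimal control). Suppose $\bar\sigma(\cdot)$ is such an optimal control with $$\big|(0<\bar\sigma(\cdot)<1)\big|>0,$$ and let $\bar y(\cdot)=y_{\bar\sigma(\cdot)}$ be the corresponding normalized principal eigenfunction. Then, for some constant $C$, $$\langle(A_1-A_0)\nabla\bar y(x),\nabla\bar y(x)\rangle= C\qquad\text{for a.e. }x\in(0<\bar\sigma(\cdot)<1),$$ and $$\langle(A_1-A_0)\nabla\bar y(x'),\nabla\bar y(x')\rangle\le\langle(A_1-A_0)\nabla\bar y(x),\nabla\bar y(x)\rangle\le\langle(A_1-A_0)\nabla\bar y(x''),\nabla\bar y(x'')\rangle$$ for a.e. $x'\in(\bar\sigma(\cdot)=0)$, a.e. $x\in(0<\bar\sigma(\cdot)<1)$, a.e. $x''\in(\bar\sigma(\cdot)=1)$. Further: - if $\int_\Omega\bar\sigma(x)\,dx<\beta|\Omega|$, then $\langle(A_1-A_0)\nabla\bar y(x),\nabla\bar y(x)\rangle\le0$ for a.e. $x\in(0\le\bar\sigma(\cdot)<1)$; - if $\int_\Omega\bar\sigma(x)\,dx>\alpha|\Omega|$, then $\langle(A_1-A_0)\nabla\bar y(x),\nabla\bar y(x)\rangle\ge0$ for a.e. $x\in(0<\bar\sigma(\cdot)\le1)$; - if $\alpha|\Omega|<\int_\Omega\bar\sigma(x)\,dx<\beta|\Omega|$,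 then $\langle(A_1-A_0)\nabla\bar y(x),\nabla\bar y(x)\rangle=0$ for a.e. $x\in(0<\bar\sigma(\cdot)<1)$.
   Context: $\Omega\subset\mathbb R^n$ is a bounded Lipschitz domain, $0<\mu_0\le\mu_1<\infty$, $\mathbb S^n$ is the set of real symmetric $n\times n$ matrices with the usual order ($A\le B$ iff $B-A$ is positive semidefinite), and $A_0\ne A_1$ are two matrices in $M[\mu_0,\mu_1]=\{A\in\mathbb S^n:\mu_0I\le A\le\mu_1I\}$. The numbers $0\le\alpha\le\beta\le1$ are such that either $0<\alpha\le\beta<1$ (no additional restriction on $A_0,A_1$), or $\alpha=0$, $\beta=1$ and neither $A_0\le A_1$ nor $A_1\le A_0$ holds. $|E|$ is Lebesgue measure, and $$\Sigma[\alpha,\beta]=\Big\{\sigma:\Omega\to[0,1]\ \text{measurable}:\ \alpha|\Omega|\le\int_\Omega\sigma(x)\,dx\le\beta|\Omega|\Big\}.$$ For $\sigma(\cdot)\in\Sigma[\alpha,\beta]$, $\lambda_{\sigma(\cdot)}$ denotes the principal (smallest) eigenvalue of $y\mapsto-\nabla\cdot\big([A_0+\sigma(x)(A_1-A_0)]\nabla y\big)$ on $\Omega$ with homogeneous Dirichlet boundary condition, i.e. the infimum over $y\in W_0^{1,2}(\Omega)\setminus\{0\}$ of $\int_\Omega\langle[A_0+\sigma(A_1-A_0)]\nabla y,\nabla y\rangle dx/\|y\|_{L^2(\Omega)}^2$, and $y_{\sigma(\cdot)}$ denotes the unique associated eigenfunction that is positive in $\Omega$ and has $L^2(\Omega)$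 norm $1$. Notation: $(0<\bar\sigma(\cdot)<1)=\{x\in\Omega:0<\bar\sigma(x)<1\}$, and similarly for $(\bar\sigma(\cdot)=0)$ etc. *)

theory Defs
  imports "HOL-Analysis.Analysis"
begin

section \<open>Symmetric matrices\<close>

text \<open>The library order on \<open>real ^ 'n ^ 'n\<close> is componentwise, so the order of
  symmetric matrices needs its own relation.\<close>

definition loewner_le :: "real ^ 'n ^ 'n \<Rightarrow> real ^ 'n ^ 'n \<Rightarrow> bool" (infix \<open>\<preceq>\<close> 50) where
  "A \<preceq> B \<longleftrightarrow> (\<forall>v. 0 \<le> ((B - A) *v v) \<bullet> v)"

definition elliptic_matrices :: "real \<Rightarrow> real \<Rightarrow> (real ^ 'n ^ 'n) set" where
  "elliptic_matrices \<mu>\<^sub>0 \<mu>\<^sub>1 = {A. transpose A = A \<and> mat \<mu>\<^sub>0 \<preceq> A \<and> A \<preceq> mat \<mu>\<^sub>1}"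


section \<open>Lipschitz domains\<close>

text \<open>Near each boundary point the domain is, in suitable orthonormal coordinates whose last axis
  is \<open>\<nu>\<close>, the set above the graph of a Lipschitz function \<open>g\<close>. Here \<open>g\<close> is a function on the
  hyperplane orthogonal to \<open>\<nu>\<close>, onto which \<open>x\<close> projects as \<open>x - (x \<bullet> \<nu>) *\<^sub>R \<nu>\<close>.\<close>

definition bounded_lipschitz_domain :: "(real ^ 'n) set \<Rightarrow> bool" where
  "bounded_lipschitz_domain \<Omega> \<longleftrightarrow>
     open \<Omega> \<and> connected \<Omega> \<and> \<Omega> \<noteq> {} \<and> bounded \<Omega> \<and>
     (\<forall>p \<in> frontier \<Omega>. \<exists>r > 0. \<exists>\<nu> g L. norm \<nu> = 1 \<and> L-lipschitz_on {z. z \<bullet> \<nu> = 0} g \<and>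
        (\<forall>x \<in> ball p r. x \<in> \<Omega> \<longleftrightarrow> g (x - (x \<bullet> \<nu>) *\<^sub>R \<nu>) < x \<bullet> \<nu>))"


section \<open>Sobolev spaces\<close>

text \<open>Elements of Lebesgue and Sobolev spaces on \<open>\<Omega>\<close> are represented by functions on the whole
  space whose values outside \<open>\<Omega>\<close> are irrelevant; functions that agree almost everywhere on
  \<open>\<Omega>\<close> are not identified.\<close>

definition grad :: "(real ^ 'n \<Rightarrow> real) \<Rightarrow> real ^ 'n \<Rightarrow> real ^ 'n" where
  "grad f x = (\<chi> i. frechet_derivative f (at x) (axis i 1))"

primrec C_k :: "nat \<Rightarrow> (real ^ 'n \<Rightarrow> real) \<Rightarrow> bool" where
  "C_k 0 f \<longleftrightarrow> continuous_on UNIV f"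
| "C_k (Suc k) f \<longleftrightarrow> f differentiable_on UNIV \<and> (\<forall>i. C_k k (\<lambda>x. grad f x $ i))"

definition test_functions :: "(real ^ 'n) set \<Rightarrow> (real ^ 'n \<Rightarrow> real) set" where
  "test_functions \<Omega> =
     {\<phi>. (\<forall>k. C_k k \<phi>) \<and> compact (closure {x. \<phi> x \<noteq> 0}) \<and> closure {x. \<phi> x \<noteq> 0} \<subseteq> \<Omega>}"

definition L2 :: "(real ^ 'n) set \<Rightarrow> (real ^ 'n \<Rightarrow> 'b::euclidean_space) set" where
  "L2 \<Omega> = {f \<in> borel_measurable (lebesgue_on \<Omega>).
             integrable (lebesgue_on \<Omega>) (\<lambda>x. (norm (f x))\<^sup>2)}"

definition has_weak_gradient ::
  "(real ^ 'n) set \<Rightarrow> (real ^ 'n \<Rightarrow> real) \<Rightarrow> (real ^ 'n \<Rightarrow> real ^ 'n) \<Rightarrow> bool" where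
  "has_weak_gradient \<Omega> y G \<longleftrightarrow> y \<in> L2 \<Omega> \<and> G \<in> L2 \<Omega> \<and>
     (\<forall>\<phi> \<in> test_functions \<Omega>. \<forall>i.
        (LINT x|lebesgue_on \<Omega>. y x * grad \<phi> x $ i) = - (LINT x|lebesgue_on \<Omega>. G x $ i * \<phi> x))"

text \<open>The weak gradient is determined only up to a null set; this picks a representative.\<close>

definition weak_gradient :: "(real ^ 'n) set \<Rightarrow> (real ^ 'n \<Rightarrow> real) \<Rightarrow> real ^ 'n \<Rightarrow> real ^ 'n" where
  "weak_gradient \<Omega> y = (SOME G. has_weak_gradient \<Omega> y G)"

definition W12 :: "(real ^ 'n) set \<Rightarrow> (real ^ 'n \<Rightarrow> real) set" where
  "W12 \<Omega> = {y. \<exists>G. has_weak_gradient \<Omega> y G}"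

definition W12_0 :: "(real ^ 'n) set \<Rightarrow> (real ^ 'n \<Rightarrow> real) set" where
  "W12_0 \<Omega> = {y \<in> W12 \<Omega>. \<exists>\<phi>. (\<forall>k. \<phi> k \<in> test_functions \<Omega>) \<and>
     (\<lambda>k. LINT x|lebesgue_on \<Omega>. (y x - \<phi> k x)\<^sup>2) \<longlonglongrightarrow> 0 \<and>
     (\<lambda>k. LINT x|lebesgue_on \<Omega>. (norm (weak_gradient \<Omega> y x - grad (\<phi> k) x))\<^sup>2) \<longlonglongrightarrow> 0}"


section \<open>Principal Dirichlet eigenvalue and eigenfunction\<close>

definition dirichlet_form ::
  "(real ^ 'n) set \<Rightarrow> (real ^ 'n \<Rightarrow> real ^ 'n ^ 'n) \<Rightarrow> (real ^ 'n \<Rightarrow> real) \<Rightarrow> (real ^ 'n \<Rightarrow> real) \<Rightarrow> real"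
  where
  "dirichlet_form \<Omega> A y v =
     (LINT x|lebesgue_on \<Omega>. (A x *v weak_gradient \<Omega> y x) \<bullet> weak_gradient \<Omega> v x)"

definition principal_eigenvalue ::
  "(real ^ 'n) set \<Rightarrow> (real ^ 'n \<Rightarrow> real ^ 'n ^ 'n) \<Rightarrow> real" where
  "principal_eigenvalue \<Omega> A =
     (INF y \<in> {y \<in> W12_0 \<Omega>. \<not> (AE x in lebesgue_on \<Omega>. y x = 0)}.
        dirichlet_form \<Omega> A y y / (LINT x|lebesgue_on \<Omega>. (y x)\<^sup>2))"

text \<open>The eigenvalue equation is meant in the weak sense. As elements of \<open>W12_0\<close> matter only
  up to null sets, positivity is required almost everywhere.\<close>

definition principal_eigenfunction ::
  "(real ^ 'n) set \<Rightarrow> (real ^ 'n \<Rightarrow> real ^ 'n ^ 'n) \<Rightarrow> (real ^ 'n \<Rightarrow> real) \<Rightarrow> bool" where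
  "principal_eigenfunction \<Omega> A y \<longleftrightarrow> y \<in> W12_0 \<Omega> \<and>
     (\<forall>v \<in> W12_0 \<Omega>. dirichlet_form \<Omega> A y v =
        principal_eigenvalue \<Omega> A * (LINT x|lebesgue_on \<Omega>. y x * v x)) \<and>
     (AE x in lebesgue_on \<Omega>. 0 < y x) \<and>
     (LINT x|lebesgue_on \<Omega>. (y x)\<^sup>2) = 1"


section \<open>The control problem\<close>

definition controls :: "(real ^ 'n) set \<Rightarrow> real \<Rightarrow> real \<Rightarrow> (real ^ 'n \<Rightarrow> real) set" where
  "controls \<Omega> \<alpha> \<beta> = {\<sigma> \<in> borel_measurable (lebesgue_on \<Omega>). (\<forall>x \<in> \<Omega>. 0 \<le> \<sigma> x \<and> \<sigma> x \<le> 1) \<and>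
     \<alpha> * measure lebesgue \<Omega> \<le> (LINT x|lebesgue_on \<Omega>. \<sigma> x) \<and>
     (LINT x|lebesgue_on \<Omega>. \<sigma> x) \<le> \<beta> * measure lebesgue \<Omega>}"

definition mixture ::
  "real ^ 'n ^ 'n \<Rightarrow> real ^ 'n ^ 'n \<Rightarrow> (real ^ 'n \<Rightarrow> real) \<Rightarrow> real ^ 'n \<Rightarrow> real ^ 'n ^ 'n" where
  "mixture A\<^sub>0 A\<^sub>1 \<sigma> x = A\<^sub>0 + \<sigma> x *\<^sub>R (A\<^sub>1 - A\<^sub>0)"

definition optimal_control ::
  "(real ^ 'n) set \<Rightarrow> real ^ 'n ^ 'n \<Rightarrow> real ^ 'n ^ 'n \<Rightarrow> real \<Rightarrow> real \<Rightarrow> (real ^ 'n \<Rightarrow> real) \<Rightarrow> bool" where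
  "optimal_control \<Omega> A\<^sub>0 A\<^sub>1 \<alpha> \<beta> \<sigma> \<longleftrightarrow> \<sigma> \<in> controls \<Omega> \<alpha> \<beta> \<and>
     principal_eigenvalue \<Omega> (mixture A\<^sub>0 A\<^sub>1 \<sigma>) =
       (SUP \<tau> \<in> controls \<Omega> \<alpha> \<beta>. principal_eigenvalue \<Omega> (mixture A\<^sub>0 A\<^sub>1 \<tau>))"

end

theory Submission
  imports Defs "HOL-Complex_Analysis.Great_Picard"
begin

text \<open>Write \<open>\<lambda>(\<sigma>)\<close> for the principal eigenvalue of the mixture and \<open>q\<close> for the quadratic form of
\<open>A\<^sub>1 - A\<^sub>0\<close> at the gradient of the eigenfunction \<open>y\<close>.

As an infimum of Rayleigh quotients, each of which is affine in \<open>\<sigma>\<close>, the function \<open>\<lambda>\<close> is concave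
and upper semicontinuous. Near-optimal controls therefore form a decreasing family of convex sets,
and elements of nearly minimal \<open>L\<^sup>2\<close> norm of these sets are a Cauchy sequence by the parallelogram
law. Its limit is optimal (\<open>optimal_control_exists\<close>).

The optimality conditions express that the first variation \<open>\<integral> (\<tau> - \<sigma>) q\<close> is nonpositive for every
control \<open>\<tau>\<close> (\<open>optimal_variational_inequality\<close>). Optimality gives \<open>\<lambda>(\<sigma> + t (\<tau> - \<sigma>)) \<le> \<lambda>(\<sigma>)\<close>, so
there are normalized test functions whose energy for the perturbed coefficient is below
\<open>\<lambda>(\<sigma>) + t\<^sup>2\<close>. They almost minimize the energy for \<open>\<sigma>\<close>, and their first-order term in \<open>t\<close> is at
most \<open>t\<close>. Once a subsequence of their gradients is known to converge to plus or minus the gradient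
of \<open>y\<close>, the inequality follows in the limit.

That convergence (\<open>minimizing_sequence_gradient_converges\<close>) has two ingredients. Rellich compactness
(\<open>rellich\<close>) gives convergence in \<open>L\<^sup>2\<close>, which the nonnegative form \<open>energy - \<lambda> \<parallel>\<cdot>\<parallel>\<^sup>2\<close> improves to
convergence of gradients. The limit lies in the kernel of that form, and this kernel is spanned by
\<open>y\<close> (\<open>null_limit_unique\<close>): it is closed under absolute values and obeys the strong maximum principle
(\<open>strong_maximum_principle\<close>), so for every constant \<open>c\<close> a kernel element \<open>u\<close> satisfies either
\<open>u \<le> c y\<close> or \<open>u > c y\<close> almost everywhere. This is where connectedness of the domain is used; for
two equal components the claim would fail. Both ingredients rest on the Poincare inequality on
convex sets (\<open>poincare_convex\<close>), on small cubes for Rellich and on balls for the maximum principle.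

All analysis is carried out on test functions and then passes to limits: nonlinear operations act on
smooth functions, and weak gradients have to be identified only for test functions
(\<open>weak_gradient_test_function\<close>). The pointwise conditions follow from the variational
inequality by moving volume
from where \<open>q\<close> is small to where it is large (locale \<open>bathtub\<close>).\<close>

section \<open>Smooth functions\<close>

lemma GDERIV_imp_grad_eq:
  fixes f :: "real ^ 'n \<Rightarrow> real"
  assumes "GDERIV f x :> D"
  shows "grad f x = D"
proof -
  have "frechet_derivative f (at x) = (\<lambda>h. h \<bullet> D)"
    using frechet_derivative_at[OF assms[unfolded gderiv_def]] by simp
  then show ?thesis
    by (simp add: grad_def vec_eq_iff inner_axis')
qed

lemma differentiable_imp_GDERIV_grad:
  fixes f :: "real ^ 'n \<Rightarrow> real"
  assumes "f differentiable at x"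
  shows "GDERIV f x :> grad f x"
proof -
  let ?f' = "frechet_derivative f (at x)"
  have f': "(f has_derivative ?f') (at x)"
    using assms frechet_derivative_works by blast
  interpret linear ?f' using f' has_derivative_linear by blast
  have "?f' h = h \<bullet> grad f x" for h
  proof -
    have "?f' h = ?f' (\<Sum>i\<in>UNIV. (h $ i) *\<^sub>R axis i 1)"
      by (simp add: basis_expansion scalar_mult_eq_scaleR[symmetric])
    also have "\<dots> = h \<bullet> grad f x"
      by (simp add: sum scale inner_vec_def grad_def)
    finally show ?thesis .
  qed
  then have "?f' = (\<lambda>h. h \<bullet> grad f x)" by auto
  then show ?thesis using f' by (simp add: gderiv_def)
qed

lemma GDERIV_imp_differentiable: "GDERIV f x :> D \<Longrightarrow> f differentiable at x"
  unfolding gderiv_def differentiable_def by blast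

lemma C_k_SucI:
  assumes "\<And>x. GDERIV f x :> D x" and "\<And>i. C_k k (\<lambda>x. D x $ i)"
  shows "C_k (Suc k) f"
  using assms GDERIV_imp_grad_eq[OF assms(1)]
  by (auto simp: differentiable_on_eq_differentiable_at intro: GDERIV_imp_differentiable)

lemma C_k_SucD:
  assumes "C_k (Suc k) f"
  shows "GDERIV f x :> grad f x" and "C_k k (\<lambda>x. grad f x $ i)"
  using assms by (auto simp: differentiable_on_eq_differentiable_at
      intro: differentiable_imp_GDERIV_grad)

lemma C_k_Suc_imp: "C_k (Suc k) f \<Longrightarrow> C_k k f"
  by (induction k arbitrary: f) (auto simp: differentiable_imp_continuous_on)

lemma C_k_const: "C_k k (\<lambda>x. c)"
proof (induction k arbitrary: c)
  case (Suc k)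
  show ?case by (rule C_k_SucI[OF GDERIV_const]) (use Suc in simp)
qed simp

lemma C_k_component: "C_k k (\<lambda>x :: real ^ 'n. x $ i)"
proof (cases k)
  case (Suc k)
  have "GDERIV (\<lambda>x. x $ i) x :> axis i 1" for x :: "real ^ 'n"
    unfolding gderiv_def inner_axis by (simp add: bounded_linear_vec_nth bounded_linear_imp_has_derivative)
  then show ?thesis unfolding Suc by (rule C_k_SucI) (rule C_k_const)
qed (simp add: continuous_on_component)

lemma C_k_add: "C_k k f \<Longrightarrow> C_k k g \<Longrightarrow> C_k k (\<lambda>x. f x + g x)"
proof (induction k arbitrary: f g)
  case (Suc k)
  note f = C_k_SucD[OF Suc.prems(1)] and g = C_k_SucD[OF Suc.prems(2)]
  show ?case
    by (rule C_k_SucI[OF GDERIV_add[OF f(1) g(1)]]) (auto intro: Suc.IH f g)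
qed (auto intro: continuous_intros)

lemma C_k_mult: "C_k k f \<Longrightarrow> C_k k g \<Longrightarrow> C_k k (\<lambda>x. f x * g x)"
proof (induction k arbitrary: f g)
  case (Suc k)
  note f = C_k_SucD[OF Suc.prems(1)] and g = C_k_SucD[OF Suc.prems(2)]
  show ?case
    by (rule C_k_SucI[OF GDERIV_mult[OF f(1) g(1)]])
      (auto intro!: C_k_add Suc.IH f g C_k_Suc_imp[OF Suc.prems(1)] C_k_Suc_imp[OF Suc.prems(2)])
qed (auto intro: continuous_intros)

lemma C_k_prod: "finite I \<Longrightarrow> (\<And>i. i \<in> I \<Longrightarrow> C_k k (f i)) \<Longrightarrow> C_k k (\<lambda>x. \<Prod>i\<in>I. f i x)"
  by (induction I rule: finite_induct) (auto intro: C_k_const C_k_mult)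

lemma C_k_inverse: "C_k k f \<Longrightarrow> (\<And>x. f x \<noteq> 0) \<Longrightarrow> C_k k (\<lambda>x. inverse (f x))"
proof (induction k arbitrary: f)
  case (Suc k)
  note f = C_k_SucD[OF Suc.prems(1)]
  have "C_k k (\<lambda>x. inverse (f x))"
    by (rule Suc.IH[OF C_k_Suc_imp[OF Suc.prems(1)] Suc.prems(2)])
  then have "C_k k (\<lambda>x. - 1 * (inverse (f x) * inverse (f x) * grad f x $ i))" for i
    by (intro C_k_mult C_k_const f)
  then show ?case
    by (intro C_k_SucI[OF GDERIV_inverse[OF f(1) Suc.prems(2)]])
      (simp add: power2_eq_square)
qed (auto intro: continuous_intros)

lemma GDERIV_sqrt:
  assumes "GDERIV f x :> D" and "0 < f x"
  shows "GDERIV (\<lambda>x. sqrt (f x)) x :> (inverse (sqrt (f x)) / 2) *\<^sub>R D"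
  by (rule GDERIV_DERIV_compose[OF assms(1) DERIV_real_sqrt[OF assms(2)]])

lemma C_k_sqrt: "C_k k f \<Longrightarrow> (\<And>x. 0 < f x) \<Longrightarrow> C_k k (\<lambda>x. sqrt (f x))"
proof (induction k arbitrary: f)
  case (Suc k)
  note f = C_k_SucD[OF Suc.prems(1)]
  have pos: "sqrt (f x) \<noteq> 0" for x using Suc.prems(2)[of x] by simp
  have "C_k k (\<lambda>x. sqrt (f x))"
    by (rule Suc.IH[OF C_k_Suc_imp[OF Suc.prems(1)] Suc.prems(2)])
  then have "C_k k (\<lambda>x. inverse (sqrt (f x)) * (1 / 2) * grad f x $ i)" for i
    by (intro C_k_mult C_k_const f C_k_inverse pos)
  then show ?case
    by (intro C_k_SucI[OF GDERIV_sqrt[OF f(1) Suc.prems(2)]]) simp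
qed (auto intro: continuous_intros)

text \<open>The classical flat function \<open>exp (- 1 / t)\<close>, times negative powers of \<open>t\<close>. The powers make the
family closed under differentiation up to linear combinations, so smoothness becomes an induction.\<close>

definition flat_exp :: "nat \<Rightarrow> real \<Rightarrow> real" where
  "flat_exp m t = (if 0 < t then exp (- inverse t) * inverse t ^ m else 0)"

text \<open>With \<open>u = 1 / t\<close> this is the fact that \<open>exp u\<close> outgrows every power of \<open>u\<close>.\<close>

lemma flat_exp_tendsto_0: "(flat_exp m \<longlongrightarrow> 0) (at 0)"
proof (rule filterlim_split_at)
  show "(flat_exp m \<longlongrightarrow> 0) (at_left 0)"
    by (rule tendsto_eventually) (auto simp: eventually_at_filter flat_exp_def)
  have "((\<lambda>t. inverse t ^ m / exp (inverse t)) \<longlongrightarrow> 0) (at_right (0::real))"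
    by (rule filterlim_compose[OF tendsto_power_div_exp_0 filterlim_inverse_at_top_right])
  then show "(flat_exp m \<longlongrightarrow> 0) (at_right 0)"
    by (rule Lim_transform_eventually)
      (auto simp: eventually_at_filter flat_exp_def exp_minus field_simps)
qed

lemma flat_exp_deriv:
  "(flat_exp m has_real_derivative flat_exp (m + 2) t - m * flat_exp (m + 1) t) (at t)"
proof (cases "t = 0")
  case True
  have "((\<lambda>h. (flat_exp m (0 + h) - flat_exp m 0) / h) \<longlongrightarrow> 0) (at 0)"
    by (rule Lim_transform_eventually[OF flat_exp_tendsto_0[of "Suc m"]])
      (auto simp: flat_exp_def eventually_at_filter field_simps)
  then show ?thesis using True by (simp add: DERIV_def flat_exp_def)
next
  case False
  show ?thesis
  proof (cases "0 < t")
    case True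
    have 1: "((\<lambda>t. exp (- inverse t)) has_real_derivative exp (- inverse t) * (inverse t)\<^sup>2) (at t)"
      using DERIV_fun_exp[OF DERIV_minus[OF DERIV_inverse[of t]]] True by (simp add: numeral_2_eq_2)
    have 2: "((\<lambda>t. inverse t ^ m) has_real_derivative real m * (- (inverse t)\<^sup>2 * inverse t ^ (m - 1))) (at t)"
      using DERIV_power[OF DERIV_inverse[of t]] True by (simp add: numeral_2_eq_2)
    have "real m * (- (inverse t)\<^sup>2 * inverse t ^ (m - 1)) = - (real m * inverse t ^ (m + 1))"
      by (cases m) (auto simp: power2_eq_square)
    with 2 have "((\<lambda>t. inverse t ^ m) has_real_derivative - (real m * inverse t ^ (m + 1))) (at t)"
      by (simp only:)
    from DERIV_mult[OF 1 this]
    have "((\<lambda>t. exp (- inverse t) * inverse t ^ m) has_real_derivative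
        flat_exp (m + 2) t - m * flat_exp (m + 1) t) (at t)"
      by (rule DERIV_cong) (use True in \<open>simp add: flat_exp_def power2_eq_square algebra_simps\<close>)
    then show ?thesis
      by (rule has_field_derivative_transform_within_open[of _ _ _ "{0<..}"])
        (use True in \<open>auto simp: flat_exp_def\<close>)
  next
    case neg: False
    have "((\<lambda>t. 0) has_real_derivative flat_exp (m + 2) t - m * flat_exp (m + 1) t) (at t)"
      using neg by (simp add: flat_exp_def)
    then show ?thesis
      by (rule has_field_derivative_transform_within_open[of _ _ _ "{..<0}"])
        (use neg False in \<open>auto simp: flat_exp_def\<close>)
  qed
qed

lemma C_k_flat_exp: "(\<And>k. C_k k h) \<Longrightarrow> C_k k (\<lambda>x. flat_exp m (h x))"
proof (induction k arbitrary: m)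
  case 0
  have "continuous_on UNIV (flat_exp m)"
    by (meson DERIV_continuous_on flat_exp_deriv has_field_derivative_at_within)
  moreover have "continuous_on UNIV h" using "0"[of 0] by simp
  ultimately show ?case
    using continuous_on_compose2 by fastforce
next
  case (Suc k)
  note h = C_k_SucD[OF Suc.prems]
  have "C_k k (\<lambda>x. (flat_exp (m + 2) (h x) + (- real m) * flat_exp (m + 1) (h x)) * grad h x $ i)" for i
    by (intro C_k_mult C_k_add C_k_const Suc.IH Suc.prems h)
  then show ?case
    by (intro C_k_SucI[OF GDERIV_DERIV_compose[OF h(1) flat_exp_deriv]]) simp
qed

lemma flat_exp_bounds: "0 \<le> flat_exp 0 t" "flat_exp 0 t \<le> 1"
  by (auto simp: flat_exp_def)

lemma flat_exp_0_pos_iff: "0 < flat_exp 0 t \<longleftrightarrow> 0 < t"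
  by (auto simp: flat_exp_def)

section \<open>Test functions\<close>

lemma test_functionsI:
  assumes "\<And>k. C_k k \<phi>" and "{x. \<phi> x \<noteq> 0} \<subseteq> K" and "compact K" and "K \<subseteq> \<Omega>"
  shows "\<phi> \<in> test_functions \<Omega>"
proof -
  have "closure {x. \<phi> x \<noteq> 0} \<subseteq> K"
    using assms(2,3) by (simp add: closure_minimal compact_imp_closed)
  moreover from this have "compact (closure {x. \<phi> x \<noteq> 0})"
    using assms(3) by (metis closed_closure compact_Int_closed inf.absorb_iff2)
  ultimately show ?thesis using assms(1,4) by (auto simp: test_functions_def)
qed

lemma test_function_support:
  assumes "\<phi> \<in> test_functions \<Omega>"
  shows "\<exists>K. compact K \<and> K \<subseteq> \<Omega> \<and> (\<forall>x. x \<notin> K \<longrightarrow> \<phi> x = 0 \<and> grad \<phi> x = 0)"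
proof -
  define K where "K = closure {x. \<phi> x \<noteq> 0}"
  have K: "compact K" "K \<subseteq> \<Omega>"
    using assms unfolding test_functions_def K_def by blast+
  have cl: "closed K" unfolding K_def by (rule closed_closure)
  have 0: "\<phi> x = 0" if "x \<notin> K" for x
    using that closure_subset[of "{x. \<phi> x \<noteq> 0}"] unfolding K_def by blast
  have "grad \<phi> x = 0" if "x \<notin> K" for x
  proof (rule GDERIV_imp_grad_eq)
    have "((\<lambda>x. 0) has_derivative (\<lambda>h. 0)) (at x)" by (rule has_derivative_const)
    then have "(\<phi> has_derivative (\<lambda>h. 0)) (at x)"
      by (rule has_derivative_transform_within_open[of _ _ _ _ "- K"])
        (use that 0 cl in \<open>simp_all add: open_Compl\<close>)
    then show "GDERIV \<phi> x :> 0" by (simp add: gderiv_def)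
  qed
  with 0 K show ?thesis by blast
qed

lemma test_function_C_k: "\<phi> \<in> test_functions \<Omega> \<Longrightarrow> C_k k \<phi>"
  unfolding test_functions_def by blast

lemma test_function_GDERIV: "\<phi> \<in> test_functions \<Omega> \<Longrightarrow> GDERIV \<phi> x :> grad \<phi> x"
  by (rule C_k_SucD(1)[OF test_function_C_k[of _ _ "Suc 0"]])

lemma test_function_continuous: "\<phi> \<in> test_functions \<Omega> \<Longrightarrow> continuous_on UNIV \<phi>"
  using test_function_C_k[of \<phi> \<Omega> 0] by simp

lemma test_function_grad_continuous: "\<phi> \<in> test_functions \<Omega> \<Longrightarrow> continuous_on UNIV (grad \<phi>)"
proof -
  assume "\<phi> \<in> test_functions \<Omega>"
  from C_k_SucD(2)[OF test_function_C_k[OF this, of "Suc 0"]]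
  have "continuous_on UNIV (\<lambda>x. \<chi> i. grad \<phi> x $ i)"
    by (intro continuous_on_vec_lambda) simp
  then show ?thesis by simp
qed

lemma test_function_add:
  assumes "\<phi> \<in> test_functions \<Omega>" "\<psi> \<in> test_functions \<Omega>"
  shows "(\<lambda>x. \<phi> x + \<psi> x) \<in> test_functions \<Omega>"
proof -
  obtain K where K: "compact K" "K \<subseteq> \<Omega>" "\<And>x. x \<notin> K \<Longrightarrow> \<phi> x = 0"
      "\<And>x. x \<notin> K \<Longrightarrow> grad \<phi> x = 0"
    using test_function_support[OF assms(1)] by blast
  obtain L where L: "compact L" "L \<subseteq> \<Omega>" "\<And>x. x \<notin> L \<Longrightarrow> \<psi> x = 0"
      "\<And>x. x \<notin> L \<Longrightarrow> grad \<psi> x = 0"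
    using test_function_support[OF assms(2)] by blast
  have "{x. \<phi> x + \<psi> x \<noteq> 0} \<subseteq> K \<union> L" using K(3) L(3) by force
  then show ?thesis using K L
    by (intro test_functionsI[of _ "K \<union> L"] C_k_add test_function_C_k[OF assms(1)]
        test_function_C_k[OF assms(2)]) auto
qed

lemma test_function_mult:
  assumes "\<phi> \<in> test_functions \<Omega>" "\<And>k. C_k k g"
  shows "(\<lambda>x. g x * \<phi> x) \<in> test_functions \<Omega>"
proof -
  obtain K where K: "compact K" "K \<subseteq> \<Omega>" "\<And>x. x \<notin> K \<Longrightarrow> \<phi> x = 0"
      "\<And>x. x \<notin> K \<Longrightarrow> grad \<phi> x = 0"
    using test_function_support[OF assms(1)] by blast
  have "{x. g x * \<phi> x \<noteq> 0} \<subseteq> K" using K(3) by force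
  then show ?thesis using K
    by (intro test_functionsI[of _ K] C_k_mult assms(2) test_function_C_k[OF assms(1)]) auto
qed

lemma test_function_cmult: "\<phi> \<in> test_functions \<Omega> \<Longrightarrow> (\<lambda>x. c * \<phi> x) \<in> test_functions \<Omega>"
  by (simp add: test_function_mult C_k_const)

lemma grad_add:
  "\<phi> \<in> test_functions \<Omega> \<Longrightarrow> \<psi> \<in> test_functions \<Omega> \<Longrightarrow>
    grad (\<lambda>x. \<phi> x + \<psi> x) x = grad \<phi> x + grad \<psi> x"
  by (intro GDERIV_imp_grad_eq GDERIV_add test_function_GDERIV)

lemma grad_cmult:
  assumes "\<phi> \<in> test_functions \<Omega>"
  shows "grad (\<lambda>x. c * \<phi> x) x = c *\<^sub>R grad \<phi> x"
  using GDERIV_imp_grad_eq[OF GDERIV_mult[OF GDERIV_const test_function_GDERIV[OF assms]], of c x]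
  by simp

lemma test_function_bounded:
  assumes "\<phi> \<in> test_functions \<Omega>"
  shows "\<exists>B\<ge>0. \<forall>x. \<bar>\<phi> x\<bar> \<le> B \<and> norm (grad \<phi> x) \<le> B"
proof -
  obtain K where K: "compact K" "K \<subseteq> \<Omega>" "\<And>x. x \<notin> K \<Longrightarrow> \<phi> x = 0" "\<And>x. x \<notin> K \<Longrightarrow> grad \<phi> x = 0"
    using test_function_support[OF assms(1)] by blast
  have "bounded (\<phi> ` K)" "bounded (grad \<phi> ` K)"
    by (intro compact_imp_bounded compact_continuous_image K(1)
        continuous_on_subset[OF test_function_continuous[OF assms] subset_UNIV]
        continuous_on_subset[OF test_function_grad_continuous[OF assms] subset_UNIV])+
  then obtain B1 B2 where B: "\<And>x. x \<in> K \<Longrightarrow> norm (\<phi> x) \<le> B1" "\<And>x. x \<in> K \<Longrightarrow> norm (grad \<phi> x) \<le> B2"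
    by (auto simp: bounded_iff)
  show ?thesis
  proof (intro exI[of _ "max 0 (max B1 B2)"] conjI allI)
    fix x
    show "\<bar>\<phi> x\<bar> \<le> max 0 (max B1 B2)" "norm (grad \<phi> x) \<le> max 0 (max B1 B2)"
      using B[of x] K(3,4)[of x] by (cases "x \<in> K"; simp)+
  qed simp
qed

text \<open>The product of flat functions of the signed distances to the faces. The scale \<open>m\<close> steepens the
edges: for growing \<open>m\<close> the bumps converge to the indicator of the open box, which lets integrals
against test functions detect integrals over boxes.\<close>

definition box_bump :: "real \<Rightarrow> real ^ 'n \<Rightarrow> real ^ 'n \<Rightarrow> real ^ 'n \<Rightarrow> real" where
  "box_bump m a b x =
     (\<Prod>i\<in>UNIV. flat_exp 0 (m * (x $ i - a $ i)) * flat_exp 0 (m * (b $ i - x $ i)))"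

lemma C_k_affine_component: "C_k k (\<lambda>x. m * (s * x $ i + c))"
  by (rule C_k_mult[OF C_k_const C_k_add[OF C_k_mult[OF C_k_const C_k_component] C_k_const]])

lemma C_k_box_bump: "C_k k (box_bump m a b)"
proof -
  have "C_k k (\<lambda>x. flat_exp 0 (m * (1 * x $ i + - (a $ i))) *
      flat_exp 0 (m * (- 1 * x $ i + b $ i)))" for i
    by (rule C_k_mult[OF C_k_flat_exp[OF C_k_affine_component] C_k_flat_exp[OF C_k_affine_component]])
  from C_k_prod[OF finite[of UNIV] this]
  show ?thesis by (simp add: box_bump_def[abs_def])
qed

lemma box_bump_pos:
  assumes "0 < m" "x \<in> box a b"
  shows "0 < box_bump m a b x"
proof -
  have "0 < flat_exp 0 (m * (x $ i - a $ i)) * flat_exp 0 (m * (b $ i - x $ i))" for i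
    using assms by (simp add: mem_box_cart flat_exp_0_pos_iff)
  then show ?thesis by (simp add: box_bump_def prod_pos)
qed

lemma box_bump_eq_0:
  assumes "0 < m" "x \<notin> box a b" shows "box_bump m a b x = 0"
proof -
  obtain i where "x $ i - a $ i \<le> 0 \<or> b $ i - x $ i \<le> 0"
    using assms(2) by (auto simp: mem_box_cart not_less)
  then have "flat_exp 0 (m * (x $ i - a $ i)) * flat_exp 0 (m * (b $ i - x $ i)) = 0"
    using assms(1) by (auto simp: flat_exp_def zero_less_mult_iff)
  then show ?thesis unfolding box_bump_def by (metis (no_types, lifting) UNIV_I finite prod_zero)
qed

lemma box_bump_bounds: "0 \<le> box_bump m a b x" "box_bump m a b x \<le> 1"
proof -
  have "0 \<le> flat_exp 0 s * flat_exp 0 t \<and> flat_exp 0 s * flat_exp 0 t \<le> 1" for s t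
    by (simp add: flat_exp_bounds mult_le_one)
  then show "0 \<le> box_bump m a b x" "box_bump m a b x \<le> 1"
    by (simp_all add: box_bump_def prod_nonneg prod_le_1)
qed

lemma test_function_box_bump:
  assumes "0 < m" "cbox a b \<subseteq> \<Omega>"
  shows "box_bump m a b \<in> test_functions \<Omega>"
proof (rule test_functionsI[of _ "cbox a b"])
  show "{x. box_bump m a b x \<noteq> 0} \<subseteq> cbox a b"
    using box_bump_eq_0[OF assms(1)] box_subset_cbox by blast
qed (use assms in \<open>auto intro: C_k_box_bump compact_cbox\<close>)

lemma box_bump_tendsto_indicator:
  "(\<lambda>m. box_bump (Suc m) a b x) \<longlonglongrightarrow> indicator (box a b) x"
proof (cases "x \<in> box a b")
  case False
  then show ?thesis using box_bump_eq_0[OF _ False] by (simp del: of_nat_Suc)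
next
  case True
  have 1: "(\<lambda>m. flat_exp 0 (real (Suc m) * t)) \<longlonglongrightarrow> 1" if "0 < t" for t :: real
  proof -
    have "(\<lambda>m. exp (- (inverse (real (Suc m)) * inverse t))) \<longlonglongrightarrow> exp (- (0 * inverse t))"
      by (intro tendsto_intros LIMSEQ_inverse_real_of_nat)
    then show ?thesis using that by (simp add: flat_exp_def zero_less_mult_iff del: of_nat_Suc)
  qed
  have "(\<lambda>m. box_bump (Suc m) a b x) \<longlonglongrightarrow> (\<Prod>i\<in>(UNIV::'a set). 1 * 1)"
    unfolding box_bump_def
    by (intro tendsto_prod tendsto_mult 1) (use True in \<open>auto simp: mem_box_cart\<close>)
  then show ?thesis using True by simp
qed

section \<open>Square integrable functions\<close>

text \<open>For an arbitrary measure, because the same estimates are needed on the domain, on balls and on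
grid cells.\<close>

definition square_integrable :: "'a measure \<Rightarrow> ('a \<Rightarrow> 'b::euclidean_space) \<Rightarrow> bool" where
  "square_integrable M f \<longleftrightarrow> f \<in> borel_measurable M \<and> integrable M (\<lambda>x. (norm (f x))\<^sup>2)"

definition sqnorm :: "'a measure \<Rightarrow> ('a \<Rightarrow> 'b::euclidean_space) \<Rightarrow> real" where
  "sqnorm M f = (LINT x|M. (norm (f x))\<^sup>2)"

definition L2_tendsto :: "'a measure \<Rightarrow> (nat \<Rightarrow> 'a \<Rightarrow> 'b::euclidean_space) \<Rightarrow> ('a \<Rightarrow> 'b) \<Rightarrow> bool" where
  "L2_tendsto M f g \<longleftrightarrow> (\<forall>k. square_integrable M (f k)) \<and> square_integrable M g \<and>
     (\<lambda>k. sqnorm M (\<lambda>x. f k x - g x)) \<longlonglongrightarrow> 0"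

lemma L2_iff: "f \<in> L2 \<Omega> \<longleftrightarrow> square_integrable (lebesgue_on \<Omega>) f"
  by (simp add: L2_def square_integrable_def)

lemma square_integrable_measurable [measurable_dest]:
  "square_integrable M f \<Longrightarrow> f \<in> borel_measurable M"
  by (simp add: square_integrable_def)

lemma square_integrable_sq: "square_integrable M f \<Longrightarrow> integrable M (\<lambda>x. (norm (f x))\<^sup>2)"
  by (simp add: square_integrable_def)

lemma square_integrable_bound:
  assumes "square_integrable M f" and "g \<in> borel_measurable M"
    and "AE x in M. norm (g x) \<le> C * norm (f x)"
  shows "square_integrable M g"
proof -
  have "integrable M (\<lambda>x. C\<^sup>2 * (norm (f x))\<^sup>2)"
    using square_integrable_sq[OF assms(1)] by simp
  then have "integrable M (\<lambda>x. (norm (g x))\<^sup>2)"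
  proof (rule Bochner_Integration.integrable_bound)
    show "AE x in M. norm ((norm (g x))\<^sup>2) \<le> norm (C\<^sup>2 * (norm (f x))\<^sup>2)"
      using assms(3)
    proof eventually_elim
      case (elim x)
      then have "(norm (g x))\<^sup>2 \<le> (C * norm (f x))\<^sup>2"
        by (intro power_mono) auto
      then show ?case by (simp add: power_mult_distrib)
    qed
  qed (use assms(2) in measurable)
  then show ?thesis using assms(2) by (simp add: square_integrable_def)
qed

lemma norm_add_sq_le: "(norm (a + b))\<^sup>2 \<le> 2 * (norm a)\<^sup>2 + 2 * (norm (b :: 'b::real_inner))\<^sup>2"
proof -
  have "(norm (a + b))\<^sup>2 + (norm (a - b))\<^sup>2 = 2 * (norm a)\<^sup>2 + 2 * (norm b)\<^sup>2"
    by (simp add: power2_norm_eq_inner inner_simps)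
  then show ?thesis using zero_le_power2[of "norm (a - b)"] by linarith
qed

lemma square_integrable_scaleR: "square_integrable M f \<Longrightarrow> square_integrable M (\<lambda>x. c *\<^sub>R f x)"
  by (rule square_integrable_bound[of M f _ "\<bar>c\<bar>"]) (auto simp: square_integrable_def)

lemma square_integrable_cmult:
  fixes f :: "'a \<Rightarrow> real"
  shows "square_integrable M f \<Longrightarrow> square_integrable M (\<lambda>x. c * f x)"
  using square_integrable_scaleR[of M f c] by simp

lemma square_integrable_minus: "square_integrable M f \<Longrightarrow> square_integrable M (\<lambda>x. - f x)"
  by (auto simp: square_integrable_def)

lemma square_integrable_add:
  assumes f: "square_integrable M f" and g: "square_integrable M g"
  shows "square_integrable M (\<lambda>x. f x + g x)"
proof -
  note [measurable] = square_integrable_measurable[OF f] square_integrable_measurable[OF g]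
  have "integrable M (\<lambda>x. 2 * (norm (f x))\<^sup>2 + 2 * (norm (g x))\<^sup>2)"
    using f g by (simp add: square_integrable_def)
  then have "integrable M (\<lambda>x. (norm (f x + g x))\<^sup>2)"
    by (rule Bochner_Integration.integrable_bound) (auto simp: norm_add_sq_le)
  then show ?thesis by (simp add: square_integrable_def)
qed

lemma square_integrable_diff:
  "square_integrable M f \<Longrightarrow> square_integrable M g \<Longrightarrow> square_integrable M (\<lambda>x. f x - g x)"
  using square_integrable_add[of M f "\<lambda>x. - g x"] square_integrable_minus[of M g] by simp

lemma integrable_inner:
  assumes f: "square_integrable M f" and g: "square_integrable M g"
  shows "integrable M (\<lambda>x. f x \<bullet> g x)"
proof -
  note [measurable] = square_integrable_measurable[OF f] square_integrable_measurable[OF g]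
  have "integrable M (\<lambda>x. (norm (f x))\<^sup>2 + (norm (g x))\<^sup>2)"
    using f g by (simp add: square_integrable_def)
  then show ?thesis
  proof (rule Bochner_Integration.integrable_bound)
    have "norm (f x \<bullet> g x) \<le> norm ((norm (f x))\<^sup>2 + (norm (g x))\<^sup>2)" for x
    proof -
      have "norm (f x \<bullet> g x) \<le> norm (f x) * norm (g x)" by (simp add: Cauchy_Schwarz_ineq2)
      also have "\<dots> \<le> (norm (f x))\<^sup>2 + (norm (g x))\<^sup>2"
        using sum_squares_bound[of "norm (f x)" "norm (g x)"]
          mult_nonneg_nonneg[OF norm_ge_zero[of "f x"] norm_ge_zero[of "g x"]] by linarith
      finally show ?thesis by simp
    qed
    then show "AE x in M. norm (f x \<bullet> g x) \<le> norm ((norm (f x))\<^sup>2 + (norm (g x))\<^sup>2)" by simp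
  qed measurable
qed

lemma integrable_mult_L2:
  fixes f g :: "'a \<Rightarrow> real"
  shows "square_integrable M f \<Longrightarrow> square_integrable M g \<Longrightarrow> integrable M (\<lambda>x. f x * g x)"
  using integrable_inner[of M f g] by simp

lemma sqnorm_nonneg: "0 \<le> sqnorm M f"
  by (simp add: sqnorm_def)

lemma sqnorm_scaleR: "sqnorm M (\<lambda>x. c *\<^sub>R f x) = c\<^sup>2 * sqnorm M f"
  by (simp add: sqnorm_def power_mult_distrib)

lemma sqnorm_minus_commute: "sqnorm M (\<lambda>x. f x - g x) = sqnorm M (\<lambda>x. g x - f x)"
  by (simp add: sqnorm_def norm_minus_commute)

lemma sqnorm_add:
  assumes f: "square_integrable M f" and g: "square_integrable M g"
  shows "sqnorm M (\<lambda>x. f x + g x) = sqnorm M f + 2 * (LINT x|M. f x \<bullet> g x) + sqnorm M g"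
proof -
  have "sqnorm M (\<lambda>x. f x + g x) =
      (LINT x|M. ((norm (f x))\<^sup>2 + 2 * (f x \<bullet> g x)) + (norm (g x))\<^sup>2)"
    unfolding sqnorm_def
    by (intro Bochner_Integration.integral_cong)
      (simp_all add: power2_norm_eq_inner inner_simps inner_commute)
  also have "\<dots> = (LINT x|M. (norm (f x))\<^sup>2) + (LINT x|M. 2 * (f x \<bullet> g x)) + sqnorm M g"
    using square_integrable_sq[OF f] square_integrable_sq[OF g] integrable_inner[OF f g]
    by (simp add: sqnorm_def)
  finally show ?thesis by (simp add: sqnorm_def)
qed

lemma sqnorm_add_le:
  assumes f: "square_integrable M f" and g: "square_integrable M g"
  shows "sqnorm M (\<lambda>x. f x + g x) \<le> 2 * sqnorm M f + 2 * sqnorm M g"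
proof -
  have "sqnorm M (\<lambda>x. f x + g x) \<le> (LINT x|M. 2 * (norm (f x))\<^sup>2 + 2 * (norm (g x))\<^sup>2)"
    unfolding sqnorm_def using f g
    by (intro integral_mono square_integrable_sq square_integrable_add norm_add_sq_le
        Bochner_Integration.integrable_add integrable_mult_right)
  then show ?thesis using square_integrable_sq[OF f] square_integrable_sq[OF g]
    by (simp add: sqnorm_def)
qed

lemma sqnorm_diff_le:
  assumes f: "square_integrable M f" and g: "square_integrable M g"
  shows "sqnorm M (\<lambda>x. f x - g x) \<le> 2 * sqnorm M f + 2 * sqnorm M g"
  using sqnorm_add_le[OF f square_integrable_minus[OF g]] by (simp add: sqnorm_def)

lemma sqnorm_mono:
  assumes "square_integrable M f" "g \<in> borel_measurable M" "AE x in M. norm (g x) \<le> norm (f x)"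
  shows "sqnorm M g \<le> sqnorm M f"
proof -
  have "square_integrable M g"
    by (rule square_integrable_bound[OF assms(1,2), of 1]) (use assms(3) in simp)
  then show ?thesis
    unfolding sqnorm_def using assms
    by (intro integral_mono_AE square_integrable_sq) (auto simp: power_mono)
qed

text \<open>The discriminant of a nonnegative quadratic polynomial is not positive. This yields the
Cauchy-Schwarz inequality for integrals here and for the energy form below.\<close>

lemma abs_le_sqrt_mult_of_nonneg_quadratic:
  fixes a b c :: real
  assumes quad: "\<And>t. 0 \<le> a + 2 * t * b + t\<^sup>2 * c" and "0 \<le> a" "0 \<le> c"
  shows "\<bar>b\<bar> \<le> sqrt a * sqrt c"
proof -
  have "b\<^sup>2 \<le> a * c"
  proof (cases "c = 0")
    case True
    have "b = 0"
    proof (rule ccontr)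
      assume "b \<noteq> 0"
      then have "2 * (- (a + 1) / (2 * b)) * b = - (a + 1)" by simp
      then show False using quad[of "- (a + 1) / (2 * b)"] True by simp
    qed
    then show ?thesis using True by simp
  next
    case False
    have "0 \<le> c * (a + 2 * (- b / c) * b + (- b / c)\<^sup>2 * c)"
      using quad[of "- b / c"] \<open>0 \<le> c\<close> by simp
    also have "\<dots> = a * c - b\<^sup>2" using False by (simp add: field_simps power2_eq_square)
    finally show ?thesis by simp
  qed
  then have "\<bar>b\<bar> \<le> sqrt (a * c)" using real_le_rsqrt[of "\<bar>b\<bar>"] by simp
  then show ?thesis by (simp add: real_sqrt_mult)
qed

lemma Cauchy_Schwarz_integral:
  assumes f: "square_integrable M f" and g: "square_integrable M g"
  shows "\<bar>LINT x|M. f x \<bullet> g x\<bar> \<le> sqrt (sqnorm M f) * sqrt (sqnorm M g)"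
proof (rule abs_le_sqrt_mult_of_nonneg_quadratic)
  fix t
  have "0 \<le> sqnorm M (\<lambda>x. f x + t *\<^sub>R g x)" by (rule sqnorm_nonneg)
  also have "\<dots> = sqnorm M f + 2 * t * (LINT x|M. f x \<bullet> g x) + t\<^sup>2 * sqnorm M g"
    using sqnorm_add[OF f square_integrable_scaleR[OF g, of t]] by (simp add: sqnorm_scaleR)
  finally show "0 \<le> sqnorm M f + 2 * t * (LINT x|M. f x \<bullet> g x) + t\<^sup>2 * sqnorm M g" .
qed (rule sqnorm_nonneg)+

lemma L2_tendstoI:
  assumes "\<And>k. square_integrable M (f k)" "square_integrable M g"
    and "(\<lambda>k. sqnorm M (\<lambda>x. f k x - g x)) \<longlonglongrightarrow> 0"
  shows "L2_tendsto M f g"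
  using assms by (simp add: L2_tendsto_def)

lemma L2_tendstoD:
  assumes "L2_tendsto M f g"
  shows "square_integrable M (f k)" "square_integrable M g"
    "(\<lambda>k. sqnorm M (\<lambda>x. f k x - g x)) \<longlonglongrightarrow> 0"
  using assms by (auto simp: L2_tendsto_def)

lemma L2_tendsto_inner:
  assumes f: "L2_tendsto M f f'" and g: "L2_tendsto M g g'"
  shows "(\<lambda>k. LINT x|M. f k x \<bullet> g k x) \<longlonglongrightarrow> (LINT x|M. f' x \<bullet> g' x)"
proof -
  note f1 = L2_tendstoD[OF f] and g1 = L2_tendstoD[OF g]
  define F G where "F k = (\<lambda>x. f k x - f' x)" and "G k = (\<lambda>x. g k x - g' x)" for k
  have F: "square_integrable M (F k)" and G: "square_integrable M (G k)" for k
    unfolding F_def G_def by (intro square_integrable_diff f1 g1)+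
  have F0: "(\<lambda>k. sqnorm M (F k)) \<longlonglongrightarrow> 0" and G0: "(\<lambda>k. sqnorm M (G k)) \<longlonglongrightarrow> 0"
    unfolding F_def G_def by (rule f1 g1)+
  have eq: "(LINT x|M. f k x \<bullet> g k x) - (LINT x|M. f' x \<bullet> g' x) =
      (LINT x|M. F k x \<bullet> G k x) + (LINT x|M. F k x \<bullet> g' x) + (LINT x|M. f' x \<bullet> G k x)" for k
  proof -
    have "(LINT x|M. f k x \<bullet> g k x) - (LINT x|M. f' x \<bullet> g' x) =
        (LINT x|M. f k x \<bullet> g k x - f' x \<bullet> g' x)"
      by (intro Bochner_Integration.integral_diff[symmetric] integrable_inner f1 g1)
    also have "\<dots> = (LINT x|M. (F k x \<bullet> G k x + F k x \<bullet> g' x) + f' x \<bullet> G k x)"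
      by (intro Bochner_Integration.integral_cong)
        (simp_all add: F_def G_def inner_simps)
    also have "\<dots> = (LINT x|M. F k x \<bullet> G k x) + (LINT x|M. F k x \<bullet> g' x) + (LINT x|M. f' x \<bullet> G k x)"
      using integrable_inner[OF F[of k] G[of k]] integrable_inner[OF F[of k] g1(2)]
        integrable_inner[OF f1(2) G[of k]] by simp
    finally show ?thesis .
  qed
  have "(\<lambda>k. sqrt (sqnorm M (F k)) * sqrt (sqnorm M (G k)) + sqrt (sqnorm M (F k)) * sqrt (sqnorm M g')
      + sqrt (sqnorm M f') * sqrt (sqnorm M (G k))) \<longlonglongrightarrow>
      sqrt 0 * sqrt 0 + sqrt 0 * sqrt (sqnorm M g') + sqrt (sqnorm M f') * sqrt 0"
    by (intro tendsto_intros F0 G0)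
  then have lim: "(\<lambda>k. sqrt (sqnorm M (F k)) * sqrt (sqnorm M (G k)) + sqrt (sqnorm M (F k)) * sqrt (sqnorm M g')
      + sqrt (sqnorm M f') * sqrt (sqnorm M (G k))) \<longlonglongrightarrow> 0" by simp
  have "(\<lambda>k. (LINT x|M. f k x \<bullet> g k x) - (LINT x|M. f' x \<bullet> g' x)) \<longlonglongrightarrow> 0"
  proof (rule Lim_null_comparison[OF always_eventually lim], rule allI)
    fix k
    show "norm ((LINT x|M. f k x \<bullet> g k x) - (LINT x|M. f' x \<bullet> g' x)) \<le>
      sqrt (sqnorm M (F k)) * sqrt (sqnorm M (G k)) + sqrt (sqnorm M (F k)) * sqrt (sqnorm M g')
      + sqrt (sqnorm M f') * sqrt (sqnorm M (G k))"
      unfolding eq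
      using Cauchy_Schwarz_integral[OF F[of k] G[of k]] Cauchy_Schwarz_integral[OF F[of k] g1(2)]
        Cauchy_Schwarz_integral[OF f1(2) G[of k]] by (simp only: real_norm_def)
  qed
  then show ?thesis by (rule LIM_zero_cancel)
qed

lemma L2_tendsto_sqnorm:
  assumes "L2_tendsto M f f'" shows "(\<lambda>k. sqnorm M (f k)) \<longlonglongrightarrow> sqnorm M f'"
  using L2_tendsto_inner[OF assms assms] by (simp add: sqnorm_def power2_norm_eq_inner)

text \<open>Operations that are Lipschitz pointwise preserve convergence in \<open>L\<^sup>2\<close>. This covers coefficient
matrices, absolute values, logarithms bounded away from their singularity, and truncations.\<close>

lemma L2_tendsto_bound:
  assumes f: "L2_tendsto M f f'"
    and sq: "\<And>k. square_integrable M (g k)" "square_integrable M g'"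
    and le: "\<And>k x. x \<in> space M \<Longrightarrow> norm (g k x - g' x) \<le> C * norm (f k x - f' x)"
  shows "L2_tendsto M g g'"
proof (rule L2_tendstoI[OF sq])
  note f1 = L2_tendstoD[OF f]
  have "(\<lambda>k. C\<^sup>2 * sqnorm M (\<lambda>x. f k x - f' x)) \<longlonglongrightarrow> 0"
    using tendsto_mult_right_zero[OF f1(3)] by simp
  then show "(\<lambda>k. sqnorm M (\<lambda>x. g k x - g' x)) \<longlonglongrightarrow> 0"
  proof (rule tendsto_sandwich[OF always_eventually always_eventually tendsto_const, rotated 2], safe)
    fix k
    have "sqnorm M (\<lambda>x. g k x - g' x) \<le> sqnorm M (\<lambda>x. C *\<^sub>R (f k x - f' x))"
    proof (rule sqnorm_mono)
      show "(\<lambda>x. g k x - g' x) \<in> borel_measurable M"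
        using square_integrable_diff[OF sq] by (rule square_integrable_measurable)
      show "AE x in M. norm (g k x - g' x) \<le> norm (C *\<^sub>R (f k x - f' x))"
      proof (rule AE_I2)
        fix x assume "x \<in> space M"
        then have "norm (g k x - g' x) \<le> C * norm (f k x - f' x)" by (rule le)
        also have "\<dots> \<le> \<bar>C\<bar> * norm (f k x - f' x)" by (simp add: mult_right_mono)
        finally show "norm (g k x - g' x) \<le> norm (C *\<^sub>R (f k x - f' x))" by simp
      qed
    qed (intro square_integrable_scaleR square_integrable_diff f1)
    then show "sqnorm M (\<lambda>x. g k x - g' x) \<le> C\<^sup>2 * sqnorm M (\<lambda>x. f k x - f' x)"
      by (simp only: sqnorm_scaleR)
  qed (rule sqnorm_nonneg)
qed

lemma L2_tendsto_scaleR: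
  assumes "L2_tendsto M f f'" shows "L2_tendsto M (\<lambda>k x. c *\<^sub>R f k x) (\<lambda>x. c *\<^sub>R f' x)"
  by (rule L2_tendsto_bound[OF assms, of _ _ "\<bar>c\<bar>"])
    (auto intro: square_integrable_scaleR L2_tendstoD[OF assms] simp: scaleR_diff_right[symmetric])

lemma L2_tendsto_add:
  assumes f: "L2_tendsto M f f'" and g: "L2_tendsto M g g'"
  shows "L2_tendsto M (\<lambda>k x. f k x + g k x) (\<lambda>x. f' x + g' x)"
proof (rule L2_tendstoI)
  note f1 = L2_tendstoD[OF f] and g1 = L2_tendstoD[OF g]
  show "square_integrable M (\<lambda>x. f k x + g k x)" "square_integrable M (\<lambda>x. f' x + g' x)" for k
    by (intro square_integrable_add f1 g1)+
  have lim: "(\<lambda>k. 2 * sqnorm M (\<lambda>x. f k x - f' x) + 2 * sqnorm M (\<lambda>x. g k x - g' x)) \<longlonglongrightarrow> 0"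
    using tendsto_add[OF tendsto_mult_right_zero[OF f1(3)] tendsto_mult_right_zero[OF g1(3)]] by simp
  show "(\<lambda>k. sqnorm M (\<lambda>x. f k x + g k x - (f' x + g' x))) \<longlonglongrightarrow> 0"
  proof (rule tendsto_sandwich[OF always_eventually always_eventually tendsto_const lim]; safe)
    fix k
    show "sqnorm M (\<lambda>x. f k x + g k x - (f' x + g' x)) \<le>
        2 * sqnorm M (\<lambda>x. f k x - f' x) + 2 * sqnorm M (\<lambda>x. g k x - g' x)"
      using sqnorm_add_le[OF square_integrable_diff[OF f1(1)[of k] f1(2)]
          square_integrable_diff[OF g1(1)[of k] g1(2)]]
      by (simp add: algebra_simps)
  qed (rule sqnorm_nonneg)
qed

lemma (in finite_measure) square_integrable_const: "square_integrable M (\<lambda>x. c)"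
  by (simp add: square_integrable_def)

lemma (in finite_measure) integrable_L2:
  fixes f :: "'a \<Rightarrow> real"
  assumes "square_integrable M f" shows "integrable M f"
  using integrable_inner[OF assms square_integrable_const[of 1]] by simp

lemma (in finite_measure) integral_sq_le:
  fixes f :: "'a \<Rightarrow> real"
  assumes "square_integrable M f"
  shows "(LINT x|M. \<bar>f x\<bar>)\<^sup>2 \<le> measure M (space M) * sqnorm M f"
proof -
  have sq: "square_integrable M (\<lambda>x. \<bar>f x\<bar>)"
    using assms by (auto simp: square_integrable_def)
  have "\<bar>LINT x|M. \<bar>f x\<bar>\<bar> \<le> sqrt (sqnorm M f) * sqrt (measure M (space M))"
    using Cauchy_Schwarz_integral[OF sq square_integrable_const[of "1 :: real"]]
    by (simp add: sqnorm_def)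
  then have "\<bar>LINT x|M. \<bar>f x\<bar>\<bar>\<^sup>2 \<le> (sqrt (sqnorm M f) * sqrt (measure M (space M)))\<^sup>2"
    by (rule power_mono) simp
  then show ?thesis
    by (simp add: power_mult_distrib sqnorm_nonneg mult.commute)
qed

text \<open>On a finite measure space an \<open>L\<^sup>2\<close> Cauchy sequence is \<open>L\<^sup>1\<close> Cauchy, hence has a subsequence that
converges almost everywhere. By Fatou's lemma the pointwise limit is the \<open>L\<^sup>2\<close> limit of the whole
sequence.\<close>

lemma (in finite_measure) L2_complete:
  fixes f :: "nat \<Rightarrow> 'a \<Rightarrow> real"
  assumes sq: "\<And>k. square_integrable M (f k)"
    and Cauchy: "\<And>e. 0 < e \<Longrightarrow> \<exists>N. \<forall>i\<ge>N. \<forall>j\<ge>N. sqnorm M (\<lambda>x. f i x - f j x) < e"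
  obtains g r where "L2_tendsto M f g" "strict_mono r" "AE x in M. (\<lambda>k. f (r k) x) \<longlonglongrightarrow> g x"
proof -
  note [measurable] = square_integrable_measurable[OF sq]
  define m where "m = measure M (space M) + 1"
  have m: "0 < m" "measure M (space M) \<le> m" by (simp_all add: m_def add_nonneg_pos)
  have L1: "\<exists>N. \<forall>i\<ge>N. \<forall>j\<ge>N. LINT x|M. norm (f i x - f j x) < e" if "0 < e" for e
  proof -
    have "0 < e\<^sup>2 / m" using that m by simp
    from Cauchy[OF this] obtain N
      where N: "\<And>i j. N \<le> i \<Longrightarrow> N \<le> j \<Longrightarrow> sqnorm M (\<lambda>x. f i x - f j x) < e\<^sup>2 / m" by blast
    have "(LINT x|M. norm (f i x - f j x)) < e" if "N \<le> i" "N \<le> j" for i j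
    proof -
      have "(LINT x|M. \<bar>f i x - f j x\<bar>)\<^sup>2 \<le> measure M (space M) * sqnorm M (\<lambda>x. f i x - f j x)"
        by (rule integral_sq_le[OF square_integrable_diff[OF sq sq]])
      also have "\<dots> \<le> m * sqnorm M (\<lambda>x. f i x - f j x)"
        by (rule mult_right_mono[OF m(2) sqnorm_nonneg])
      also have "\<dots> < e\<^sup>2" using N[OF that] m(1) by (simp add: field_simps)
      finally show ?thesis using \<open>0 < e\<close> by (simp add: power_less_imp_less_base)
    qed
    then show ?thesis by blast
  qed
  obtain r where r: "strict_mono r" and AEC: "AE x in M. Cauchy (\<lambda>i. f (r i) x)"
    by (rule cauchy_L1_AE_cauchy_subseq[OF integrable_L2[OF sq] L1])
  define g where "g x = lim (\<lambda>i. f (r i) x)" for x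
  have [measurable]: "g \<in> borel_measurable M"
    unfolding g_def by (rule borel_measurable_lim_metric) measurable
  have AEg: "AE x in M. (\<lambda>k. f (r k) x) \<longlonglongrightarrow> g x"
    using AEC by eventually_elim (simp add: g_def Cauchy_convergent convergent_LIMSEQ_iff[symmetric])
  have le: "\<exists>N. \<forall>n\<ge>N. (\<integral>\<^sup>+ x. ennreal ((f n x - g x)\<^sup>2) \<partial>M) \<le> ennreal e" if "0 < e" for e
  proof -
    obtain N where N: "\<And>i j. N \<le> i \<Longrightarrow> N \<le> j \<Longrightarrow> sqnorm M (\<lambda>x. f i x - f j x) < e"
      using Cauchy[OF \<open>0 < e\<close>] by blast
    have "(\<integral>\<^sup>+ x. ennreal ((f n x - g x)\<^sup>2) \<partial>M) \<le> ennreal e" if "N \<le> n" for n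
    proof -
      have "(\<integral>\<^sup>+ x. ennreal ((f n x - g x)\<^sup>2) \<partial>M) =
          (\<integral>\<^sup>+ x. liminf (\<lambda>i. ennreal ((f n x - f (r i) x)\<^sup>2)) \<partial>M)"
      proof (rule nn_integral_cong_AE, use AEg in eventually_elim)
        case (elim x)
        have "(\<lambda>i. ennreal ((f n x - f (r i) x)\<^sup>2)) \<longlonglongrightarrow> ennreal ((f n x - g x)\<^sup>2)"
          by (intro tendsto_ennrealI tendsto_intros elim)
        then show ?case by (rule lim_imp_Liminf[OF sequentially_bot, symmetric])
      qed
      also have "\<dots> \<le> liminf (\<lambda>i. \<integral>\<^sup>+ x. ennreal ((f n x - f (r i) x)\<^sup>2) \<partial>M)"
        by (rule nn_integral_liminf) measurable
      also have "\<dots> \<le> ennreal e"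
      proof (rule order_trans[OF Liminf_le_Limsup[OF sequentially_bot] Limsup_bounded],
          rule eventually_mono[OF eventually_ge_at_top[of N]])
        fix i assume "N \<le> i"
        then have "N \<le> r i" using seq_suble[OF r, of i] by linarith
        have "(\<integral>\<^sup>+ x. ennreal ((f n x - f (r i) x)\<^sup>2) \<partial>M) = ennreal (sqnorm M (\<lambda>x. f n x - f (r i) x))"
          unfolding sqnorm_def
          using square_integrable_sq[OF square_integrable_diff[OF sq[of n] sq[of "r i"]]]
          by (subst nn_integral_eq_integral[symmetric]) auto
        also have "\<dots> \<le> ennreal e"
          using N[OF \<open>N \<le> n\<close> \<open>N \<le> r i\<close>] by (intro ennreal_leI) simp
        finally show "(\<integral>\<^sup>+ x. ennreal ((f n x - f (r i) x)\<^sup>2) \<partial>M) \<le> ennreal e" .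
      qed
      finally show ?thesis .
    qed
    then show ?thesis by blast
  qed
  have fin: "square_integrable M (\<lambda>x. f n x - g x) \<and> sqnorm M (\<lambda>x. f n x - g x) \<le> e"
    if "0 < e" "(\<integral>\<^sup>+ x. ennreal ((f n x - g x)\<^sup>2) \<partial>M) \<le> ennreal e" for n e
  proof
    have "(\<integral>\<^sup>+ x. ennreal ((f n x - g x)\<^sup>2) \<partial>M) < \<infinity>"
      using that(2) by (simp add: le_less_trans[OF _ ennreal_less_top])
    then have int: "integrable M (\<lambda>x. (f n x - g x)\<^sup>2)"
      by (intro integrableI_bounded) auto
    then show "square_integrable M (\<lambda>x. f n x - g x)" by (simp add: square_integrable_def)
    have "ennreal (sqnorm M (\<lambda>x. f n x - g x)) = (\<integral>\<^sup>+ x. ennreal ((f n x - g x)\<^sup>2) \<partial>M)"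
      unfolding sqnorm_def using int by (subst nn_integral_eq_integral) auto
    then show "sqnorm M (\<lambda>x. f n x - g x) \<le> e"
      using that by (metis ennreal_le_iff less_imp_le)
  qed
  have sqg: "square_integrable M g"
  proof -
    obtain N where "(\<integral>\<^sup>+ x. ennreal ((f N x - g x)\<^sup>2) \<partial>M) \<le> ennreal 1"
      using le[of 1] by auto
    from square_integrable_diff[OF sq[of N] fin[THEN conjunct1, OF _ this]]
    show ?thesis by simp
  qed
  have "(\<lambda>k. sqnorm M (\<lambda>x. f k x - g x)) \<longlonglongrightarrow> 0"
  proof (rule LIMSEQ_I)
    fix e :: real assume "0 < e"
    obtain N where "\<forall>n\<ge>N. (\<integral>\<^sup>+ x. ennreal ((f n x - g x)\<^sup>2) \<partial>M) \<le> ennreal (e / 2)"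
      using le[of "e / 2"] \<open>0 < e\<close> by auto
    then have "\<forall>n\<ge>N. sqnorm M (\<lambda>x. f n x - g x) \<le> e / 2"
      using fin[of "e / 2"] \<open>0 < e\<close> by auto
    then have "\<forall>n\<ge>N. norm (sqnorm M (\<lambda>x. f n x - g x) - 0) < e"
      using \<open>0 < e\<close> sqnorm_nonneg[of M "\<lambda>x. f n x - g x" for n]
      by (simp add: order_le_less_trans[where y="e / 2"])
    then show "\<exists>N. \<forall>n\<ge>N. norm (sqnorm M (\<lambda>x. f n x - g x) - 0) < e" by blast
  qed
  with sq sqg have "L2_tendsto M f g" by (rule L2_tendstoI)
  with r AEg show thesis by (intro that)
qed

section \<open>Weak gradients of test functions\<close>

lemma continuous_imp_borel_measurable_lebesgue_on:
  fixes f :: "real ^ 'n \<Rightarrow> 'b::euclidean_space"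
  assumes "continuous_on UNIV f"
  shows "f \<in> borel_measurable (lebesgue_on S)"
  using borel_measurable_continuous_onI[OF assms] borel_measurable_subalgebra
  by (intro measurable_restrict_space1 measurable_completion) auto

lemma finite_measure_lebesgue_on_bounded:
  assumes "open S" "bounded S" shows "finite_measure (lebesgue_on S)"
  using assms by (intro finite_measure_lebesgue_on lmeasurable_open)

lemma integral_lebesgue_on_eq_lborel:
  fixes f :: "real ^ 'n \<Rightarrow> real"
  assumes "f \<in> borel_measurable borel" "S \<in> sets lebesgue" "\<And>x. x \<notin> S \<Longrightarrow> f x = 0"
  shows "(LINT x|lebesgue_on S. f x) = (LINT x|lborel. f x)"
proof -
  have "(LINT x|lebesgue_on S. f x) = (LINT x|lebesgue. indicator S x *\<^sub>R f x)"
    using assms(2) by (simp add: integral_restrict_space)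
  also have "(\<lambda>x. indicator S x *\<^sub>R f x) = f"
    by (rule ext) (use assms(3) in \<open>auto simp: indicator_def\<close>)
  finally show ?thesis using assms(1) by (simp add: integral_completion)
qed

lemma test_function_square_integrable:
  assumes "finite_measure (lebesgue_on \<Omega>)" and \<phi>: "\<phi> \<in> test_functions \<Omega>"
  shows "square_integrable (lebesgue_on \<Omega>) \<phi>" and "square_integrable (lebesgue_on \<Omega>) (grad \<phi>)"
proof -
  interpret finite_measure "lebesgue_on \<Omega>" by fact
  obtain B where B: "\<And>x. \<bar>\<phi> x\<bar> \<le> B" "\<And>x. norm (grad \<phi> x) \<le> B"
    using test_function_bounded[OF \<phi>] by blast
  show "square_integrable (lebesgue_on \<Omega>) \<phi>" "square_integrable (lebesgue_on \<Omega>) (grad \<phi>)"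
    by (rule square_integrable_bound[OF square_integrable_const[of "1 :: real"], of _ B],
        intro continuous_imp_borel_measurable_lebesgue_on test_function_continuous[OF \<phi>]
          test_function_grad_continuous[OF \<phi>], use B in simp)+
qed

lemma GDERIV_bounded_imp_lipschitz:
  fixes f :: "real ^ 'n \<Rightarrow> real"
  assumes "\<And>x. GDERIV f x :> D x" "\<And>x. norm (D x) \<le> B"
  shows "\<bar>f y - f x\<bar> \<le> B * norm (y - x)"
proof -
  have "norm (f y - f x) \<le> B * norm (y - x)"
  proof (rule differentiable_bound[of UNIV f "\<lambda>x h. h \<bullet> D x"])
    show "(f has_derivative (\<lambda>h. h \<bullet> D x)) (at x within UNIV)" for x
      using assms(1) by (simp add: gderiv_def)
    show "onorm (\<lambda>h. h \<bullet> D x) \<le> B" for x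
    proof (rule onorm_le)
      fix h
      have "norm (h \<bullet> D x) \<le> norm h * norm (D x)" by (simp add: Cauchy_Schwarz_ineq2)
      also have "\<dots> \<le> norm h * B" using assms(2) by (simp add: mult_left_mono)
      finally show "norm (h \<bullet> D x) \<le> B * norm h" by (simp add: mult.commute)
    qed
  qed auto
  then show ?thesis by simp
qed

text \<open>Translations preserve Lebesgue measure, so every difference quotient has integral zero. The
quotients are bounded by the Lipschitz constant on a fixed ball and vanish outside it, and dominated
convergence passes to the derivative.\<close>

lemma integral_partial_derivative_eq_0:
  assumes \<Omega>: "open \<Omega>" "bounded \<Omega>" and f: "f \<in> test_functions \<Omega>"
  shows "(LINT x|lebesgue_on \<Omega>. grad f x $ i) = 0"
proof -
  obtain B where B: "0 \<le> B" "\<And>x. \<bar>f x\<bar> \<le> B" "\<And>x. norm (grad f x) \<le> B"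
    using test_function_bounded[OF f] by blast
  obtain K where K: "compact K" "K \<subseteq> \<Omega>" "\<forall>x. x \<notin> K \<longrightarrow> f x = 0 \<and> grad f x = 0"
    using test_function_support[OF f] by blast
  obtain R where "\<forall>x\<in>K. norm x \<le> R"
    using compact_imp_bounded[OF K(1)] unfolding bounded_iff by blast
  then have R: "K \<subseteq> cball 0 R" by auto
  have [measurable]: "f \<in> borel_measurable borel" "(\<lambda>x. grad f x $ i) \<in> borel_measurable borel"
    by (rule borel_measurable_continuous_onI[OF test_function_continuous[OF f]])
      (rule borel_measurable_continuous_onI[OF continuous_on_component[OF test_function_grad_continuous[OF f]]])
  let ?e = "axis i (1::real)"
  define q where "q m x = (f (x + inverse (real (Suc m)) *\<^sub>R ?e) - f x) * real (Suc m)" for m x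
  have int: "integrable lborel f"
  proof (rule Bochner_Integration.integrable_bound[of _ "\<lambda>x. B * indicator (cball 0 R) x"])
    show "integrable lborel (\<lambda>x. B * indicator (cball 0 R) x :: real)"
      using emeasure_bounded_finite[OF bounded_cball] by (intro integrable_mult_right integrable_real_indicator) auto
    have "norm (f x) \<le> norm (B * indicator (cball 0 R) x)" for x
    proof (cases "x \<in> K")
      case True
      then show ?thesis using R B(1) B(2)[of x] by (auto simp: indicator_def)
    qed (use K(3) in simp)
    then show "AE x in lborel. norm (f x) \<le> norm (B * indicator (cball 0 R) x :: real)" by simp
  qed simp
  have q0: "(LINT x|lborel. q m x) = 0" for m
  proof -
    let ?t = "inverse (real (Suc m)) *\<^sub>R ?e"
    have "integrable (distr lborel borel ((+) ?t)) f" using int by (simp add: lborel_distr_plus)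
    then have int': "integrable lborel (\<lambda>x. f (?t + x))" by (simp add: integrable_distr_eq)
    have "(LINT x|lborel. f (?t + x)) = (LINT x|distr lborel borel ((+) ?t). f x)"
      by (simp add: integral_distr)
    then have "(LINT x|lborel. f (?t + x)) = (LINT x|lborel. f x)" by (simp add: lborel_distr_plus)
    then show ?thesis
      unfolding q_def using int int' by (simp add: add.commute del: of_nat_Suc)
  qed
  have qlim: "(\<lambda>m. q m x) \<longlonglongrightarrow> grad f x $ i" for x
  proof -
    have "GDERIV (\<lambda>t. f (x + t *\<^sub>R ?e)) 0 :> grad f x $ i"
    proof -
      have 1: "((\<lambda>t. x + t *\<^sub>R ?e) has_derivative (\<lambda>t. t *\<^sub>R ?e)) (at 0)"
        by (auto intro!: derivative_eq_intros)
      have 2: "(f has_derivative (\<lambda>h. h \<bullet> grad f x)) (at (x + 0 *\<^sub>R ?e))"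
        using test_function_GDERIV[OF f] by (simp add: gderiv_def)
      show ?thesis
        unfolding gderiv_def
        by (rule has_derivative_eq_rhs[OF has_derivative_compose[OF 1 2]]) (simp add: inner_axis')
    qed
    then have "((\<lambda>t. f (x + t *\<^sub>R ?e)) has_real_derivative grad f x $ i) (at 0)"
      unfolding gderiv_def has_field_derivative_def by (rule has_derivative_eq_rhs) auto
    then have "(\<lambda>h. (f (x + h *\<^sub>R ?e) - f x) / h) \<midarrow>0\<rightarrow> grad f x $ i"
      by (simp add: DERIV_def)
    moreover have "filterlim (\<lambda>m. inverse (real (Suc m))) (at 0) sequentially"
      using LIMSEQ_inverse_real_of_nat by (simp add: filterlim_at)
    ultimately have "(\<lambda>m. (f (x + inverse (real (Suc m)) *\<^sub>R ?e) - f x) / inverse (real (Suc m)))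
        \<longlonglongrightarrow> grad f x $ i"
      by (rule filterlim_compose)
    then show ?thesis by (simp add: q_def divide_inverse del: of_nat_Suc)
  qed
  have qb: "norm (q m x) \<le> B * indicator (cball 0 (R + 1)) x" for m x
  proof (cases "x \<in> cball 0 (R + 1)")
    case True
    have "\<bar>f (x + inverse (real (Suc m)) *\<^sub>R ?e) - f x\<bar> \<le>
        B * norm (x + inverse (real (Suc m)) *\<^sub>R ?e - x)"
      by (rule GDERIV_bounded_imp_lipschitz[OF test_function_GDERIV[OF f] B(3)])
    also have "\<dots> = B * inverse (real (Suc m))" by (simp del: of_nat_Suc)
    finally have "\<bar>q m x\<bar> \<le> B * inverse (real (Suc m)) * real (Suc m)"
      unfolding q_def by (simp add: abs_mult mult_right_mono del: of_nat_Suc)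
    then show ?thesis using True by (simp add: mult.assoc del: of_nat_Suc)
  next
    case False
    let ?t = "inverse (real (Suc m)) *\<^sub>R ?e"
    have "inverse (real (Suc m)) \<le> 1" by (simp add: field_simps)
    then have "norm ?t \<le> 1" by (simp del: of_nat_Suc)
    then have "R < norm (x + ?t)" using False norm_triangle_ineq2[of x "- ?t"] by simp
    then have "x + ?t \<notin> K" "x \<notin> K" using R False by force+
    then show ?thesis using K(3) B(1) by (simp add: q_def indicator_def del: of_nat_Suc)
  qed
  have "(\<lambda>m. LINT x|lborel. q m x) \<longlonglongrightarrow> (LINT x|lborel. grad f x $ i)"
  proof (rule integral_dominated_convergence[where w="\<lambda>x. B * indicator (cball 0 (R + 1)) x"])
    show "q m \<in> borel_measurable lborel" for m unfolding q_def by measurable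
    show "integrable lborel (\<lambda>x. B * indicator (cball 0 (R + 1)) x :: real)"
      using emeasure_bounded_finite[OF bounded_cball] by (intro integrable_mult_right integrable_real_indicator) auto
  qed (use qlim qb in auto)
  then have "(LINT x|lborel. grad f x $ i) = 0"
    by (simp add: q0 LIMSEQ_const_iff)
  moreover have "(LINT x|lebesgue_on \<Omega>. grad f x $ i) = (LINT x|lborel. grad f x $ i)"
    using K(2,3) \<Omega>(1) by (intro integral_lebesgue_on_eq_lborel) auto
  ultimately show ?thesis by simp
qed

lemma grad_mult:
  assumes "\<phi> \<in> test_functions \<Omega>" "\<psi> \<in> test_functions \<Omega>"
  shows "grad (\<lambda>x. \<phi> x * \<psi> x) x = \<phi> x *\<^sub>R grad \<psi> x + \<psi> x *\<^sub>R grad \<phi> x"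
  by (intro GDERIV_imp_grad_eq GDERIV_mult test_function_GDERIV[OF assms(1)] test_function_GDERIV[OF assms(2)])

lemma square_integrable_component:
  fixes f :: "'a \<Rightarrow> real ^ 'n"
  assumes "square_integrable M f" shows "square_integrable M (\<lambda>x. f x $ i)"
proof (rule square_integrable_bound[OF assms, of _ 1])
  have "(\<lambda>v :: real ^ 'n. v $ i) \<in> borel_measurable borel"
    by (intro borel_measurable_continuous_onI continuous_on_component continuous_on_id)
  from measurable_compose[OF square_integrable_measurable[OF assms] this]
  show "(\<lambda>x. f x $ i) \<in> borel_measurable M" .
qed (simp add: component_le_norm_cart)

text \<open>Integration by parts: the product of two test functions is one, and its partial derivatives have
integral zero.\<close>

lemma test_function_has_weak_gradient:
  assumes \<Omega>: "open \<Omega>" "bounded \<Omega>" and \<phi>: "\<phi> \<in> test_functions \<Omega>"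
  shows "has_weak_gradient \<Omega> \<phi> (grad \<phi>)"
  unfolding has_weak_gradient_def L2_iff
proof (intro conjI ballI allI)
  note fin = finite_measure_lebesgue_on_bounded[OF \<Omega>]
  note sq = test_function_square_integrable[OF fin]
  show "square_integrable (lebesgue_on \<Omega>) \<phi>" "square_integrable (lebesgue_on \<Omega>) (grad \<phi>)"
    by (rule sq[OF \<phi>])+
  fix \<psi> i assume \<psi>: "\<psi> \<in> test_functions \<Omega>"
  have "0 = (LINT x|lebesgue_on \<Omega>. grad (\<lambda>x. \<phi> x * \<psi> x) x $ i)"
    by (rule integral_partial_derivative_eq_0[symmetric, OF \<Omega> test_function_mult[OF \<psi> test_function_C_k[OF \<phi>]]])
  also have "\<dots> = (LINT x|lebesgue_on \<Omega>. \<phi> x * grad \<psi> x $ i + grad \<phi> x $ i * \<psi> x)"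
    by (simp add: grad_mult[OF \<phi> \<psi>] mult.commute)
  also have "\<dots> = (LINT x|lebesgue_on \<Omega>. \<phi> x * grad \<psi> x $ i) + (LINT x|lebesgue_on \<Omega>. grad \<phi> x $ i * \<psi> x)"
    by (intro Bochner_Integration.integral_add integrable_mult_L2 square_integrable_component sq \<phi> \<psi>)
  finally show "(LINT x|lebesgue_on \<Omega>. \<phi> x * grad \<psi> x $ i) = - (LINT x|lebesgue_on \<Omega>. grad \<phi> x $ i * \<psi> x)"
    by simp
qed

text \<open>Bumps turn the hypothesis into vanishing integrals over all boxes inside the domain. At almost
every point the function is the limit of its averages over shrinking boxes.\<close>

lemma AE_zero_if_orthogonal_to_test_functions:
  fixes h :: "real ^ 'n \<Rightarrow> real"
  assumes \<Omega>: "open \<Omega>" and h: "integrable (lebesgue_on \<Omega>) h"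
    and orth: "\<And>\<phi>. \<phi> \<in> test_functions \<Omega> \<Longrightarrow> (LINT x|lebesgue_on \<Omega>. h x * \<phi> x) = 0"
  shows "AE x in lebesgue_on \<Omega>. h x = 0"
proof -
  define F where "F x = indicator \<Omega> x * h x" for x
  have \<Omega>l: "\<Omega> \<in> sets lebesgue" using \<Omega> by auto
  have F: "integrable lebesgue F"
    using h \<Omega>l by (simp add: F_def[abs_def] integrable_restrict_space)
  then have [measurable]: "F \<in> borel_measurable lebesgue" by simp
  have "F integrable_on UNIV" using F by (rule integrable_on_lebesgue)
  then have Fcb: "F integrable_on cbox a b" for a b
    by (rule integrable_on_subcbox) simp
  have zero: "integral (cbox a b) F = 0" if ab: "cbox a b \<subseteq> \<Omega>" for a b
  proof -
    have bump: "(LINT x|lebesgue. box_bump (Suc m) a b x * F x) = 0" for m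
    proof -
      have "(LINT x|lebesgue. box_bump (Suc m) a b x * F x) =
          (LINT x|lebesgue. indicator \<Omega> x *\<^sub>R (h x * box_bump (Suc m) a b x))"
        by (rule Bochner_Integration.integral_cong) (auto simp: F_def)
      also have "\<dots> = (LINT x|lebesgue_on \<Omega>. h x * box_bump (Suc m) a b x)"
        using \<Omega>l by (simp add: integral_restrict_space)
      also have "\<dots> = 0" by (rule orth[OF test_function_box_bump[OF _ ab]]) simp
      finally show ?thesis .
    qed
    have [measurable]: "box_bump (Suc m) a b \<in> borel_measurable lebesgue" for m
      using continuous_imp_borel_measurable_lebesgue_on[of "box_bump (Suc m) a b" UNIV]
        C_k_box_bump[of 0 "Suc m" a b] by (simp del: of_nat_Suc)
    have [measurable]: "box a b \<in> sets lebesgue" "cbox a b \<in> sets lebesgue" by simp_all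
    have "(\<lambda>m. LINT x|lebesgue. box_bump (Suc m) a b x * F x) \<longlonglongrightarrow>
        (LINT x|lebesgue. indicator (box a b) x * F x)"
    proof (rule integral_dominated_convergence[where w="\<lambda>x. norm (F x)"])
      show "AE x in lebesgue. (\<lambda>m. box_bump (Suc m) a b x * F x) \<longlonglongrightarrow> indicator (box a b) x * F x"
        by (intro AE_I2 tendsto_mult_right box_bump_tendsto_indicator)
      show "AE x in lebesgue. norm (box_bump (Suc m) a b x * F x) \<le> norm (F x)" for m
        using box_bump_bounds[of "Suc m" a b] by (intro AE_I2) (simp add: abs_mult mult_left_le_one_le)
      show "(\<lambda>x. indicator (box a b) x * F x) \<in> borel_measurable lebesgue" by measurable
      show "(\<lambda>x. box_bump (Suc m) a b x * F x) \<in> borel_measurable lebesgue" for m by measurable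
    qed (use F in auto)
    from LIMSEQ_unique[OF this[unfolded bump] tendsto_const]
    have *: "(LINT x|lebesgue. indicator (box a b) x * F x) = 0" .
    have "integral (cbox a b) F = (LINT x|lebesgue_on (cbox a b). F x)"
      using F by (intro lebesgue_integral_eq_integral[symmetric])
        (auto simp: integrable_restrict_space intro: integrable_mult_indicator[where 'b=real, simplified])
    also have "\<dots> = (LINT x|lebesgue. indicator (cbox a b) x *\<^sub>R F x)"
      by (simp add: integral_restrict_space)
    also have "\<dots> = (LINT x|lebesgue. indicator (box a b) x * F x)"
    proof (rule integral_cong_AE)
      have "AE x in lebesgue. x \<notin> cbox a b - box a b"
        using negligible_frontier_interval[of a b] by (intro AE_not_in) (simp add: negligible_iff_null_sets)
      then show "AE x in lebesgue. indicator (cbox a b) x *\<^sub>R F x = indicator (box a b) x * F x"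
        by eventually_elim (auto simp: indicator_def box_subset_cbox[THEN subsetD])
    qed measurable
    finally show ?thesis using * by simp
  qed
  obtain N where N: "negligible N"
    "\<And>x e. \<lbrakk>x \<notin> N; 0 < e\<rbrakk> \<Longrightarrow> \<exists>d>0. \<forall>h. 0 < h \<and> h < d \<longrightarrow>
        norm (integral (cbox x (x + h *\<^sub>R One)) F /\<^sub>R h ^ DIM(real ^ 'n) - F x) < e"
    by (rule integrable_ccontinuous_explicit[OF Fcb]) (rule that)
  have "h x = 0" if x: "x \<in> \<Omega>" "x \<notin> N" for x
  proof (rule ccontr)
    assume "h x \<noteq> 0"
    then have "0 < norm (F x)" using x by (simp add: F_def)
    from N(2)[OF x(2) this] obtain d where d: "0 < d"
      "\<And>h. 0 < h \<Longrightarrow> h < d \<Longrightarrow> norm (integral (cbox x (x + h *\<^sub>R One)) F /\<^sub>R h ^ DIM(real ^ 'n) - F x) < norm (F x)"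
      by blast
    obtain r where r: "0 < r" "ball x r \<subseteq> \<Omega>" using \<Omega> x(1) open_contains_ball by blast
    define n where "n = norm (One :: real ^ 'n)"
    have n: "0 \<le> n" by (simp add: n_def)
    define t where "t = min (d / 2) (r / (2 * (n + 1)))"
    have t: "0 < t" "t < d" "t \<le> r / (2 * (n + 1))"
      using d(1) r(1) n by (auto simp: t_def min_less_iff_disj)
    have "cbox x (x + t *\<^sub>R One) \<subseteq> ball x r"
    proof
      fix z assume z: "z \<in> cbox x (x + t *\<^sub>R One)"
      have "norm (z - x) \<le> norm (t *\<^sub>R (One :: real ^ 'n))"
        by (rule norm_le_componentwise) (use z t(1) in \<open>auto simp: mem_box inner_simps\<close>)
      also have "\<dots> = t * n" using t(1) by (simp add: n_def)
      also have "\<dots> \<le> r / (2 * (n + 1)) * n" using t(3) n by (rule mult_right_mono)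
      also have "\<dots> < r" using n r(1) by (simp add: field_simps add_nonneg_pos)
      finally show "z \<in> ball x r" by (simp add: dist_norm norm_minus_commute)
    qed
    then have "integral (cbox x (x + t *\<^sub>R One)) F = 0" using r(2) by (intro zero) blast
    with d(2)[OF t(1,2)] show False by simp
  qed
  moreover have "AE x in lebesgue. x \<notin> N"
    using N(1) by (intro AE_not_in) (simp add: negligible_iff_null_sets)
  ultimately have "AE x in lebesgue. x \<in> \<Omega> \<longrightarrow> h x = 0" by (auto elim: eventually_mono)
  then show ?thesis using \<Omega>l by (simp add: AE_restrict_space_iff)
qed

text \<open>The constant \<open>weak_gradient\<close> is an arbitrary choice among weak gradients. It agrees with the
classical gradient because two weak gradients of one function differ by something orthogonal to all
test functions.\<close>

theorem weak_gradient_test_function: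
  assumes \<Omega>: "open \<Omega>" "bounded \<Omega>" and \<phi>: "\<phi> \<in> test_functions \<Omega>"
  shows "AE x in lebesgue_on \<Omega>. weak_gradient \<Omega> \<phi> x = grad \<phi> x"
proof -
  note fin = finite_measure_lebesgue_on_bounded[OF \<Omega>]
  interpret finite_measure "lebesgue_on \<Omega>" by fact
  let ?G = "weak_gradient \<Omega> \<phi>"
  have G: "has_weak_gradient \<Omega> \<phi> ?G"
    unfolding weak_gradient_def by (rule someI[of "has_weak_gradient \<Omega> \<phi>", OF test_function_has_weak_gradient[OF \<Omega> \<phi>]])
  have sqG: "square_integrable (lebesgue_on \<Omega>) ?G" using G by (simp add: has_weak_gradient_def L2_iff)
  note sq = test_function_square_integrable[OF fin]
  have "AE x in lebesgue_on \<Omega>. ?G x $ i - grad \<phi> x $ i = 0" for i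
  proof (rule AE_zero_if_orthogonal_to_test_functions[OF \<Omega>(1)])
    show "integrable (lebesgue_on \<Omega>) (\<lambda>x. ?G x $ i - grad \<phi> x $ i)"
      by (intro integrable_L2 square_integrable_diff square_integrable_component sqG sq \<phi>)
    fix \<psi> assume \<psi>: "\<psi> \<in> test_functions \<Omega>"
    have "(LINT x|lebesgue_on \<Omega>. (?G x $ i - grad \<phi> x $ i) * \<psi> x) =
        (LINT x|lebesgue_on \<Omega>. ?G x $ i * \<psi> x - grad \<phi> x $ i * \<psi> x)"
      by (simp add: left_diff_distrib)
    also have "\<dots> = (LINT x|lebesgue_on \<Omega>. ?G x $ i * \<psi> x) - (LINT x|lebesgue_on \<Omega>. grad \<phi> x $ i * \<psi> x)"
      by (intro Bochner_Integration.integral_diff integrable_mult_L2 square_integrable_component sqG sq \<phi> \<psi>)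
    also have "\<dots> = 0"
    proof -
      have eq: "(LINT x|lebesgue_on \<Omega>. \<phi> x * grad \<psi> x $ i) = - (LINT x|lebesgue_on \<Omega>. H x $ i * \<psi> x)"
        if "has_weak_gradient \<Omega> \<phi> H" for H
        using that \<psi> by (simp add: has_weak_gradient_def)
      show ?thesis using eq[OF G] eq[OF test_function_has_weak_gradient[OF \<Omega> \<phi>]] by linarith
    qed
    finally show "(LINT x|lebesgue_on \<Omega>. (?G x $ i - grad \<phi> x $ i) * \<psi> x) = 0" .
  qed
  then have "AE x in lebesgue_on \<Omega>. \<forall>i. ?G x $ i - grad \<phi> x $ i = 0"
    by (simp add: AE_all_countable)
  then show ?thesis by eventually_elim (simp add: vec_eq_iff)
qed

section \<open>The Poincare inequality on convex sets\<close>

text \<open>The fundamental theorem of calculus on the segment from \<open>y\<close> to \<open>x\<close>, followed by the Cauchy-Schwarz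
inequality.\<close>

lemma increment_sq_le_segment_integral:
  fixes g :: "real ^ 'n \<Rightarrow> real"
  assumes g: "\<And>x. GDERIV g x :> G x" and G: "continuous_on UNIV G"
  shows "ennreal ((g x - g y)\<^sup>2) \<le>
    ennreal ((norm (x - y))\<^sup>2) * (\<integral>\<^sup>+ s. ennreal ((norm (G (y + s *\<^sub>R (x - y))))\<^sup>2) * indicator {0..1} s \<partial>lborel)"
proof -
  define v where "v = x - y"
  define p where "p s = G (y + s *\<^sub>R v)" for s
  have p: "continuous_on UNIV p" unfolding p_def
    by (intro continuous_on_compose2[OF G] continuous_intros) auto
  have [measurable]: "p \<in> borel_measurable borel" by (rule borel_measurable_continuous_onI[OF p])
  have der: "((\<lambda>s. g (y + s *\<^sub>R v)) has_real_derivative v \<bullet> p s) (at s)" for s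
  proof -
    have 1: "((\<lambda>s. y + s *\<^sub>R v) has_derivative (\<lambda>s. s *\<^sub>R v)) (at s)"
      by (auto intro!: derivative_eq_intros)
    have 2: "(g has_derivative (\<lambda>h. h \<bullet> p s)) (at (y + s *\<^sub>R v))"
      using g by (simp add: gderiv_def p_def)
    show ?thesis
      unfolding has_field_derivative_def
      by (rule has_derivative_eq_rhs[OF has_derivative_compose[OF 1 2]]) (simp add: fun_eq_iff)
  qed
  have isc: "isCont (\<lambda>s. v \<bullet> p s) s" for s
    using p by (intro continuous_intros) (simp add: continuous_on_eq_continuous_at)
  have bint: "has_bochner_integral lborel (\<lambda>s. (v \<bullet> p s) * indicator {0..1} s) (g x - g y)"
    using has_bochner_integral_FTC_Icc_real[of 0 1 "\<lambda>s. g (y + s *\<^sub>R v)" "\<lambda>s. v \<bullet> p s"] der isc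
    by (simp add: v_def)
  have "ennreal \<bar>g x - g y\<bar> \<le> (\<integral>\<^sup>+ s. ennreal \<bar>(v \<bullet> p s) * indicator {0..1} s\<bar> \<partial>lborel)"
    using bint has_bochner_integral_iff
    by (metis (no_types, lifting) integral_norm_bound_ennreal real_norm_def nn_integral_cong)
  also have "\<dots> = (\<integral>\<^sup>+ s. (ennreal \<bar>v \<bullet> p s\<bar> * indicator {0..1} s) * indicator {0..1::real} s \<partial>lborel)"
    by (rule nn_integral_cong) (simp add: indicator_def)
  finally have "(ennreal \<bar>g x - g y\<bar>)\<^sup>2 \<le>
      (\<integral>\<^sup>+ s. (ennreal \<bar>v \<bullet> p s\<bar> * indicator {0..1} s) * indicator {0..1::real} s \<partial>lborel)\<^sup>2"
    by (rule power_mono) simp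
  also have "\<dots> \<le> (\<integral>\<^sup>+ s. (ennreal \<bar>v \<bullet> p s\<bar> * indicator {0..1} s)\<^sup>2 \<partial>lborel) *
      (\<integral>\<^sup>+ s. (indicator {0..1::real} s)\<^sup>2 \<partial>lborel)"
    by (rule Cauchy_Schwarz_nn_integral) measurable
  also have "(\<integral>\<^sup>+ s. (indicator {0..1::real} s)\<^sup>2 \<partial>lborel) = (\<integral>\<^sup>+ s. indicator {0..1::real} s \<partial>lborel)"
    by (rule nn_integral_cong) (simp add: indicator_def)
  also have "\<dots> = 1" by simp
  also have "(\<integral>\<^sup>+ s. (ennreal \<bar>v \<bullet> p s\<bar> * indicator {0..1} s)\<^sup>2 \<partial>lborel) \<le>
      (\<integral>\<^sup>+ s. ennreal ((norm v)\<^sup>2) * (ennreal ((norm (p s))\<^sup>2) * indicator {0..1} s) \<partial>lborel)"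
  proof (rule nn_integral_mono)
    fix s
    have "\<bar>v \<bullet> p s\<bar>\<^sup>2 \<le> (norm v * norm (p s))\<^sup>2"
      by (rule power_mono) (simp_all add: Cauchy_Schwarz_ineq2)
    then have "ennreal (\<bar>v \<bullet> p s\<bar>\<^sup>2) \<le> ennreal ((norm v)\<^sup>2) * ennreal ((norm (p s))\<^sup>2)"
      by (simp add: power_mult_distrib ennreal_mult[symmetric])
    then show "(ennreal \<bar>v \<bullet> p s\<bar> * indicator {0..1} s)\<^sup>2 \<le>
        ennreal ((norm v)\<^sup>2) * (ennreal ((norm (p s))\<^sup>2) * indicator {0..1} s)"
      by (simp add: indicator_def ennreal_power)
  qed
  also have "\<dots> = ennreal ((norm v)\<^sup>2) * (\<integral>\<^sup>+ s. ennreal ((norm (p s))\<^sup>2) * indicator {0..1} s \<partial>lborel)"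
    by (rule nn_integral_cmult) measurable
  finally show ?thesis by (simp add: p_def v_def ennreal_power)
qed

text \<open>The substitution costs the factor \<open>c\<close> to the power minus \<open>n\<close>. Keeping \<open>c\<close> away from zero is the
reason for cutting segments at their midpoint in the next proof.\<close>

lemma nn_integral_affine_le:
  fixes \<gamma> :: "real ^ 'n \<Rightarrow> ennreal"
  assumes [measurable]: "\<gamma> \<in> borel_measurable borel" and c: "1 / 2 \<le> c"
  shows "(\<integral>\<^sup>+ x. \<gamma> (t + c *\<^sub>R x) \<partial>lborel) \<le> 2 ^ CARD('n) * (\<integral>\<^sup>+ x. \<gamma> x \<partial>lborel)"
proof -
  have "(\<integral>\<^sup>+ x. \<gamma> x \<partial>lborel) =
      (\<integral>\<^sup>+ x. \<gamma> x \<partial>(density (distr lborel borel (\<lambda>x. t + c *\<^sub>R x)) (\<lambda>_. ennreal (\<bar>c\<bar> ^ DIM(real ^ 'n)))))"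
    using c lborel_affine[of c t] by simp
  also have "\<dots> = (\<integral>\<^sup>+ x. ennreal (\<bar>c\<bar> ^ CARD('n)) * \<gamma> (t + c *\<^sub>R x) \<partial>lborel)"
    by (simp add: nn_integral_density nn_integral_distr)
  also have "\<dots> = ennreal (\<bar>c\<bar> ^ CARD('n)) * (\<integral>\<^sup>+ x. \<gamma> (t + c *\<^sub>R x) \<partial>lborel)"
    by (rule nn_integral_cmult) measurable
  finally have eq: "(\<integral>\<^sup>+ x. \<gamma> x \<partial>lborel) = ennreal (\<bar>c\<bar> ^ CARD('n)) * (\<integral>\<^sup>+ x. \<gamma> (t + c *\<^sub>R x) \<partial>lborel)" .
  have "1 \<le> (2 * c) ^ CARD('n)" using c by (intro one_le_power) simp
  then have "(1::ennreal) \<le> ennreal (2 ^ CARD('n) * \<bar>c\<bar> ^ CARD('n))"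
    using c by (simp add: power_mult_distrib)
  also have "\<dots> = 2 ^ CARD('n) * ennreal (\<bar>c\<bar> ^ CARD('n))"
    by (simp add: ennreal_mult ennreal_power[symmetric])
  finally have "1 * (\<integral>\<^sup>+ x. \<gamma> (t + c *\<^sub>R x) \<partial>lborel) \<le>
      2 ^ CARD('n) * ennreal (\<bar>c\<bar> ^ CARD('n)) * (\<integral>\<^sup>+ x. \<gamma> (t + c *\<^sub>R x) \<partial>lborel)"
    by (rule mult_right_mono) simp
  then show ?thesis by (simp add: eq mult.assoc)
qed

text \<open>Integrate the segment estimate over all pairs of points. For a fixed position \<open>s\<close> on the segment,
the intermediate point replaces \<open>x\<close> as the variable of integration when it is closer to \<open>x\<close>, and \<open>y\<close>
otherwise. By convexity it stays in \<open>Q\<close>.\<close>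

lemma poincare_double_integral:
  fixes g :: "real ^ 'n \<Rightarrow> real"
  assumes g: "\<And>x. GDERIV g x :> G x" and G: "continuous_on UNIV G"
    and Q[measurable]: "Q \<in> sets borel" and conv: "convex Q"
    and diam: "\<And>x y. x \<in> Q \<Longrightarrow> y \<in> Q \<Longrightarrow> norm (x - y) \<le> d"
  shows "(\<integral>\<^sup>+ x. (\<integral>\<^sup>+ y. ennreal ((g x - g y)\<^sup>2) * indicator Q y \<partial>lborel) * indicator Q x \<partial>lborel) \<le>
    ennreal (d\<^sup>2) * (2 ^ CARD('n) * emeasure lborel Q * (\<integral>\<^sup>+ x. ennreal ((norm (G x))\<^sup>2) * indicator Q x \<partial>lborel))"
proof -
  have [measurable]: "G \<in> borel_measurable borel" by (rule borel_measurable_continuous_onI[OF G])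
  define \<gamma> where "\<gamma> z = ennreal ((norm (G z))\<^sup>2) * indicator Q z" for z
  have [measurable]: "\<gamma> \<in> borel_measurable borel" unfolding \<gamma>_def by measurable
  define F where "F x y s = indicator Q x * indicator Q y * \<gamma> (y + s *\<^sub>R (x - y)) * indicator {0..1::real} s"
    for x y s
  let ?R = "2 ^ CARD('n) * emeasure lborel Q * (\<integral>\<^sup>+ x. \<gamma> x \<partial>lborel)"
  have slice: "(\<integral>\<^sup>+ x. \<integral>\<^sup>+ y. F x y s \<partial>lborel \<partial>lborel) \<le> ?R * indicator {0..1} s" for s
  proof (cases "s \<in> {0..1}")
    case False
    then show ?thesis by (simp add: F_def)
  next
    case s: True
    have pull: "(\<integral>\<^sup>+ x. indicator Q x * (2 ^ CARD('n) * (\<integral>\<^sup>+ x. \<gamma> x \<partial>lborel)) \<partial>lborel) = ?R"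
      by (subst nn_integral_multc) (auto simp: ac_simps)
    show ?thesis
    proof (cases "1 / 2 \<le> s")
      case True
      have "(\<integral>\<^sup>+ x. \<integral>\<^sup>+ y. F x y s \<partial>lborel \<partial>lborel) = (\<integral>\<^sup>+ y. \<integral>\<^sup>+ x. F x y s \<partial>lborel \<partial>lborel)"
        by (rule lborel_pair.Fubini'[symmetric]) (unfold F_def, measurable)
      also have "\<dots> \<le> (\<integral>\<^sup>+ y. indicator Q y * (2 ^ CARD('n) * (\<integral>\<^sup>+ x. \<gamma> x \<partial>lborel)) \<partial>lborel)"
      proof (rule nn_integral_mono)
        fix y
        have "(\<integral>\<^sup>+ x. F x y s \<partial>lborel) \<le> (\<integral>\<^sup>+ x. indicator Q y * \<gamma> (((1 - s) *\<^sub>R y) + s *\<^sub>R x) \<partial>lborel)"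
          by (rule nn_integral_mono) (auto simp: F_def indicator_def algebra_simps)
        also have "\<dots> = indicator Q y * (\<integral>\<^sup>+ x. \<gamma> (((1 - s) *\<^sub>R y) + s *\<^sub>R x) \<partial>lborel)"
          by (rule nn_integral_cmult) measurable
        also have "\<dots> \<le> indicator Q y * (2 ^ CARD('n) * (\<integral>\<^sup>+ x. \<gamma> x \<partial>lborel))"
          by (intro mult_left_mono nn_integral_affine_le True) auto
        finally show "(\<integral>\<^sup>+ x. F x y s \<partial>lborel) \<le> indicator Q y * (2 ^ CARD('n) * (\<integral>\<^sup>+ x. \<gamma> x \<partial>lborel))" .
      qed
      finally show ?thesis using s pull by simp
    next
      case False
      have "(\<integral>\<^sup>+ x. \<integral>\<^sup>+ y. F x y s \<partial>lborel \<partial>lborel) \<le>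
          (\<integral>\<^sup>+ x. indicator Q x * (2 ^ CARD('n) * (\<integral>\<^sup>+ x. \<gamma> x \<partial>lborel)) \<partial>lborel)"
      proof (rule nn_integral_mono)
        fix x
        have "(\<integral>\<^sup>+ y. F x y s \<partial>lborel) \<le> (\<integral>\<^sup>+ y. indicator Q x * \<gamma> ((s *\<^sub>R x) + (1 - s) *\<^sub>R y) \<partial>lborel)"
          by (rule nn_integral_mono) (auto simp: F_def indicator_def algebra_simps)
        also have "\<dots> = indicator Q x * (\<integral>\<^sup>+ y. \<gamma> ((s *\<^sub>R x) + (1 - s) *\<^sub>R y) \<partial>lborel)"
          by (rule nn_integral_cmult) measurable
        also have "\<dots> \<le> indicator Q x * (2 ^ CARD('n) * (\<integral>\<^sup>+ x. \<gamma> x \<partial>lborel))"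
          using False by (intro mult_left_mono nn_integral_affine_le) auto
        finally show "(\<integral>\<^sup>+ y. F x y s \<partial>lborel) \<le> indicator Q x * (2 ^ CARD('n) * (\<integral>\<^sup>+ x. \<gamma> x \<partial>lborel))" .
      qed
      then show ?thesis using s pull by simp
    qed
  qed
  have "(\<integral>\<^sup>+ x. (\<integral>\<^sup>+ y. ennreal ((g x - g y)\<^sup>2) * indicator Q y \<partial>lborel) * indicator Q x \<partial>lborel) \<le>
      (\<integral>\<^sup>+ x. \<integral>\<^sup>+ y. ennreal (d\<^sup>2) * (\<integral>\<^sup>+ s. F x y s \<partial>lborel) \<partial>lborel \<partial>lborel)"
  proof (rule nn_integral_mono)
    fix x
    show "(\<integral>\<^sup>+ y. ennreal ((g x - g y)\<^sup>2) * indicator Q y \<partial>lborel) * indicator Q x \<le>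
        (\<integral>\<^sup>+ y. ennreal (d\<^sup>2) * (\<integral>\<^sup>+ s. F x y s \<partial>lborel) \<partial>lborel)"
    proof (cases "x \<in> Q")
      case x: True
      have "(\<integral>\<^sup>+ y. ennreal ((g x - g y)\<^sup>2) * indicator Q y \<partial>lborel) \<le>
        (\<integral>\<^sup>+ y. ennreal (d\<^sup>2) * (\<integral>\<^sup>+ s. F x y s \<partial>lborel) \<partial>lborel)"
      proof (rule nn_integral_mono)
        fix y
        show "ennreal ((g x - g y)\<^sup>2) * indicator Q y \<le> ennreal (d\<^sup>2) * (\<integral>\<^sup>+ s. F x y s \<partial>lborel)"
        proof (cases "y \<in> Q")
          case y: True
          have seg: "y + s *\<^sub>R (x - y) \<in> Q" if "s \<in> {0..1}" for s
          proof -
            have "(1 - s) *\<^sub>R y + s *\<^sub>R x \<in> Q" using conv x y that by (auto simp: convex_alt)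
            then show ?thesis by (simp add: algebra_simps)
          qed
          have "(norm (x - y))\<^sup>2 \<le> d\<^sup>2" using diam[OF x y] by (intro power_mono) auto
          then have "ennreal ((norm (x - y))\<^sup>2) \<le> ennreal (d\<^sup>2)" by (rule ennreal_leI)
          moreover have "(\<integral>\<^sup>+ s. ennreal ((norm (G (y + s *\<^sub>R (x - y))))\<^sup>2) * indicator {0..1} s \<partial>lborel)
              \<le> (\<integral>\<^sup>+ s. F x y s \<partial>lborel)"
            using x y seg by (intro nn_integral_mono) (auto simp: F_def \<gamma>_def indicator_def)
          ultimately show ?thesis
            using y by (auto intro!: order_trans[OF increment_sq_le_segment_integral[OF g G]] mult_mono)
        qed simp
      qed
      then show ?thesis using x by simp
    qed simp
  qed
  also have "\<dots> = (\<integral>\<^sup>+ x. ennreal (d\<^sup>2) * (\<integral>\<^sup>+ y. \<integral>\<^sup>+ s. F x y s \<partial>lborel \<partial>lborel) \<partial>lborel)"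
    by (intro nn_integral_cong nn_integral_cmult) (unfold F_def, measurable)
  also have "\<dots> = ennreal (d\<^sup>2) * (\<integral>\<^sup>+ x. \<integral>\<^sup>+ y. \<integral>\<^sup>+ s. F x y s \<partial>lborel \<partial>lborel \<partial>lborel)"
    by (rule nn_integral_cmult) (unfold F_def, measurable)
  also have "(\<integral>\<^sup>+ x. \<integral>\<^sup>+ y. \<integral>\<^sup>+ s. F x y s \<partial>lborel \<partial>lborel \<partial>lborel) =
      (\<integral>\<^sup>+ x. \<integral>\<^sup>+ s. \<integral>\<^sup>+ y. F x y s \<partial>lborel \<partial>lborel \<partial>lborel)"
    by (intro nn_integral_cong lborel_pair.Fubini') (unfold F_def, measurable)
  also have "\<dots> = (\<integral>\<^sup>+ s. \<integral>\<^sup>+ x. \<integral>\<^sup>+ y. F x y s \<partial>lborel \<partial>lborel \<partial>lborel)"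
    by (intro lborel_pair.Fubini') (unfold F_def, measurable)
  also have "\<dots> \<le> (\<integral>\<^sup>+ s. ?R * indicator {0..1::real} s \<partial>lborel)"
    by (rule nn_integral_mono) (rule slice)
  also have "\<dots> = ?R" by (simp add: nn_integral_cmult)
  finally show ?thesis by (simp add: \<gamma>_def mult_left_mono)
qed

lemma continuous_square_integrable_on_bounded:
  fixes f :: "real ^ 'n \<Rightarrow> 'b::euclidean_space"
  assumes f: "continuous_on UNIV f" and Q: "Q \<in> sets borel" "bounded Q"
  shows "square_integrable (lebesgue_on Q) f"
proof -
  have "Q \<in> lmeasurable" using Q by (simp add: bounded_set_imp_lmeasurable)
  then interpret finite_measure "lebesgue_on Q" by (rule finite_measure_lebesgue_on)
  obtain R where R: "\<forall>x\<in>Q. norm x \<le> R" using Q(2) unfolding bounded_iff by blast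
  have "bounded (f ` cball 0 R)"
    by (intro compact_imp_bounded compact_continuous_image continuous_on_subset[OF f subset_UNIV] compact_cball)
  then obtain B where B: "\<forall>y\<in>f ` cball 0 R. norm y \<le> B" unfolding bounded_iff by blast
  show ?thesis
  proof (rule square_integrable_bound[OF square_integrable_const[of "1 :: real"], of _ B])
    show "AE x in lebesgue_on Q. norm (f x) \<le> B * norm (1 :: real)"
      by (rule AE_I2) (use R B in auto)
  qed (rule continuous_imp_borel_measurable_lebesgue_on[OF f])
qed

lemma nn_integral_lebesgue_on_eq_lborel:
  fixes f :: "real ^ 'n \<Rightarrow> ennreal"
  assumes "Q \<in> sets borel"
  shows "(\<integral>\<^sup>+ x. f x \<partial>lebesgue_on Q) = (\<integral>\<^sup>+ x. f x * indicator Q x \<partial>lborel)"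
  using assms by (subst nn_integral_restrict_space) (auto simp: nn_integral_completion)

lemma nn_integral_sq_eq_sqnorm:
  assumes "square_integrable M f"
  shows "(\<integral>\<^sup>+ x. ennreal ((norm (f x))\<^sup>2) \<partial>M) = ennreal (sqnorm M f)"
  unfolding sqnorm_def using assms by (intro nn_integral_eq_integral square_integrable_sq) auto

text \<open>The deviation of \<open>g x\<close> from the mean is the average of \<open>g x - g y\<close> over \<open>y\<close>, so its square is at
most the average of the squares, and the double integral bounds the result.\<close>

theorem poincare_convex:
  fixes g :: "real ^ 'n \<Rightarrow> real"
  assumes g: "\<And>x. GDERIV g x :> G x" and G: "continuous_on UNIV G"
    and Q: "Q \<in> sets borel" "bounded Q" and conv: "convex Q"
    and diam: "\<And>x y. x \<in> Q \<Longrightarrow> y \<in> Q \<Longrightarrow> norm (x - y) \<le> d"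
  shows "sqnorm (lebesgue_on Q) (\<lambda>x. g x - (LINT y|lebesgue_on Q. g y) / measure lebesgue Q) \<le>
    2 ^ CARD('n) * d\<^sup>2 * sqnorm (lebesgue_on Q) G"
proof -
  let ?M = "lebesgue_on Q"
  have Ql: "Q \<in> lmeasurable" using Q by (simp add: bounded_set_imp_lmeasurable)
  then interpret finite_measure ?M by (rule finite_measure_lebesgue_on)
  define \<mu> where "\<mu> = measure lebesgue Q"
  have "measure ?M (space ?M) = \<mu>"
    using Ql by (simp add: \<mu>_def measure_restrict_space fmeasurableD)
  moreover have "emeasure lborel Q = emeasure lebesgue Q"
    using Q(1) by simp
  moreover have "emeasure lebesgue Q = ennreal \<mu>"
    unfolding \<mu>_def by (rule emeasure_eq_measure2[OF Ql])
  ultimately have \<mu>: "measure ?M (space ?M) = \<mu>" "emeasure lborel Q = ennreal \<mu>"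
    by simp_all
  have gc: "continuous_on UNIV g"
    using g by (auto simp: continuous_on_eq_continuous_at gderiv_def intro: has_derivative_continuous)
  have sg: "square_integrable ?M g" and sG: "square_integrable ?M G"
    using continuous_square_integrable_on_bounded[OF _ Q] gc G by blast+
  define c where "c = (LINT y|?M. g y) / \<mu>"
  have sgc: "square_integrable ?M (\<lambda>x. g x - c)"
    by (intro square_integrable_diff sg square_integrable_const)
  show ?thesis
  proof (cases "\<mu> = 0")
    case True
    then have "emeasure ?M (space ?M) = 0"
      using \<mu>(1) by (simp add: emeasure_eq_measure)
    then have "AE x in ?M. (norm (g x - c))\<^sup>2 = 0"
      by (intro AE_I[of _ _ "space ?M"]) auto
    then have "sqnorm ?M (\<lambda>x. g x - c) = 0"
      unfolding sqnorm_def by (rule integral_eq_zero_AE)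
    then show ?thesis by (simp add: c_def \<mu>_def sqnorm_nonneg)
  next
    case False
    then have pos: "0 < \<mu>" by (simp add: \<mu>_def zero_less_measure_iff)
    have point: "ennreal ((norm (g x - c))\<^sup>2) \<le>
        ennreal (1 / \<mu>) * (\<integral>\<^sup>+ y. ennreal ((g x - g y)\<^sup>2) \<partial>?M)" for x
    proof -
      have sq: "square_integrable ?M (\<lambda>y. g x - g y)"
        by (intro square_integrable_diff sg square_integrable_const)
      have "(LINT y|?M. g x - g y) = \<mu> * g x - (LINT y|?M. g y)"
        using integrable_L2[OF sg] \<mu>(1) by simp
      then have "\<mu> * (g x - c) = (LINT y|?M. g x - g y)"
        using pos by (simp add: c_def algebra_simps)
      then have "(\<mu> * (g x - c))\<^sup>2 \<le> (LINT y|?M. \<bar>g x - g y\<bar>)\<^sup>2"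
        using integral_abs_bound[of ?M "\<lambda>y. g x - g y"] by (simp add: abs_le_square_iff[symmetric])
      also have "\<dots> \<le> \<mu> * sqnorm ?M (\<lambda>y. g x - g y)"
        using integral_sq_le[OF sq] \<mu>(1) by simp
      finally have "\<mu> * (\<mu> * (g x - c)\<^sup>2) \<le> \<mu> * sqnorm ?M (\<lambda>y. g x - g y)"
        by (simp add: power2_eq_square ac_simps)
      then have "\<mu> * (g x - c)\<^sup>2 \<le> sqnorm ?M (\<lambda>y. g x - g y)" using pos by simp
      then have "(g x - c)\<^sup>2 \<le> 1 / \<mu> * sqnorm ?M (\<lambda>y. g x - g y)"
        using pos by (simp add: field_simps)
      then have "ennreal ((g x - c)\<^sup>2) \<le> ennreal (1 / \<mu>) * ennreal (sqnorm ?M (\<lambda>y. g x - g y))"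
        using pos by (simp add: ennreal_mult[symmetric] sqnorm_nonneg)
      then show ?thesis
        using nn_integral_sq_eq_sqnorm[OF sq] by simp
    qed
    have "ennreal (sqnorm ?M (\<lambda>x. g x - c)) = (\<integral>\<^sup>+ x. ennreal ((norm (g x - c))\<^sup>2) \<partial>?M)"
      by (rule nn_integral_sq_eq_sqnorm[OF sgc, symmetric])
    also have "\<dots> \<le> (\<integral>\<^sup>+ x. ennreal (1 / \<mu>) * (\<integral>\<^sup>+ y. ennreal ((g x - g y)\<^sup>2) \<partial>?M) \<partial>?M)"
      by (rule nn_integral_mono) (rule point)
    also have "\<dots> = ennreal (1 / \<mu>) * (\<integral>\<^sup>+ x. (\<integral>\<^sup>+ y. ennreal ((g x - g y)\<^sup>2) * indicator Q y \<partial>lborel) * indicator Q x \<partial>lborel)"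
    proof -
      have [measurable]: "g \<in> borel_measurable borel" "Q \<in> sets borel"
        using borel_measurable_continuous_onI[OF gc] Q(1) by auto
      have "(\<integral>\<^sup>+ x. ennreal (1 / \<mu>) * (\<integral>\<^sup>+ y. ennreal ((g x - g y)\<^sup>2) \<partial>?M) \<partial>?M) =
         (\<integral>\<^sup>+ x. ennreal (1 / \<mu>) * ((\<integral>\<^sup>+ y. ennreal ((g x - g y)\<^sup>2) * indicator Q y \<partial>lborel) * indicator Q x) \<partial>lborel)"
        by (simp add: nn_integral_lebesgue_on_eq_lborel[OF Q(1)] mult.assoc)
      also have "\<dots> = ennreal (1 / \<mu>) * (\<integral>\<^sup>+ x. (\<integral>\<^sup>+ y. ennreal ((g x - g y)\<^sup>2) * indicator Q y \<partial>lborel) * indicator Q x \<partial>lborel)"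
        by (rule nn_integral_cmult) measurable
      finally show ?thesis .
    qed
    also have "\<dots> \<le> ennreal (1 / \<mu>) * (ennreal (d\<^sup>2) * (2 ^ CARD('n) * emeasure lborel Q *
        (\<integral>\<^sup>+ x. ennreal ((norm (G x))\<^sup>2) * indicator Q x \<partial>lborel)))"
      by (intro mult_left_mono poincare_double_integral g G Q conv diam) auto
    also have "\<dots> = ennreal (1 / \<mu>) * (ennreal (d\<^sup>2) * (2 ^ CARD('n) * ennreal \<mu> * ennreal (sqnorm ?M G)))"
      using nn_integral_sq_eq_sqnorm[OF sG] \<mu>(2) by (simp add: nn_integral_lebesgue_on_eq_lborel[OF Q(1)])
    also have "\<dots> = ennreal (1 / \<mu> * (d\<^sup>2 * (2 ^ CARD('n) * \<mu> * sqnorm ?M G)))"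
    proof -
      have "(2::ennreal) ^ CARD('n) = ennreal (2 ^ CARD('n))" by (simp add: ennreal_power[symmetric])
      then show ?thesis using pos sqnorm_nonneg[of ?M G] by (simp add: ennreal_mult[symmetric])
    qed
    also have "1 / \<mu> * (d\<^sup>2 * (2 ^ CARD('n) * \<mu> * sqnorm ?M G)) = 2 ^ CARD('n) * d\<^sup>2 * sqnorm ?M G"
      using pos by (simp add: field_simps)
    finally show ?thesis
      by (simp add: c_def \<mu>_def sqnorm_nonneg)
  qed
qed

section \<open>Rellich compactness\<close>

text \<open>Half-open cubes of side \<open>1 / (m + 1)\<close>, indexed by integer vectors. For fixed \<open>m\<close> they partition the
space, so norms are sums over cells without any overlap to count.\<close>

definition grid_cell :: "nat \<Rightarrow> ('n \<Rightarrow> int) \<Rightarrow> (real ^ 'n) set" where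
  "grid_cell m k = {x. \<forall>i. \<lfloor>x $ i * real (Suc m)\<rfloor> = k i}"

lemma grid_cell_borel:
  fixes k :: "'n::finite \<Rightarrow> int"
  shows "grid_cell m k \<in> sets borel"
proof -
  have "{x :: real ^ 'n. \<lfloor>x $ i * real (Suc m)\<rfloor> = k i} \<in> sets borel" for i
  proof -
    have [measurable]: "(\<lambda>x :: real ^ 'n. x $ i) \<in> borel_measurable borel"
      by (intro borel_measurable_continuous_onI continuous_on_component continuous_on_id)
    show ?thesis by measurable
  qed
  then have "(\<Inter>i\<in>UNIV. {x :: real ^ 'n. \<lfloor>x $ i * real (Suc m)\<rfloor> = k i}) \<in> sets borel"
    by (intro sets.finite_INT) auto
  also have "(\<Inter>i\<in>UNIV. {x :: real ^ 'n. \<lfloor>x $ i * real (Suc m)\<rfloor> = k i}) = grid_cell m k"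
    by (auto simp: grid_cell_def)
  finally show ?thesis .
qed

lemma grid_cell_convex: "convex (grid_cell m k)"
proof -
  have "grid_cell m k = (\<Inter>i. (\<lambda>x. x $ i * real (Suc m)) -` {real_of_int (k i)..<real_of_int (k i) + 1})"
    by (auto simp: grid_cell_def floor_eq_iff)
  also have "convex \<dots>"
    by (intro convex_INT convex_linear_vimage convex_real_interval linearI)
      (simp_all add: algebra_simps)
  finally show ?thesis .
qed

lemma grid_cell_diam:
  fixes x y :: "real ^ 'n"
  assumes "x \<in> grid_cell m k" "y \<in> grid_cell m k"
  shows "norm (x - y) \<le> CARD('n) / real (Suc m)"
proof -
  have "\<bar>(x - y) $ i\<bar> \<le> 1 / real (Suc m)" for i
  proof -
    have "\<lfloor>x $ i * real (Suc m)\<rfloor> = \<lfloor>y $ i * real (Suc m)\<rfloor>"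
      using assms by (simp add: grid_cell_def)
    then have "\<bar>x $ i * real (Suc m) - y $ i * real (Suc m)\<bar> \<le> 1"
      by linarith
    then have "\<bar>x $ i - y $ i\<bar> * real (Suc m) \<le> 1"
      by (simp add: left_diff_distrib[symmetric] abs_mult del: of_nat_Suc)
    then show ?thesis by (simp add: field_simps)
  qed
  then have "(\<Sum>i\<in>UNIV. \<bar>(x - y) $ i\<bar>) \<le> (\<Sum>i\<in>(UNIV::'n set). 1 / real (Suc m))"
    by (intro sum_mono)
  then show ?thesis using norm_le_l1_cart[of "x - y"] by simp
qed

lemma grid_cell_bounded: "bounded (grid_cell m k)"
  unfolding bounded_two_points dist_norm
  by (intro exI[of _ "real CARD('a) / real (Suc m)"] ballI grid_cell_diam)

lemma finite_grid_cells:
  fixes S :: "(real ^ 'n) set"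
  assumes "bounded S"
  shows "finite ((\<lambda>x i. \<lfloor>x $ i * real (Suc m)\<rfloor>) ` S)"
proof -
  obtain B where B: "\<forall>x\<in>S. norm x \<le> B" using assms unfolding bounded_iff by blast
  define L where "L = \<lceil>B * real (Suc m)\<rceil> + 1"
  have "(\<lambda>x i. \<lfloor>x $ i * real (Suc m)\<rfloor>) ` S \<subseteq> (UNIV :: 'n set) \<rightarrow>\<^sub>E {- L..L}"
  proof
    fix k assume "k \<in> (\<lambda>x i. \<lfloor>x $ i * real (Suc m)\<rfloor>) ` S"
    then obtain x where x: "x \<in> S" "k = (\<lambda>i. \<lfloor>x $ i * real (Suc m)\<rfloor>)" by blast
    have "k i \<in> {- L..L}" for i
    proof -
      have "\<bar>x $ i\<bar> \<le> B" using B x(1) component_le_norm_cart[of x i] by fastforce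
      then have "\<bar>x $ i * real (Suc m)\<bar> \<le> B * real (Suc m)"
        by (simp add: abs_mult mult_right_mono del: of_nat_Suc)
      then show ?thesis unfolding x(2) L_def by (simp del: of_nat_Suc) linarith
    qed
    then show "k \<in> UNIV \<rightarrow>\<^sub>E {- L..L}" by auto
  qed
  moreover have "finite ((UNIV :: 'n set) \<rightarrow>\<^sub>E {- L..L})" by (intro finite_PiE) auto
  ultimately show ?thesis by (rule finite_subset)
qed

lemma sqnorm_eq_sum_grid:
  fixes f :: "real ^ 'n \<Rightarrow> 'b::euclidean_space"
  assumes sq: "square_integrable (lebesgue_on S) f" and S: "S \<in> sets lebesgue" "bounded S"
    and 0: "\<And>x. x \<notin> S \<Longrightarrow> f x = 0"
  shows "sqnorm (lebesgue_on S) f =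
    (\<Sum>k\<in>(\<lambda>x i. \<lfloor>x $ i * real (Suc m)\<rfloor>) ` S. sqnorm (lebesgue_on (grid_cell m k)) f)"
proof -
  let ?I = "(\<lambda>x i. \<lfloor>x $ i * real (Suc m)\<rfloor>) ` S"
  have fin: "finite ?I" by (rule finite_grid_cells[OF S(2)])
  have f0: "indicator S x * (norm (f x))\<^sup>2 = (norm (f x))\<^sup>2" for x
    using 0[of x] by (cases "x \<in> S") auto
  have int: "integrable lebesgue (\<lambda>x. (norm (f x))\<^sup>2)"
    using square_integrable_sq[OF sq] S(1) by (simp add: integrable_restrict_space f0)
  have pt: "(norm (f x))\<^sup>2 = (\<Sum>k\<in>?I. indicator (grid_cell m k) x *\<^sub>R (norm (f x))\<^sup>2)" for x
  proof (cases "x \<in> S")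
    case False
    then show ?thesis using 0 by simp
  next
    case True
    let ?k = "\<lambda>i. \<lfloor>x $ i * real (Suc m)\<rfloor>"
    have "(\<Sum>k\<in>?I. indicator (grid_cell m k) x *\<^sub>R (norm (f x))\<^sup>2) =
        (\<Sum>k\<in>?I. if k = ?k then (norm (f x))\<^sup>2 else 0)"
      by (rule sum.cong) (auto simp: grid_cell_def indicator_def fun_eq_iff simp del: of_nat_Suc, metis)
    also have "\<dots> = (norm (f x))\<^sup>2" using fin True by (simp add: sum.delta del: of_nat_Suc)
    finally show ?thesis by simp
  qed
  have gl: "grid_cell m k \<in> sets lebesgue" for k :: "'n \<Rightarrow> int"
    using grid_cell_borel[of m k] by simp
  have "sqnorm (lebesgue_on S) f = (LINT x|lebesgue. (norm (f x))\<^sup>2)"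
    unfolding sqnorm_def using S(1) by (simp add: integral_restrict_space f0)
  also have "\<dots> = (LINT x|lebesgue. (\<Sum>k\<in>?I. indicator (grid_cell m k) x *\<^sub>R (norm (f x))\<^sup>2))"
    by (subst pt) simp
  also have "\<dots> = (\<Sum>k\<in>?I. LINT x|lebesgue. indicator (grid_cell m k) x *\<^sub>R (norm (f x))\<^sup>2)"
    by (intro Bochner_Integration.integral_sum integrable_mult_indicator int gl)
  also have "\<dots> = (\<Sum>k\<in>?I. sqnorm (lebesgue_on (grid_cell m k)) f)"
    unfolding sqnorm_def by (intro sum.cong refl integral_restrict_space[symmetric]) (simp add: gl)
  finally show ?thesis .
qed

lemma test_function_diff:
  "\<phi> \<in> test_functions \<Omega> \<Longrightarrow> \<psi> \<in> test_functions \<Omega> \<Longrightarrow> (\<lambda>x. \<phi> x - \<psi> x) \<in> test_functions \<Omega>"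
  using test_function_add[OF _ test_function_cmult[of \<psi> \<Omega> "-1"], of \<phi>] by simp

lemma grad_diff:
  "\<phi> \<in> test_functions \<Omega> \<Longrightarrow> \<psi> \<in> test_functions \<Omega> \<Longrightarrow>
    grad (\<lambda>x. \<phi> x - \<psi> x) x = grad \<phi> x - grad \<psi> x"
  by (intro GDERIV_imp_grad_eq GDERIV_diff test_function_GDERIV)

lemma grid_cell_lmeasurable: "grid_cell m k \<in> lmeasurable"
  by (rule bounded_set_imp_lmeasurable[OF grid_cell_bounded]) (use grid_cell_borel[of m k] in simp)

text \<open>Splitting into the mean and the deviation from it on each cell: up to a multiple of the gradient
norm that decays with the grid size, finitely many averages control the norm.\<close>

lemma sqnorm_test_function_le_grid:
  fixes \<phi> :: "real ^ 'n \<Rightarrow> real"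
  assumes \<Omega>: "open \<Omega>" "bounded \<Omega>" and \<phi>: "\<phi> \<in> test_functions \<Omega>"
  shows "sqnorm (lebesgue_on \<Omega>) \<phi> \<le>
    2 * 2 ^ CARD('n) * (CARD('n) / real (Suc m))\<^sup>2 * sqnorm (lebesgue_on \<Omega>) (grad \<phi>) +
    (\<Sum>k\<in>(\<lambda>x i. \<lfloor>x $ i * real (Suc m)\<rfloor>) ` \<Omega>. 2 * (measure lebesgue (grid_cell m k) *
       ((LINT x|lebesgue_on (grid_cell m k). \<phi> x) / measure lebesgue (grid_cell m k))\<^sup>2))"
proof -
  let ?I = "(\<lambda>x i. \<lfloor>x $ i * real (Suc m)\<rfloor>) ` \<Omega>"
  let ?Q = "grid_cell m :: ('n \<Rightarrow> int) \<Rightarrow> (real ^ 'n) set"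
  let ?c = "\<lambda>k. (LINT x|lebesgue_on (?Q k). \<phi> x) / measure lebesgue (?Q k)"
  let ?D = "2 ^ CARD('n) * (CARD('n) / real (Suc m))\<^sup>2"
  note fin = finite_measure_lebesgue_on_bounded[OF \<Omega>]
  note sq = test_function_square_integrable[OF fin \<phi>]
  have \<Omega>l: "\<Omega> \<in> sets lebesgue" using \<Omega>(1) by simp
  have zero: "\<phi> x = 0 \<and> grad \<phi> x = 0" if "x \<notin> \<Omega>" for x
    using test_function_support[OF \<phi>] that by blast
  have cell: "sqnorm (lebesgue_on (?Q k)) \<phi> \<le> 2 * (?D * sqnorm (lebesgue_on (?Q k)) (grad \<phi>)) +
      2 * (measure lebesgue (?Q k) * (?c k)\<^sup>2)" for k
  proof -
    let ?M = "lebesgue_on (?Q k)"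
    have Ql: "?Q k \<in> lmeasurable" by (rule grid_cell_lmeasurable)
    then interpret finite_measure ?M by (rule finite_measure_lebesgue_on)
    have s\<phi>: "square_integrable ?M \<phi>"
      by (rule continuous_square_integrable_on_bounded[OF test_function_continuous[OF \<phi>] grid_cell_borel grid_cell_bounded])
    have "sqnorm ?M (\<lambda>x. (\<phi> x - ?c k) + ?c k) \<le> 2 * sqnorm ?M (\<lambda>x. \<phi> x - ?c k) + 2 * sqnorm ?M (\<lambda>x. ?c k)"
      by (intro sqnorm_add_le square_integrable_diff s\<phi> square_integrable_const)
    moreover have "sqnorm ?M (\<lambda>x. \<phi> x - ?c k) \<le> ?D * sqnorm ?M (grad \<phi>)"
      by (rule poincare_convex[OF test_function_GDERIV[OF \<phi>] test_function_grad_continuous[OF \<phi>]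
            grid_cell_borel grid_cell_bounded grid_cell_convex grid_cell_diam])
    moreover have "sqnorm ?M (\<lambda>x. ?c k) = measure lebesgue (?Q k) * (?c k)\<^sup>2"
      using Ql by (simp add: sqnorm_def measure_restrict_space fmeasurableD power_divide)
    ultimately show ?thesis by simp
  qed
  have "sqnorm (lebesgue_on \<Omega>) \<phi> = (\<Sum>k\<in>?I. sqnorm (lebesgue_on (?Q k)) \<phi>)"
    using zero by (intro sqnorm_eq_sum_grid sq \<Omega>l \<Omega>(2)) simp
  also have "\<dots> \<le> (\<Sum>k\<in>?I. 2 * (?D * sqnorm (lebesgue_on (?Q k)) (grad \<phi>)) +
      2 * (measure lebesgue (?Q k) * (?c k)\<^sup>2))"
    by (rule sum_mono) (rule cell)
  also have "\<dots> = 2 * ?D * (\<Sum>k\<in>?I. sqnorm (lebesgue_on (?Q k)) (grad \<phi>)) +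
      (\<Sum>k\<in>?I. 2 * (measure lebesgue (?Q k) * (?c k)\<^sup>2))"
    by (simp add: sum.distrib sum_distrib_left mult.assoc)
  also have "(\<Sum>k\<in>?I. sqnorm (lebesgue_on (?Q k)) (grad \<phi>)) = sqnorm (lebesgue_on \<Omega>) (grad \<phi>)"
    using zero by (intro sqnorm_eq_sum_grid[symmetric] sq \<Omega>l \<Omega>(2)) simp
  finally show ?thesis by (simp add: mult.assoc)
qed

text \<open>A bound that is uniform in the cell, as the diagonal selection of a subsequence requires.\<close>

lemma test_function_cell_integral_le:
  fixes \<phi> :: "real ^ 'n \<Rightarrow> real"
  assumes \<Omega>: "open \<Omega>" "bounded \<Omega>" and \<phi>: "\<phi> \<in> test_functions \<Omega>"
    and C: "sqnorm (lebesgue_on \<Omega>) \<phi> \<le> C"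
  shows "\<bar>LINT x|lebesgue_on (grid_cell m k). \<phi> x\<bar> \<le>
    sqrt (measure (lebesgue_on \<Omega>) (space (lebesgue_on \<Omega>)) * C)"
proof -
  interpret finite_measure "lebesgue_on \<Omega>" by (rule finite_measure_lebesgue_on_bounded[OF \<Omega>])
  have sq: "square_integrable (lebesgue_on \<Omega>) \<phi>"
    by (rule test_function_square_integrable(1)[OF finite_measure_lebesgue_on_bounded[OF \<Omega>] \<phi>])
  have \<Omega>l: "\<Omega> \<in> sets lebesgue" using \<Omega>(1) by simp
  have Ql: "grid_cell m k \<in> sets lebesgue" using grid_cell_borel[of m k] by simp
  have zero: "indicator \<Omega> x * \<phi> x = \<phi> x" for x
    using test_function_support[OF \<phi>] by (cases "x \<in> \<Omega>") auto
  have int: "integrable lebesgue \<phi>"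
    using integrable_L2[OF sq] \<Omega>l by (simp add: integrable_restrict_space zero)
  have "\<bar>LINT x|lebesgue_on (grid_cell m k). \<phi> x\<bar> = \<bar>LINT x|lebesgue. indicator (grid_cell m k) x *\<^sub>R \<phi> x\<bar>"
    using Ql by (simp add: integral_restrict_space)
  also have "\<dots> \<le> (LINT x|lebesgue. \<bar>indicator (grid_cell m k) x *\<^sub>R \<phi> x\<bar>)"
    by (rule integral_abs_bound)
  also have "\<dots> \<le> (LINT x|lebesgue. \<bar>\<phi> x\<bar>)"
    using int Ql by (intro integral_mono integrable_abs integrable_mult_indicator) (auto simp: indicator_def)
  also have "\<dots> = (LINT x|lebesgue_on \<Omega>. \<bar>\<phi> x\<bar>)"
  proof -
    have "indicator \<Omega> x * \<bar>\<phi> x\<bar> = \<bar>\<phi> x\<bar>" for x using zero[of x] by (auto simp: indicator_def)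
    then show ?thesis using \<Omega>l by (subst integral_restrict_space) (simp_all only: Int_UNIV_right space_completion space_lborel space_borel real_scaleR_def)
  qed
  also have "\<dots> \<le> sqrt (measure (lebesgue_on \<Omega>) (space (lebesgue_on \<Omega>)) * C)"
    by (rule real_le_rsqrt[OF order_trans[OF integral_sq_le[OF sq] mult_left_mono[OF C]]]) simp
  finally show ?thesis .
qed

text \<open>There are countably many grid cells, so one subsequence makes the integrals over all of them
converge. Given a tolerance, a fine grid makes the gradient term of the previous estimate small for
all differences at once, and the averages over its finitely many cells converge.\<close>

theorem rellich:
  fixes \<phi> :: "nat \<Rightarrow> real ^ 'n \<Rightarrow> real"
  assumes \<Omega>: "open \<Omega>" "bounded \<Omega>" and \<phi>: "\<And>k. \<phi> k \<in> test_functions \<Omega>"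
    and C: "\<And>k. sqnorm (lebesgue_on \<Omega>) (\<phi> k) \<le> C" "\<And>k. sqnorm (lebesgue_on \<Omega>) (grad (\<phi> k)) \<le> C"
  shows "\<exists>r :: nat \<Rightarrow> nat. strict_mono r \<and> (\<forall>e>0. \<exists>N. \<forall>i\<ge>N. \<forall>j\<ge>N.
    sqnorm (lebesgue_on \<Omega>) (\<lambda>x. \<phi> (r i) x - \<phi> (r j) x) < e)"
proof -
  let ?M = "lebesgue_on \<Omega>"
  let ?Q = "\<lambda>m k. grid_cell m k :: (real ^ 'n) set"
  have sq: "square_integrable ?M (\<phi> k)" "square_integrable ?M (grad (\<phi> k))" for k
    by (rule test_function_square_integrable[OF finite_measure_lebesgue_on_bounded[OF \<Omega>] \<phi>])+
  have sq2: "(u - v)\<^sup>2 \<le> 2 * u\<^sup>2 + 2 * v\<^sup>2" for u v :: real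
    using norm_add_sq_le[of u "- v"] by simp
  have C0: "0 \<le> C" using C(1)[of 0] sqnorm_nonneg[of ?M "\<phi> 0"] by linarith
  \<comment> \<open>Integrals rather than averages are selected, since they are bounded uniformly in the cell.\<close>
  define a where "a n p = (LINT x|lebesgue_on (?Q (fst p) (snd p)). \<phi> n x)" for n and p :: "nat \<times> ('n \<Rightarrow> int)"
  obtain r :: "nat \<Rightarrow> nat" where r: "strict_mono r" and conv: "\<And>p. \<exists>l. (\<lambda>n. a (r n) p) \<longlonglongrightarrow> l"
  proof (rule function_convergent_subsequence[of UNIV a "sqrt (measure ?M (space ?M) * C)"])
    show "countable (UNIV :: (nat \<times> ('n \<Rightarrow> int)) set)" by simp
    show "norm (a n p) \<le> sqrt (measure ?M (space ?M) * C)" for n p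
      unfolding a_def real_norm_def by (rule test_function_cell_integral_le[OF \<Omega> \<phi> C(1)])
  qed (use that in simp)
  define L where "L p = lim (\<lambda>n. a (r n) p)" for p
  have L: "(\<lambda>n. a (r n) p) \<longlonglongrightarrow> L p" for p
    using conv[of p] unfolding L_def by (auto simp: convergent_def convergent_LIMSEQ_iff[symmetric])
  have "\<exists>N. \<forall>i\<ge>N. \<forall>j\<ge>N. sqnorm ?M (\<lambda>x. \<phi> (r i) x - \<phi> (r j) x) < e" if "0 < e" for e
  proof -
    define A where "A = 2 * 2 ^ CARD('n) * (real CARD('n))\<^sup>2 * (4 * C)"
    have A0: "0 \<le> A" using C0 by (simp add: A_def)
    obtain m :: nat where m: "A / (e / 2) < real m" using reals_Archimedean2 by blast
    have Am: "2 * 2 ^ CARD('n) * (CARD('n) / real (Suc m))\<^sup>2 * (4 * C) < e / 2"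
    proof -
      have "A < e / 2 * real m" using m \<open>0 < e\<close> by (simp add: field_simps)
      also have "\<dots> \<le> e / 2 * (real (Suc m))\<^sup>2"
        using \<open>0 < e\<close> by (intro mult_left_mono) (auto simp: power2_eq_square algebra_simps)
      finally have "A / (real (Suc m))\<^sup>2 < e / 2" by (simp add: field_simps del: of_nat_Suc)
      then show ?thesis by (simp add: A_def power_divide del: of_nat_Suc)
    qed
    define I where "I = (\<lambda>x i. \<lfloor>x $ i * real (Suc m)\<rfloor>) ` \<Omega>"
    define w where "w k = measure lebesgue (?Q m k)" for k
    have w: "0 \<le> w k" for k by (simp add: w_def)
    define \<tau> where "\<tau> n = (\<Sum>k\<in>I. 4 * (w k * ((a (r n) (m, k) - L (m, k)) / w k)\<^sup>2))" for n
    have "\<tau> \<longlonglongrightarrow> (\<Sum>k\<in>I. 4 * (w k * ((L (m, k) - L (m, k)) / w k)\<^sup>2))"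
      unfolding \<tau>_def divide_inverse by (intro tendsto_intros L)
    then have "\<tau> \<longlonglongrightarrow> 0" by simp
    then have "eventually (\<lambda>n. \<tau> n < e / 4) sequentially"
      using \<open>0 < e\<close> by (intro order_tendstoD) auto
    then obtain N where N: "\<And>n. N \<le> n \<Longrightarrow> \<tau> n < e / 4" by (auto simp: eventually_sequentially)
    have "sqnorm ?M (\<lambda>x. \<phi> (r i) x - \<phi> (r j) x) < e" if ij: "N \<le> i" "N \<le> j" for i j
    proof -
      let ?g = "\<lambda>x. \<phi> (r i) x - \<phi> (r j) x"
      have g: "?g \<in> test_functions \<Omega>" by (rule test_function_diff[OF \<phi> \<phi>])
      have "sqnorm ?M (grad ?g) = sqnorm ?M (\<lambda>x. grad (\<phi> (r i)) x - grad (\<phi> (r j)) x)"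
        unfolding sqnorm_def by (simp add: grad_diff[OF \<phi> \<phi>])
      also have "\<dots> \<le> 2 * sqnorm ?M (grad (\<phi> (r i))) + 2 * sqnorm ?M (grad (\<phi> (r j)))"
        by (intro sqnorm_diff_le sq)
      also have "\<dots> \<le> 4 * C" using C(2)[of "r i"] C(2)[of "r j"] by simp
      finally have gr: "sqnorm ?M (grad ?g) \<le> 4 * C" .
      have int: "(LINT x|lebesgue_on (?Q m k). ?g x) = a (r i) (m, k) - a (r j) (m, k)" for k
      proof -
        interpret finite_measure "lebesgue_on (?Q m k)"
          by (rule finite_measure_lebesgue_on[OF grid_cell_lmeasurable])
        show ?thesis
          unfolding a_def fst_conv snd_conv
          by (intro Bochner_Integration.integral_diff integrable_L2 continuous_square_integrable_on_bounded
              test_function_continuous[OF \<phi>] grid_cell_borel grid_cell_bounded)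
      qed
      have "sqnorm ?M ?g \<le> 2 * 2 ^ CARD('n) * (CARD('n) / real (Suc m))\<^sup>2 * sqnorm ?M (grad ?g) +
          (\<Sum>k\<in>I. 2 * (w k * ((LINT x|lebesgue_on (?Q m k). ?g x) / w k)\<^sup>2))"
        unfolding I_def w_def by (rule sqnorm_test_function_le_grid[OF \<Omega> g])
      also have "\<dots> \<le> 2 * 2 ^ CARD('n) * (CARD('n) / real (Suc m))\<^sup>2 * (4 * C) + (\<tau> i + \<tau> j)"
      proof (rule add_mono)
        show "2 * 2 ^ CARD('n) * (CARD('n) / real (Suc m))\<^sup>2 * sqnorm ?M (grad ?g) \<le>
            2 * 2 ^ CARD('n) * (CARD('n) / real (Suc m))\<^sup>2 * (4 * C)"
          by (rule mult_left_mono[OF gr]) simp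
        show "(\<Sum>k\<in>I. 2 * (w k * ((LINT x|lebesgue_on (?Q m k). ?g x) / w k)\<^sup>2)) \<le> \<tau> i + \<tau> j"
          unfolding \<tau>_def sum.distrib[symmetric]
        proof (rule sum_mono)
          fix k
          let ?u = "(a (r i) (m, k) - L (m, k)) / w k" and ?v = "(a (r j) (m, k) - L (m, k)) / w k"
          have "(LINT x|lebesgue_on (?Q m k). ?g x) / w k = ?u - ?v"
            by (simp add: int diff_divide_distrib)
          moreover have "(?u - ?v)\<^sup>2 \<le> 2 * ?u\<^sup>2 + 2 * ?v\<^sup>2"
            by (rule sq2)
          ultimately have "2 * (w k * ((LINT x|lebesgue_on (?Q m k). ?g x) / w k)\<^sup>2) \<le>
              2 * (w k * (2 * ?u\<^sup>2 + 2 * ?v\<^sup>2))"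
            using w[of k] by (simp add: mult_left_mono)
          also have "\<dots> = 4 * (w k * ?u\<^sup>2) + 4 * (w k * ?v\<^sup>2)" by (simp add: algebra_simps)
          finally show "2 * (w k * ((LINT x|lebesgue_on (?Q m k). ?g x) / w k)\<^sup>2) \<le>
              4 * (w k * ?u\<^sup>2) + 4 * (w k * ?v\<^sup>2)" .
        qed
      qed
      also have "\<dots> < e" using Am N[OF ij(1)] N[OF ij(2)] by linarith
      finally show ?thesis .
    qed
    then show ?thesis by blast
  qed
  then have "\<forall>e>0. \<exists>N. \<forall>i\<ge>N. \<forall>j\<ge>N. sqnorm ?M (\<lambda>x. \<phi> (r i) x - \<phi> (r j) x) < e" by blast
  with r show ?thesis by (intro exI[of _ r] conjI)
qed

section \<open>Quadratic forms with a ground state\<close>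

locale elliptic_coefficient =
  fixes \<Omega> :: "(real ^ 'n) set" and A :: "real ^ 'n \<Rightarrow> real ^ 'n ^ 'n" and \<mu> \<Lambda> :: real
  assumes open_\<Omega>: "open \<Omega>" and bounded_\<Omega>: "bounded \<Omega>"
    and measurable_A: "\<And>F. F \<in> borel_measurable (lebesgue_on \<Omega>) \<Longrightarrow>
      (\<lambda>x. A x *v F x) \<in> borel_measurable (lebesgue_on \<Omega>)"
    and symmetric_A: "\<And>x v w. x \<in> \<Omega> \<Longrightarrow> (A x *v v) \<bullet> w = (A x *v w) \<bullet> v"
    and \<mu>_pos: "0 < \<mu>" and \<Lambda>_nonneg: "0 \<le> \<Lambda>" and coercive_A: "\<And>x v. x \<in> \<Omega> \<Longrightarrow> \<mu> * (norm v)\<^sup>2 \<le> (A x *v v) \<bullet> v"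
    and bounded_A: "\<And>x v. x \<in> \<Omega> \<Longrightarrow> norm (A x *v v) \<le> \<Lambda> * norm v"
begin

abbreviation M where "M \<equiv> lebesgue_on \<Omega>"

definition energy :: "(real ^ 'n \<Rightarrow> real ^ 'n) \<Rightarrow> (real ^ 'n \<Rightarrow> real ^ 'n) \<Rightarrow> real" where
  "energy F G = (LINT x|M. (A x *v F x) \<bullet> G x)"

lemma finite_M: "finite_measure M"
  by (rule finite_measure_lebesgue_on_bounded[OF open_\<Omega> bounded_\<Omega>])

sublocale finite_measure M by (rule finite_M)

lemmas sq_test = test_function_square_integrable[OF finite_M]

lemma square_integrable_A:
  assumes "square_integrable M F" shows "square_integrable M (\<lambda>x. A x *v F x)"
  by (rule square_integrable_bound[OF assms, of _ \<Lambda>])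
    (use bounded_A in \<open>auto intro: measurable_A square_integrable_measurable assms\<close>)

lemma energy_integrable:
  "square_integrable M F \<Longrightarrow> square_integrable M G \<Longrightarrow> integrable M (\<lambda>x. (A x *v F x) \<bullet> G x)"
  by (intro integrable_inner square_integrable_A)

lemma energy_commute: "energy F G = energy G F"
  unfolding energy_def
  by (rule Bochner_Integration.integral_cong) (simp_all add: symmetric_A)

lemma energy_add_left:
  assumes "square_integrable M F" "square_integrable M F'" "square_integrable M G"
  shows "energy (\<lambda>x. F x + F' x) G = energy F G + energy F' G"
  using energy_integrable[OF assms(1,3)] energy_integrable[OF assms(2,3)]
  by (simp add: energy_def matrix_vector_right_distrib inner_add_left)

lemma energy_scaleR_left: "energy (\<lambda>x. c *\<^sub>R F x) G = c * energy F G"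
  by (simp add: energy_def matrix_vector_mult_scaleR)

lemma energy_ge:
  assumes "square_integrable M F" shows "\<mu> * sqnorm M F \<le> energy F F"
proof -
  have "\<mu> * sqnorm M F = (LINT x|M. \<mu> * (norm (F x))\<^sup>2)" by (simp add: sqnorm_def)
  also have "\<dots> \<le> energy F F" unfolding energy_def
    using assms coercive_A by (intro integral_mono energy_integrable integrable_mult_right square_integrable_sq) auto
  finally show ?thesis .
qed

lemma energy_le:
  assumes "square_integrable M F" shows "energy F F \<le> \<Lambda> * sqnorm M F"
proof -
  have "energy F F \<le> (LINT x|M. \<Lambda> * (norm (F x))\<^sup>2)" unfolding energy_def
  proof (intro integral_mono energy_integrable integrable_mult_right square_integrable_sq assms)
    fix x assume "x \<in> space M"
    then have "norm (A x *v F x) * norm (F x) \<le> \<Lambda> * norm (F x) * norm (F x)"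
      using bounded_A by (intro mult_right_mono) auto
    then show "(A x *v F x) \<bullet> F x \<le> \<Lambda> * (norm (F x))\<^sup>2"
      using Cauchy_Schwarz_ineq2[of "A x *v F x" "F x"] by (simp add: power2_eq_square mult.assoc)
  qed
  then show ?thesis by (simp add: sqnorm_def)
qed

lemma L2_tendsto_A:
  assumes "L2_tendsto M F F'" shows "L2_tendsto M (\<lambda>k x. A x *v F k x) (\<lambda>x. A x *v F' x)"
  by (rule L2_tendsto_bound[OF assms, of _ _ \<Lambda>])
    (use bounded_A in \<open>auto intro: square_integrable_A L2_tendstoD[OF assms] simp: matrix_vector_mult_diff_distrib[symmetric]\<close>)

lemma energy_tendsto:
  assumes "L2_tendsto M F F'" "L2_tendsto M G G'"
  shows "(\<lambda>k. energy (F k) (G k)) \<longlonglongrightarrow> energy F' G'"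
  unfolding energy_def by (intro L2_tendsto_inner L2_tendsto_A assms)

end

text \<open>The constant \<open>\<kappa>\<close> lies below all Rayleigh quotients of test functions, which makes the form \<open>B\<close>
below nonnegative. In the application it is the principal eigenvalue.\<close>

locale elliptic_ground_level = elliptic_coefficient \<Omega> A \<mu> \<Lambda>
  for \<Omega> :: "(real ^ 'n) set" and A \<mu> \<Lambda> +
  fixes \<kappa> :: real
  assumes ground_level: "\<And>\<phi>. \<phi> \<in> test_functions \<Omega> \<Longrightarrow> \<kappa> * sqnorm M \<phi> \<le> energy (grad \<phi>) (grad \<phi>)"
begin

definition B :: "(real ^ 'n \<Rightarrow> real) \<Rightarrow> (real ^ 'n \<Rightarrow> real) \<Rightarrow> real" where
  "B \<phi> \<psi> = energy (grad \<phi>) (grad \<psi>) - \<kappa> * (LINT x|M. \<phi> x * \<psi> x)"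

lemma B_diag: "B \<phi> \<phi> = energy (grad \<phi>) (grad \<phi>) - \<kappa> * sqnorm M \<phi>"
  by (simp add: B_def sqnorm_def power2_eq_square)

lemma B_nonneg: "\<phi> \<in> test_functions \<Omega> \<Longrightarrow> 0 \<le> B \<phi> \<phi>"
  using ground_level by (simp add: B_diag)

lemma B_commute: "B \<phi> \<psi> = B \<psi> \<phi>"
  unfolding B_def by (simp add: energy_commute[of "grad \<phi>"] mult.commute)

lemma B_add_left:
  assumes "\<phi> \<in> test_functions \<Omega>" "\<phi>' \<in> test_functions \<Omega>" "\<psi> \<in> test_functions \<Omega>"
  shows "B (\<lambda>x. \<phi> x + \<phi>' x) \<psi> = B \<phi> \<psi> + B \<phi>' \<psi>"
proof -
  have "energy (grad (\<lambda>x. \<phi> x + \<phi>' x)) (grad \<psi>) = energy (\<lambda>x. grad \<phi> x + grad \<phi>' x) (grad \<psi>)"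
    using assms by (simp add: energy_def grad_add)
  also have "\<dots> = energy (grad \<phi>) (grad \<psi>) + energy (grad \<phi>') (grad \<psi>)"
    by (intro energy_add_left sq_test assms)
  finally show ?thesis
    using integrable_mult_L2[OF sq_test(1)[OF assms(1)] sq_test(1)[OF assms(3)]]
      integrable_mult_L2[OF sq_test(1)[OF assms(2)] sq_test(1)[OF assms(3)]]
    by (simp add: B_def distrib_right distrib_left)
qed

lemma B_cmult_left:
  assumes "\<phi> \<in> test_functions \<Omega>" shows "B (\<lambda>x. c * \<phi> x) \<psi> = c * B \<phi> \<psi>"
proof -
  have "energy (grad (\<lambda>x. c * \<phi> x)) (grad \<psi>) = energy (\<lambda>x. c *\<^sub>R grad \<phi> x) (grad \<psi>)"
    using assms by (simp add: energy_def grad_cmult)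
  then show ?thesis by (simp add: B_def energy_scaleR_left mult.assoc algebra_simps)
qed

lemma B_combination:
  assumes \<phi>: "\<phi> \<in> test_functions \<Omega>" and \<psi>: "\<psi> \<in> test_functions \<Omega>"
  shows "B (\<lambda>x. \<phi> x + t * \<psi> x) (\<lambda>x. \<phi> x + t * \<psi> x) = B \<phi> \<phi> + 2 * t * B \<phi> \<psi> + t\<^sup>2 * B \<psi> \<psi>"
proof -
  note t\<psi> = test_function_cmult[OF \<psi>, of t]
  note s = test_function_add[OF \<phi> t\<psi>]
  have "B (\<lambda>x. \<phi> x + t * \<psi> x) (\<lambda>x. \<phi> x + t * \<psi> x) =
      B (\<lambda>x. \<phi> x + t * \<psi> x) \<phi> + t * B (\<lambda>x. \<phi> x + t * \<psi> x) \<psi>"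
    by (simp add: B_add_left[OF \<phi> t\<psi> s] B_cmult_left[OF \<psi>] B_commute[of _ "\<lambda>x. \<phi> x + t * \<psi> x"])
  also have "\<dots> = B \<phi> \<phi> + 2 * t * B \<phi> \<psi> + t\<^sup>2 * B \<psi> \<psi>"
    by (simp add: B_add_left[OF \<phi> t\<psi> \<phi>] B_add_left[OF \<phi> t\<psi> \<psi>] B_cmult_left[OF \<psi>] B_commute[of \<psi> \<phi>]
        power2_eq_square algebra_simps)
  finally show ?thesis .
qed

lemma B_Cauchy_Schwarz:
  assumes \<phi>: "\<phi> \<in> test_functions \<Omega>" and \<psi>: "\<psi> \<in> test_functions \<Omega>"
  shows "\<bar>B \<phi> \<psi>\<bar> \<le> sqrt (B \<phi> \<phi>) * sqrt (B \<psi> \<psi>)"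
proof (rule abs_le_sqrt_mult_of_nonneg_quadratic)
  show "0 \<le> B \<phi> \<phi> + 2 * t * B \<phi> \<psi> + t\<^sup>2 * B \<psi> \<psi>" for t
    using B_nonneg[OF test_function_add[OF \<phi> test_function_cmult[OF \<psi>, of t]]]
    by (simp add: B_combination[OF \<phi> \<psi>])
qed (intro B_nonneg \<phi> \<psi>)+

lemma B_combination_le:
  assumes \<phi>: "\<phi> \<in> test_functions \<Omega>" and \<psi>: "\<psi> \<in> test_functions \<Omega>"
  shows "B (\<lambda>x. \<phi> x + t * \<psi> x) (\<lambda>x. \<phi> x + t * \<psi> x) \<le> 2 * B \<phi> \<phi> + 2 * t\<^sup>2 * B \<psi> \<psi>"
  using B_nonneg[OF test_function_add[OF \<phi> test_function_cmult[OF \<psi>, of "- t"]]]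
    B_combination[OF \<phi> \<psi>, of "- t"] B_combination[OF \<phi> \<psi>, of t]
  by simp

text \<open>The kernel of the nonnegative form \<open>B\<close>, that is, the eigenfunctions for the level \<open>\<kappa>\<close>, described
through approximating test functions. Nonlinear operations are applied to the approximations, where
the classical chain rule is available.\<close>

definition null_limit :: "(real ^ 'n \<Rightarrow> real) \<Rightarrow> bool" where
  "null_limit u \<longleftrightarrow> (\<exists>\<phi>. (\<forall>k. \<phi> k \<in> test_functions \<Omega>) \<and> L2_tendsto M \<phi> u \<and>
     (\<lambda>k. B (\<phi> k) (\<phi> k)) \<longlonglongrightarrow> 0)"

lemma null_limit_combination:
  assumes "null_limit u" "null_limit v"
  shows "null_limit (\<lambda>x. u x + t * v x)"
proof -
  obtain \<phi> where \<phi>: "\<And>k. \<phi> k \<in> test_functions \<Omega>" "L2_tendsto M \<phi> u" "(\<lambda>k. B (\<phi> k) (\<phi> k)) \<longlonglongrightarrow> 0"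
    using assms(1) unfolding null_limit_def by blast
  obtain \<psi> where \<psi>: "\<And>k. \<psi> k \<in> test_functions \<Omega>" "L2_tendsto M \<psi> v" "(\<lambda>k. B (\<psi> k) (\<psi> k)) \<longlonglongrightarrow> 0"
    using assms(2) unfolding null_limit_def by blast
  have tf: "(\<lambda>x. \<phi> k x + t * \<psi> k x) \<in> test_functions \<Omega>" for k
    by (intro test_function_add test_function_cmult \<phi> \<psi>)
  have L2: "L2_tendsto M (\<lambda>k x. \<phi> k x + t * \<psi> k x) (\<lambda>x. u x + t * v x)"
    using L2_tendsto_add[OF \<phi>(2) L2_tendsto_scaleR[OF \<psi>(2), of t]] by simp
  have lim: "(\<lambda>k. 2 * B (\<phi> k) (\<phi> k) + 2 * t\<^sup>2 * B (\<psi> k) (\<psi> k)) \<longlonglongrightarrow> 0"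
    using tendsto_add[OF tendsto_mult_right_zero[OF \<phi>(3), of 2] tendsto_mult_right_zero[OF \<psi>(3), of "2 * t\<^sup>2"]]
    by simp
  have "(\<lambda>k. B (\<lambda>x. \<phi> k x + t * \<psi> k x) (\<lambda>x. \<phi> k x + t * \<psi> k x)) \<longlonglongrightarrow> 0"
    by (rule tendsto_sandwich[OF always_eventually always_eventually tendsto_const lim])
      (intro allI B_nonneg tf B_combination_le \<phi> \<psi>)+
  then show ?thesis
    unfolding null_limit_def using tf L2 by (intro exI[of _ "\<lambda>k x. \<phi> k x + t * \<psi> k x"]) simp
qed

lemma square_integrable_null_limit: "null_limit u \<Longrightarrow> square_integrable M u"
  unfolding null_limit_def using L2_tendstoD(2) by blast

text \<open>A smooth substitute for the absolute value that vanishes at zero, so that supports do not grow.\<close>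

lemma smooth_abs_test_function:
  assumes \<phi>: "\<phi> \<in> test_functions \<Omega>" and e: "0 < e"
  shows "(\<lambda>x. sqrt ((\<phi> x)\<^sup>2 + e\<^sup>2) - e) \<in> test_functions \<Omega>"
    and "grad (\<lambda>x. sqrt ((\<phi> x)\<^sup>2 + e\<^sup>2) - e) x = (\<phi> x / sqrt ((\<phi> x)\<^sup>2 + e\<^sup>2)) *\<^sub>R grad \<phi> x"
proof -
  have pos: "0 < \<phi> x * \<phi> x + e * e" for x using e by (simp add: add_nonneg_pos)
  have C: "C_k k (\<lambda>x. sqrt (\<phi> x * \<phi> x + e * e) + - e)" for k
    by (intro C_k_add[OF C_k_sqrt[OF C_k_add[OF C_k_mult C_k_const]] C_k_const]
        test_function_C_k[OF \<phi>] pos)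
  obtain K where K: "compact K" "K \<subseteq> \<Omega>" "\<forall>x. x \<notin> K \<longrightarrow> \<phi> x = 0 \<and> grad \<phi> x = 0"
    using test_function_support[OF \<phi>] by blast
  have sub: "{x. sqrt (\<phi> x * \<phi> x + e * e) + - e \<noteq> 0} \<subseteq> K"
  proof
    fix x assume "x \<in> {x. sqrt (\<phi> x * \<phi> x + e * e) + - e \<noteq> 0}"
    then have "\<phi> x \<noteq> 0" using e by auto
    then show "x \<in> K" using K(3) by blast
  qed
  show "(\<lambda>x. sqrt ((\<phi> x)\<^sup>2 + e\<^sup>2) - e) \<in> test_functions \<Omega>"
    using test_functionsI[OF C sub K(1,2)] by (simp add: power2_eq_square)
  have halve: "(inverse s / 2) *\<^sub>R (p *\<^sub>R v + p *\<^sub>R v + 0) - 0 = (p / s) *\<^sub>R v" for s p and v :: "real ^ 'n"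
  proof -
    have "p *\<^sub>R v + p *\<^sub>R v + 0 = (p + p) *\<^sub>R v" by (simp only: scaleR_left_distrib add_0_right)
    moreover have "inverse s / 2 * (p + p) = p / s" by (simp add: field_simps)
    ultimately show ?thesis by (simp only: diff_0_right scaleR_scaleR)
  qed
  note g = test_function_GDERIV[OF \<phi>, of x]
  let ?s = "sqrt (\<phi> x * \<phi> x + e * e)"
  have "GDERIV (\<lambda>x. \<phi> x * \<phi> x) x :> \<phi> x *\<^sub>R grad \<phi> x + \<phi> x *\<^sub>R grad \<phi> x"
    by (rule GDERIV_mult[OF g g])
  then have "GDERIV (\<lambda>x. \<phi> x * \<phi> x + e * e) x :> \<phi> x *\<^sub>R grad \<phi> x + \<phi> x *\<^sub>R grad \<phi> x + 0"
    by (rule GDERIV_add) (rule GDERIV_const)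
  then have "GDERIV (\<lambda>x. sqrt (\<phi> x * \<phi> x + e * e)) x :>
      (inverse ?s / 2) *\<^sub>R (\<phi> x *\<^sub>R grad \<phi> x + \<phi> x *\<^sub>R grad \<phi> x + 0)"
    by (rule GDERIV_sqrt) (rule pos)
  then have "GDERIV (\<lambda>x. sqrt (\<phi> x * \<phi> x + e * e) - e) x :>
      (inverse ?s / 2) *\<^sub>R (\<phi> x *\<^sub>R grad \<phi> x + \<phi> x *\<^sub>R grad \<phi> x + 0) - 0"
    by (rule GDERIV_diff) (rule GDERIV_const)
  then have "grad (\<lambda>x. sqrt (\<phi> x * \<phi> x + e * e) - e) x =
      (inverse ?s / 2) *\<^sub>R (\<phi> x *\<^sub>R grad \<phi> x + \<phi> x *\<^sub>R grad \<phi> x + 0) - 0"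
    by (rule GDERIV_imp_grad_eq)
  also have "\<dots> = (\<phi> x / ?s) *\<^sub>R grad \<phi> x" by (rule halve)
  finally show "grad (\<lambda>x. sqrt ((\<phi> x)\<^sup>2 + e\<^sup>2) - e) x = (\<phi> x / sqrt ((\<phi> x)\<^sup>2 + e\<^sup>2)) *\<^sub>R grad \<phi> x"
    by (simp only: power2_eq_square)
qed

text \<open>The gradient is multiplied by a factor between \<open>-1\<close> and \<open>1\<close>.\<close>

lemma energy_smooth_abs_le:
  assumes \<phi>: "\<phi> \<in> test_functions \<Omega>" and e: "0 < e"
  defines "\<psi> \<equiv> (\<lambda>x. sqrt ((\<phi> x)\<^sup>2 + e\<^sup>2) - e)"
  shows "energy (grad \<psi>) (grad \<psi>) \<le> energy (grad \<phi>) (grad \<phi>)"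
proof -
  have \<psi>: "\<psi> \<in> test_functions \<Omega>" unfolding \<psi>_def by (rule smooth_abs_test_function[OF \<phi> e])
  show ?thesis unfolding energy_def
  proof (intro integral_mono energy_integrable sq_test \<phi> \<psi>)
    fix x assume "x \<in> space M"
    then have x: "x \<in> \<Omega>" by simp
    let ?t = "\<phi> x / sqrt ((\<phi> x)\<^sup>2 + e\<^sup>2)"
    have "\<bar>\<phi> x\<bar> \<le> sqrt ((\<phi> x)\<^sup>2 + e\<^sup>2)" by (rule real_le_rsqrt) simp
    moreover have "0 < sqrt ((\<phi> x)\<^sup>2 + e\<^sup>2)" using e by (simp add: add_nonneg_pos)
    ultimately have "\<bar>?t\<bar> \<le> 1" by (simp add: abs_divide)
    then have "?t\<^sup>2 \<le> 1" by (simp add: abs_square_le_1)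
    moreover have "0 \<le> (A x *v grad \<phi> x) \<bullet> grad \<phi> x"
      using coercive_A[OF x, of "grad \<phi> x"] \<mu>_pos
      by (meson less_imp_le mult_nonneg_nonneg order_trans zero_le_power2)
    ultimately have "?t\<^sup>2 * ((A x *v grad \<phi> x) \<bullet> grad \<phi> x) \<le> (A x *v grad \<phi> x) \<bullet> grad \<phi> x"
      by (simp add: mult_left_le_one_le)
    then show "(A x *v grad \<psi> x) \<bullet> grad \<psi> x \<le> (A x *v grad \<phi> x) \<bullet> grad \<phi> x"
      unfolding \<psi>_def smooth_abs_test_function(2)[OF \<phi> e]
      by (simp only: matrix_vector_mult_scaleR inner_scaleR_left inner_scaleR_right power2_eq_square mult.assoc)
  qed
qed

text \<open>Regularized absolute values converge in \<open>L\<^sup>2\<close> when the regularization vanishes. The energy does not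
increase and the norms have the same limit, so the form still tends to zero. The approximations are
moreover nonnegative, which the logarithms below need.\<close>

lemma null_limit_abs_approx:
  assumes "null_limit u"
  shows "\<exists>\<psi>. (\<forall>k. \<psi> k \<in> test_functions \<Omega> \<and> (\<forall>x. 0 \<le> \<psi> k x)) \<and> L2_tendsto M \<psi> (\<lambda>x. \<bar>u x\<bar>) \<and>
    (\<lambda>k. B (\<psi> k) (\<psi> k)) \<longlonglongrightarrow> 0"
proof -
  obtain \<phi> where \<phi>: "\<And>k. \<phi> k \<in> test_functions \<Omega>" "L2_tendsto M \<phi> u" "(\<lambda>k. B (\<phi> k) (\<phi> k)) \<longlonglongrightarrow> 0"
    using assms unfolding null_limit_def by blast
  define e where "e k = inverse (real (Suc k))" for k
  have e: "0 < e k" for k by (simp add: e_def)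
  have e0: "e \<longlonglongrightarrow> 0" unfolding e_def by (rule LIMSEQ_inverse_real_of_nat)
  define \<psi> where "\<psi> k x = sqrt ((\<phi> k x)\<^sup>2 + (e k)\<^sup>2) - e k" for k x
  have \<psi>: "\<psi> k \<in> test_functions \<Omega>" for k
    unfolding \<psi>_def by (rule smooth_abs_test_function(1)[OF \<phi>(1) e])
  have \<psi>0: "0 \<le> \<psi> k x" for k x
    using real_le_rsqrt[of "e k" "(\<phi> k x)\<^sup>2 + (e k)\<^sup>2"] by (simp add: \<psi>_def)
  have close: "\<bar>\<psi> k x - \<bar>\<phi> k x\<bar>\<bar> \<le> e k" for k x
  proof -
    have "\<bar>\<phi> k x\<bar> \<le> sqrt ((\<phi> k x)\<^sup>2 + (e k)\<^sup>2)" by (rule real_le_rsqrt) simp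
    moreover have "sqrt ((\<phi> k x)\<^sup>2 + (e k)\<^sup>2) \<le> \<bar>\<phi> k x\<bar> + e k"
      using sqrt_sum_squares_le_sum_abs[of "\<phi> k x" "e k"] e[of k] by simp
    ultimately show ?thesis using e[of k] by (simp add: \<psi>_def)
  qed
  have sabs: "square_integrable M (\<lambda>x. \<bar>v x\<bar>)" if "square_integrable M v" for v :: "real ^ 'n \<Rightarrow> real"
    using that by (auto simp: square_integrable_def)
  have L1: "L2_tendsto M (\<lambda>k x. \<bar>\<phi> k x\<bar>) (\<lambda>x. \<bar>u x\<bar>)"
    by (rule L2_tendsto_bound[OF \<phi>(2), of _ _ 1]) (auto intro!: sabs L2_tendstoD[OF \<phi>(2)])
  have Le: "L2_tendsto M (\<lambda>k x. e k) (\<lambda>x. 0)"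
  proof (rule L2_tendstoI)
    have "(\<lambda>k. measure M (space M) * (e k)\<^sup>2) \<longlonglongrightarrow> measure M (space M) * 0\<^sup>2"
      by (intro tendsto_intros e0)
    then show "(\<lambda>k. sqnorm M (\<lambda>x. e k - 0)) \<longlonglongrightarrow> 0" by (simp add: sqnorm_def)
  qed (rule square_integrable_const)+
  have L2: "L2_tendsto M (\<lambda>k x. \<psi> k x - \<bar>\<phi> k x\<bar>) (\<lambda>x. 0)"
  proof (rule L2_tendsto_bound[OF Le, of _ _ 1])
    show "square_integrable M (\<lambda>x. \<psi> k x - \<bar>\<phi> k x\<bar>)" for k
      by (intro square_integrable_diff sq_test(1)[OF \<psi>] sabs sq_test(1)[OF \<phi>(1)])
    show "norm (\<psi> k x - \<bar>\<phi> k x\<bar> - 0) \<le> 1 * norm (e k - 0)" for k x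
      using close[of k x] e[of k] by simp
  qed (rule square_integrable_const)
  have L: "L2_tendsto M \<psi> (\<lambda>x. \<bar>u x\<bar>)" using L2_tendsto_add[OF L1 L2] by simp
  have "(\<lambda>k. B (\<phi> k) (\<phi> k) + \<kappa> * (sqnorm M (\<phi> k) - sqnorm M (\<psi> k))) \<longlonglongrightarrow>
      0 + \<kappa> * (sqnorm M u - sqnorm M (\<lambda>x. \<bar>u x\<bar>))"
    by (intro tendsto_intros \<phi>(3) L2_tendsto_sqnorm[OF \<phi>(2)] L2_tendsto_sqnorm[OF L])
  then have lim: "(\<lambda>k. B (\<phi> k) (\<phi> k) + \<kappa> * (sqnorm M (\<phi> k) - sqnorm M (\<psi> k))) \<longlonglongrightarrow> 0"
    by (simp add: sqnorm_def)
  have "(\<lambda>k. B (\<psi> k) (\<psi> k)) \<longlonglongrightarrow> 0"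
  proof (rule tendsto_sandwich[OF always_eventually always_eventually tendsto_const lim]; rule allI)
    show "0 \<le> B (\<psi> k) (\<psi> k)" for k by (rule B_nonneg[OF \<psi>])
    show "B (\<psi> k) (\<psi> k) \<le> B (\<phi> k) (\<phi> k) + \<kappa> * (sqnorm M (\<phi> k) - sqnorm M (\<psi> k))" for k
      using energy_smooth_abs_le[OF \<phi>(1)[of k] e[of k]]
      by (simp add: B_diag \<psi>_def[abs_def] right_diff_distrib)
  qed
  with \<psi> \<psi>0 L show ?thesis by (intro exI[of _ \<psi>] conjI allI)
qed

lemma null_limit_abs: "null_limit u \<Longrightarrow> null_limit (\<lambda>x. \<bar>u x\<bar>)"
  using null_limit_abs_approx[of u] unfolding null_limit_def by blast

end

section \<open>The strong maximum principle\<close>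

text \<open>Suppose that \<open>w\<close> vanishes on a set \<open>Z\<close> and is at least \<open>d\<close> on a set \<open>P\<close>. As \<open>e\<close> tends to zero, the
values of \<open>ln (1 + w / e)\<close> on the two sets drift arbitrarily far apart. Deviations from a constant
that are bounded in mean square uniformly in \<open>e\<close> are then possible only if \<open>Z\<close> or \<open>P\<close> is a null set.\<close>

lemma log_oscillation_dichotomy:
  fixes w :: "'a \<Rightarrow> real"
  assumes "finite_measure M" and [measurable]: "w \<in> borel_measurable M" and w0: "\<And>x. 0 \<le> w x"
    and osc: "\<And>e. 0 < e \<Longrightarrow> \<exists>c. square_integrable M (\<lambda>x. ln (1 + w x / e) - c) \<and>
      sqnorm M (\<lambda>x. ln (1 + w x / e) - c) \<le> K"
  shows "(AE x in M. w x = 0) \<or> (AE x in M. 0 < w x)"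
proof (rule disjCI)
  interpret finite_measure M by fact
  define Z where "Z = {x \<in> space M. w x = 0}"
  have [measurable]: "Z \<in> sets M" unfolding Z_def by measurable
  assume nAE: "\<not> (AE x in M. 0 < w x)"
  have Zpos: "0 < measure M Z"
  proof (rule ccontr)
    assume "\<not> 0 < measure M Z"
    then have "emeasure M Z = 0" by (simp add: emeasure_eq_measure zero_less_measure_iff)
    then have "Z \<in> null_sets M" by auto
    then have "AE x in M. x \<notin> Z" by (rule AE_not_in)
    then have "AE x in M. 0 < w x"
    proof (rule AE_mp, intro AE_I2 impI)
      fix x assume "x \<in> space M" "x \<notin> Z"
      then show "0 < w x" using w0[of x] by (simp add: Z_def less_le)
    qed
    with nAE show False by simp
  qed
  have "AE x in M. w x < d" if d: "0 < d" for d
  proof -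
    define P where "P = {x \<in> space M. d \<le> w x}"
    have [measurable]: "P \<in> sets M" unfolding P_def by measurable
    have "\<not> 0 < measure M P"
    proof
      assume Ppos: "0 < measure M P"
      define m where "m = min (measure M Z) (measure M P)"
      have m: "0 < m" using Zpos Ppos by (simp add: m_def)
      \<comment> \<open>\<open>T\<close> is so large that \<open>(T / 2)\<^sup>2 m\<close> exceeds \<open>K\<close>, and \<open>e\<close> is chosen such that the
         logarithm differs by at least \<open>T\<close> between the sets \<open>Z\<close> and \<open>P\<close>.\<close>
      define T where "T = 2 * sqrt ((\<bar>K\<bar> + 1) / m)"
      have T: "0 < T" "(T / 2)\<^sup>2 = (\<bar>K\<bar> + 1) / m" using m by (simp_all add: T_def)
      define e where "e = d / (exp T - 1)"
      have e: "0 < e" using T d by (simp add: e_def)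
      have de: "1 + d / e = exp T" using T(1) d by (simp add: e_def)
      obtain c where c: "square_integrable M (\<lambda>x. ln (1 + w x / e) - c)"
          "sqnorm M (\<lambda>x. ln (1 + w x / e) - c) \<le> K" using osc[OF e] by blast
      have le: "(T / 2)\<^sup>2 * measure M S \<le> K"
        if S: "S \<in> sets M" "\<And>x. x \<in> S \<Longrightarrow> T / 2 \<le> \<bar>ln (1 + w x / e) - c\<bar>" for S
      proof -
        have "(T / 2)\<^sup>2 * measure M S = (LINT x|M. (T / 2)\<^sup>2 * indicator S x)" using S(1) by simp
        also have "\<dots> \<le> sqnorm M (\<lambda>x. ln (1 + w x / e) - c)"
          unfolding sqnorm_def
        proof (rule integral_mono)
          show "integrable M (\<lambda>x. (T / 2)\<^sup>2 * indicator S x)" using S(1)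
            by (intro integrable_mult_right integrable_real_indicator) (auto simp: emeasure_eq_measure)
          show "integrable M (\<lambda>x. (norm (ln (1 + w x / e) - c))\<^sup>2)" by (rule square_integrable_sq[OF c(1)])
          fix x
          show "(T / 2)\<^sup>2 * indicator S x \<le> (norm (ln (1 + w x / e) - c))\<^sup>2"
          proof (cases "x \<in> S")
            case True
            have "(T / 2)\<^sup>2 \<le> \<bar>ln (1 + w x / e) - c\<bar>\<^sup>2"
              by (rule power_mono[OF S(2)[OF True]]) (use T in simp)
            then show ?thesis using True by simp
          qed simp
        qed
        finally show ?thesis using c(2) by linarith
      qed
      have "(T / 2)\<^sup>2 * m \<le> K"
      proof (cases "T / 2 \<le> c")
        case True
        have "(T / 2)\<^sup>2 * measure M Z \<le> K"
          by (rule le) (use True T in \<open>auto simp: Z_def\<close>)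
        moreover have "(T / 2)\<^sup>2 * m \<le> (T / 2)\<^sup>2 * measure M Z"
          by (rule mult_left_mono) (auto simp: m_def)
        ultimately show ?thesis by linarith
      next
        case False
        have "(T / 2)\<^sup>2 * measure M P \<le> K"
        proof (rule le)
          fix x assume "x \<in> P"
          then have "d / e \<le> w x / e" using e by (simp add: P_def divide_right_mono)
          then have "exp T \<le> 1 + w x / e" using de by linarith
          then have "T \<le> ln (1 + w x / e)"
            by (smt (verit) exp_gt_zero ln_exp ln_le_cancel_iff)
          then show "T / 2 \<le> \<bar>ln (1 + w x / e) - c\<bar>" using False by linarith
        qed simp
        moreover have "(T / 2)\<^sup>2 * m \<le> (T / 2)\<^sup>2 * measure M P"
          by (rule mult_left_mono) (auto simp: m_def)
        ultimately show ?thesis by linarith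
      qed
      then show False using m T(2) by simp
    qed
    then have "emeasure M P = 0" by (simp add: emeasure_eq_measure zero_less_measure_iff)
    then have "P \<in> null_sets M" by auto
    then have "AE x in M. x \<notin> P" by (rule AE_not_in)
    then show ?thesis
      by (rule AE_mp) (auto simp: P_def)
  qed
  then have "AE x in M. \<forall>n. w x < inverse (real (Suc n))"
    by (simp add: AE_all_countable del: of_nat_Suc)
  then show "AE x in M. w x = 0"
  proof (rule AE_mp, intro AE_I2 impI)
    fix x assume "\<forall>n. w x < inverse (real (Suc n))"
    then have "w x \<le> 0"
      using LIMSEQ_inverse_real_of_nat by (intro LIMSEQ_le_const) (auto intro: less_imp_le)
    then show "w x = 0" using w0[of x] by simp
  qed
qed

lemma ln_one_plus_lipschitz:
  fixes a b e :: real
  assumes "0 \<le> a" "0 \<le> b" "0 < e"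
  shows "\<bar>ln (1 + a / e) - ln (1 + b / e)\<bar> \<le> inverse e * \<bar>a - b\<bar>"
proof -
  have *: "ln (1 + s / e) - ln (1 + t / e) \<le> inverse e * (s - t)" if "0 \<le> t" "t \<le> s" for s t
  proof -
    have pos: "0 < 1 + t / e" "0 < 1 + s / e" using that assms(3) by (auto intro!: add_pos_nonneg)
    have "ln (1 + s / e) - ln (1 + t / e) = ln ((1 + s / e) / (1 + t / e))"
      using pos by (simp add: ln_div)
    also have "\<dots> \<le> (1 + s / e) / (1 + t / e) - 1"
      using pos by (intro ln_le_minus_one) simp
    also have "\<dots> = ((1 + s / e) - (1 + t / e)) / (1 + t / e)"
      using pos(1) by (simp only: diff_divide_distrib) simp
    also have "\<dots> = ((s - t) / e) / (1 + t / e)" by (simp add: diff_divide_distrib)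
    also have "\<dots> \<le> ((s - t) / e) / 1"
      using that assms(3) by (intro divide_left_mono) (auto intro!: mult_pos_pos pos)
    finally show ?thesis by (simp add: field_simps)
  qed
  have mono: "ln (1 + t / e) \<le> ln (1 + s / e)" if "0 \<le> t" "t \<le> s" for s t
  proof -
    have "0 < 1 + t / e" using that assms(3) by (auto intro!: add_pos_nonneg)
    moreover have "t / e \<le> s / e" using that assms(3) by (simp add: divide_right_mono)
    ultimately show ?thesis by (simp add: ln_mono)
  qed
  show ?thesis
  proof (cases "b \<le> a")
    case True
    then show ?thesis using *[OF assms(2) True] mono[OF assms(2) True] by simp
  next
    case False
    then have "a \<le> b" by simp
    then show ?thesis using *[OF assms(1) \<open>a \<le> b\<close>] mono[OF assms(1) \<open>a \<le> b\<close>] by simp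
  qed
qed

lemma norm_add_sq_le_of_bounds:
  fixes a b c :: "'b::real_inner"
  assumes "c = a + b" "(norm a)\<^sup>2 \<le> u" "(norm b)\<^sup>2 \<le> v"
  shows "(norm c)\<^sup>2 \<le> 2 * u + 2 * v"
  using norm_add_sq_le[of a b] assms by simp

lemma square_integrable_subset:
  fixes f :: "real ^ 'n \<Rightarrow> 'b::euclidean_space"
  assumes f: "square_integrable (lebesgue_on S) f" and Q: "Q \<in> sets lebesgue" "Q \<subseteq> S" and S: "S \<in> sets lebesgue"
  shows "square_integrable (lebesgue_on Q) f" and "sqnorm (lebesgue_on Q) f \<le> sqnorm (lebesgue_on S) f"
proof -
  have int: "integrable lebesgue (\<lambda>x. indicator S x *\<^sub>R (norm (f x))\<^sup>2)"
    using square_integrable_sq[OF f] S by (simp add: integrable_restrict_space)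
  have "integrable lebesgue (\<lambda>x. indicator Q x *\<^sub>R (indicator S x *\<^sub>R (norm (f x))\<^sup>2))"
    using int Q(1) by (rule integrable_mult_indicator[rotated])
  moreover have "indicator Q x *\<^sub>R (indicator S x *\<^sub>R (norm (f x))\<^sup>2) = indicator Q x *\<^sub>R (norm (f x))\<^sup>2" for x
    using Q(2) by (auto simp: indicator_def)
  ultimately have intQ: "integrable lebesgue (\<lambda>x. indicator Q x *\<^sub>R (norm (f x))\<^sup>2)" by (simp only:)
  have "f \<in> borel_measurable (lebesgue_on Q)"
    using measurable_restrict_mono[OF square_integrable_measurable[OF f] Q(2)] .
  then show "square_integrable (lebesgue_on Q) f"
    using intQ Q(1) by (simp add: square_integrable_def integrable_restrict_space)
  have "(LINT x|lebesgue. indicator Q x *\<^sub>R (norm (f x))\<^sup>2) \<le> (LINT x|lebesgue. indicator S x *\<^sub>R (norm (f x))\<^sup>2)"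
    using Q(2) by (intro integral_mono intQ int) (auto simp: indicator_def)
  then show "sqnorm (lebesgue_on Q) f \<le> sqnorm (lebesgue_on S) f"
    using Q(1) S unfolding sqnorm_def by (subst (1 2) integral_restrict_space) simp_all
qed

lemma L2_tendsto_subset:
  fixes f :: "nat \<Rightarrow> real ^ 'n \<Rightarrow> 'b::euclidean_space"
  assumes f: "L2_tendsto (lebesgue_on S) f g" and Q: "Q \<in> sets lebesgue" "Q \<subseteq> S" and S: "S \<in> sets lebesgue"
  shows "L2_tendsto (lebesgue_on Q) f g"
proof (rule L2_tendstoI)
  note f1 = L2_tendstoD[OF f]
  show "square_integrable (lebesgue_on Q) (f k)" "square_integrable (lebesgue_on Q) g" for k
    by (rule square_integrable_subset(1)[OF f1(1) Q S] square_integrable_subset(1)[OF f1(2) Q S])+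
  show "(\<lambda>k. sqnorm (lebesgue_on Q) (\<lambda>x. f k x - g x)) \<longlonglongrightarrow> 0"
    by (rule tendsto_sandwich[OF always_eventually always_eventually tendsto_const f1(3)])
      (intro allI sqnorm_nonneg square_integrable_subset(2)[OF square_integrable_diff[OF f1(1,2)] Q S])+
qed

context elliptic_ground_level
begin

text \<open>Testing the form with \<open>\<zeta> = \<eta>\<^sup>2 / (\<psi> + e)\<close> produces the term \<open>- \<langle>A H, H\<rangle>\<close>, where
\<open>H = \<eta> \<nabla> ln (\<psi> + e)\<close>, and a mixed term that Young's inequality absorbs. The bound on \<open>H\<close> depends on
\<open>e\<close> only through \<open>B \<psi> \<zeta>\<close>, which disappears for an element of the kernel. The crude bound on
\<open>B \<zeta> \<zeta>\<close> deteriorates with \<open>e\<close>, but is used for fixed \<open>e\<close> only.\<close>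

lemma log_gradient_estimate:
  assumes \<psi>: "\<psi> \<in> test_functions \<Omega>" and \<psi>0: "\<And>x. 0 \<le> \<psi> x"
    and \<eta>: "\<eta> \<in> test_functions \<Omega>" and \<eta>01: "\<And>x. 0 \<le> \<eta> x \<and> \<eta> x \<le> 1" and e: "0 < e"
  defines "\<zeta> \<equiv> (\<lambda>x. (\<eta> x * inverse (\<psi> x + e)) * \<eta> x)"
    and "H \<equiv> (\<lambda>x. (\<eta> x * inverse (\<psi> x + e)) *\<^sub>R grad \<psi> x)"
  shows "\<zeta> \<in> test_functions \<Omega>" and "square_integrable M H"
    and "\<mu> / 2 * sqnorm M H \<le> 2 * \<Lambda>\<^sup>2 / \<mu> * sqnorm M (grad \<eta>) + \<bar>\<kappa>\<bar> * sqnorm M \<eta> + \<bar>B \<psi> \<zeta>\<bar>"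
    and "B \<zeta> \<zeta> \<le> \<Lambda> * (8 * (inverse e)\<^sup>2 * sqnorm M (grad \<eta>) + 2 * (inverse e) ^ 4 * sqnorm M (grad \<psi>))
      + \<bar>\<kappa>\<bar> * ((inverse e)\<^sup>2 * sqnorm M \<eta>)"
proof -
  define q where "q x = inverse (\<psi> x + e)" for x
  have pos: "0 < \<psi> x + e" for x using \<psi>0[of x] e by linarith
  have q: "0 < q x" "q x \<le> inverse e" "\<psi> x * q x \<le> 1" for x
    using pos[of x] \<psi>0[of x] e by (auto simp: q_def field_simps)
  have Cq: "C_k k q" for k
    unfolding q_def[abs_def]
    by (rule C_k_inverse[OF C_k_add[OF test_function_C_k[OF \<psi>] C_k_const]]) (use pos in \<open>simp add: less_imp_neq[symmetric]\<close>)
  have C\<eta>q: "C_k k (\<lambda>x. \<eta> x * q x)" for k by (rule C_k_mult[OF test_function_C_k[OF \<eta>] Cq])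
  have \<zeta>_eq: "\<zeta> = (\<lambda>x. (\<eta> x * q x) * \<eta> x)" by (simp add: \<zeta>_def q_def)
  show \<zeta>: "\<zeta> \<in> test_functions \<Omega>" unfolding \<zeta>_eq by (rule test_function_mult[OF \<eta> C\<eta>q])
  have H_eq: "H = (\<lambda>x. (\<eta> x * q x) *\<^sub>R grad \<psi> x)" by (simp add: H_def q_def)
  have \<eta>q: "0 \<le> \<eta> x * q x" "\<eta> x * q x \<le> inverse e" for x
  proof -
    show "0 \<le> \<eta> x * q x" using \<eta>01[of x] q(1)[of x] by simp
    have "\<eta> x * q x \<le> 1 * q x" by (rule mult_right_mono) (use \<eta>01[of x] q(1)[of x] in auto)
    then show "\<eta> x * q x \<le> inverse e" using q(2)[of x] by simp
  qed
  have contH: "continuous_on UNIV H" unfolding H_eq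
    by (rule continuous_on_scaleR) (use C\<eta>q[of 0] test_function_grad_continuous[OF \<psi>] in auto)
  show sqH: "square_integrable M H"
  proof (rule square_integrable_bound[OF sq_test(2)[OF \<psi>] continuous_imp_borel_measurable_lebesgue_on[OF contH]])
    show "AE x in M. norm (H x) \<le> inverse e * norm (grad \<psi> x)"
      using \<eta>q by (intro AE_I2) (simp add: H_eq mult_right_mono)
  qed
  have gr: "grad \<zeta> x = (2 * (\<eta> x * q x)) *\<^sub>R grad \<eta> x - (\<eta> x * q x) *\<^sub>R H x" for x
  proof -
    have 1: "GDERIV q x :> - (q x)\<^sup>2 *\<^sub>R grad \<psi> x"
    proof -
      have "GDERIV (\<lambda>x. \<psi> x + e) x :> grad \<psi> x + 0"
        by (rule GDERIV_add[OF test_function_GDERIV[OF \<psi>] GDERIV_const])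
      then have "GDERIV (\<lambda>x. inverse (\<psi> x + e)) x :> - (inverse (\<psi> x + e))\<^sup>2 *\<^sub>R (grad \<psi> x + 0)"
        by (rule GDERIV_inverse) (use pos[of x] in simp)
      then show ?thesis by (simp add: q_def[abs_def])
    qed
    note 2 = GDERIV_mult[OF test_function_GDERIV[OF \<eta>] 1]
    note 3 = GDERIV_mult[OF 2 test_function_GDERIV[OF \<eta>]]
    have "grad \<zeta> x = (\<eta> x * q x) *\<^sub>R grad \<eta> x +
        \<eta> x *\<^sub>R (\<eta> x *\<^sub>R (- (q x)\<^sup>2 *\<^sub>R grad \<psi> x) + q x *\<^sub>R grad \<eta> x)"
      unfolding \<zeta>_eq by (rule GDERIV_imp_grad_eq[OF 3])
    also have "\<dots> = (2 * (\<eta> x * q x)) *\<^sub>R grad \<eta> x - (\<eta> x * q x) *\<^sub>R H x"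
      unfolding H_eq by (simp add: vec_eq_iff power2_eq_square algebra_simps)
    finally show ?thesis .
  qed
  have point: "(A x *v grad \<psi> x) \<bullet> grad \<zeta> x \<le>
      2 * \<Lambda>\<^sup>2 / \<mu> * (norm (grad \<eta> x))\<^sup>2 - \<mu> / 2 * (norm (H x))\<^sup>2" if x: "x \<in> \<Omega>" for x
  proof -
    have "(A x *v grad \<psi> x) \<bullet> grad \<zeta> x = 2 * ((A x *v H x) \<bullet> grad \<eta> x) - (A x *v H x) \<bullet> H x"
      by (simp add: gr H_eq matrix_vector_mult_scaleR inner_diff_right)
    also have "\<dots> \<le> 2 * (\<Lambda> * norm (H x) * norm (grad \<eta> x)) - \<mu> * (norm (H x))\<^sup>2"
    proof -
      have "(A x *v H x) \<bullet> grad \<eta> x \<le> norm (A x *v H x) * norm (grad \<eta> x)"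
        by (rule norm_cauchy_schwarz)
      also have "\<dots> \<le> \<Lambda> * norm (H x) * norm (grad \<eta> x)"
        by (rule mult_right_mono[OF bounded_A[OF x]]) simp
      finally show ?thesis using coercive_A[OF x, of "H x"] by linarith
    qed
    also have "\<dots> \<le> 2 * \<Lambda>\<^sup>2 / \<mu> * (norm (grad \<eta> x))\<^sup>2 - \<mu> / 2 * (norm (H x))\<^sup>2"
    proof -
      have "0 \<le> (\<mu> * norm (H x) - 2 * \<Lambda> * norm (grad \<eta> x))\<^sup>2 / (2 * \<mu>)" using \<mu>_pos by simp
      also have "\<dots> = \<mu> / 2 * (norm (H x))\<^sup>2 + 2 * \<Lambda>\<^sup>2 / \<mu> * (norm (grad \<eta> x))\<^sup>2
          - 2 * (\<Lambda> * norm (H x) * norm (grad \<eta> x))"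
        using \<mu>_pos by (simp add: power2_eq_square field_simps)
      finally show ?thesis by simp
    qed
    finally show ?thesis .
  qed
  have en: "energy (grad \<psi>) (grad \<zeta>) \<le> 2 * \<Lambda>\<^sup>2 / \<mu> * sqnorm M (grad \<eta>) - \<mu> / 2 * sqnorm M H"
  proof -
    have "energy (grad \<psi>) (grad \<zeta>) \<le>
        (LINT x|M. 2 * \<Lambda>\<^sup>2 / \<mu> * (norm (grad \<eta> x))\<^sup>2 - \<mu> / 2 * (norm (H x))\<^sup>2)"
      unfolding energy_def
      using point by (intro integral_mono energy_integrable sq_test \<psi> \<zeta> Bochner_Integration.integrable_diff
          integrable_mult_right square_integrable_sq sqH \<eta>) auto
    also have "\<dots> = 2 * \<Lambda>\<^sup>2 / \<mu> * sqnorm M (grad \<eta>) - \<mu> / 2 * sqnorm M H"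
      unfolding sqnorm_def
      using square_integrable_sq[OF sq_test(2)[OF \<eta>]] square_integrable_sq[OF sqH]
      by (subst Bochner_Integration.integral_diff) simp_all
    finally show ?thesis .
  qed
  have prod: "0 \<le> (LINT x|M. \<psi> x * \<zeta> x) \<and> (LINT x|M. \<psi> x * \<zeta> x) \<le> sqnorm M \<eta>"
  proof
    have eq: "\<psi> x * \<zeta> x = (\<psi> x * q x) * (\<eta> x)\<^sup>2" for x by (simp add: \<zeta>_eq power2_eq_square)
    show "0 \<le> (LINT x|M. \<psi> x * \<zeta> x)"
      unfolding eq using \<psi>0 q(1) by (intro Bochner_Integration.integral_nonneg mult_nonneg_nonneg) (auto intro: less_imp_le)
    show "(LINT x|M. \<psi> x * \<zeta> x) \<le> sqnorm M \<eta>"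
      unfolding sqnorm_def
    proof (intro integral_mono integrable_mult_L2 square_integrable_sq sq_test \<psi> \<zeta> \<eta>)
      show "\<psi> x * \<zeta> x \<le> (norm (\<eta> x))\<^sup>2" for x
        unfolding eq using mult_right_mono[OF q(3)[of x], of "(\<eta> x)\<^sup>2"] by simp
    qed
  qed
  have "\<bar>\<kappa> * (LINT x|M. \<psi> x * \<zeta> x)\<bar> \<le> \<bar>\<kappa>\<bar> * sqnorm M \<eta>"
    using prod by (simp add: abs_mult mult_left_mono)
  then show "\<mu> / 2 * sqnorm M H \<le> 2 * \<Lambda>\<^sup>2 / \<mu> * sqnorm M (grad \<eta>) + \<bar>\<kappa>\<bar> * sqnorm M \<eta> + \<bar>B \<psi> \<zeta>\<bar>"
    using en unfolding B_def by linarith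
  have "sqnorm M (grad \<zeta>) \<le> 8 * (inverse e)\<^sup>2 * sqnorm M (grad \<eta>) + 2 * (inverse e) ^ 4 * sqnorm M (grad \<psi>)"
  proof -
    define F1 where "F1 x = (2 * inverse e) *\<^sub>R grad \<eta> x" for x
    define F2 where "F2 x = (inverse e)\<^sup>2 *\<^sub>R grad \<psi> x" for x
    have s: "square_integrable M F1" "square_integrable M F2"
      unfolding F1_def F2_def by (intro square_integrable_scaleR sq_test \<eta> \<psi>)+
    have "sqnorm M (grad \<zeta>) \<le> (LINT x|M. 2 * (norm (F1 x))\<^sup>2 + 2 * (norm (F2 x))\<^sup>2)"
      unfolding sqnorm_def
    proof (intro integral_mono square_integrable_sq sq_test \<zeta> Bochner_Integration.integrable_add integrable_mult_right s)
      fix x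
      have "norm ((2 * (\<eta> x * q x)) *\<^sub>R grad \<eta> x) \<le> norm (F1 x)"
        unfolding F1_def norm_scaleR using \<eta>q[of x] e by (intro mult_right_mono) auto
      moreover have "norm (- ((\<eta> x * q x) *\<^sub>R H x)) \<le> norm (F2 x)"
      proof -
        have "\<bar>\<eta> x * q x\<bar> * \<bar>\<eta> x * q x\<bar> \<le> inverse e * inverse e"
          using \<eta>q[of x] e by (intro mult_mono) auto
        then have "\<bar>\<eta> x * q x\<bar> * \<bar>\<eta> x * q x\<bar> * norm (grad \<psi> x) \<le> inverse e * inverse e * norm (grad \<psi> x)"
          by (rule mult_right_mono) simp
        then show ?thesis
          by (simp only: F2_def H_eq norm_minus_cancel norm_scaleR power2_eq_square abs_mult mult.assoc)
            (use e in simp)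
      qed
      ultimately have "(norm ((2 * (\<eta> x * q x)) *\<^sub>R grad \<eta> x))\<^sup>2 \<le> (norm (F1 x))\<^sup>2"
          "(norm (- ((\<eta> x * q x) *\<^sub>R H x)))\<^sup>2 \<le> (norm (F2 x))\<^sup>2"
        by (auto intro!: power_mono simp del: norm_minus_cancel norm_scaleR)
      then show "(norm (grad \<zeta> x))\<^sup>2 \<le> 2 * (norm (F1 x))\<^sup>2 + 2 * (norm (F2 x))\<^sup>2"
        by (rule norm_add_sq_le_of_bounds[rotated]) (unfold gr, simp)
    qed
    also have "\<dots> = 2 * sqnorm M F1 + 2 * sqnorm M F2"
      using square_integrable_sq[OF s(1)] square_integrable_sq[OF s(2)] by (simp add: sqnorm_def)
    also have "\<dots> = 8 * (inverse e)\<^sup>2 * sqnorm M (grad \<eta>) + 2 * (inverse e) ^ 4 * sqnorm M (grad \<psi>)"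
      unfolding F1_def F2_def sqnorm_scaleR by (simp add: power_mult_distrib power2_eq_square power4_eq_xxxx)
    finally show ?thesis .
  qed
  then have "energy (grad \<zeta>) (grad \<zeta>) \<le> \<Lambda> * (8 * (inverse e)\<^sup>2 * sqnorm M (grad \<eta>) + 2 * (inverse e) ^ 4 * sqnorm M (grad \<psi>))"
    by (rule order_trans[OF energy_le[OF sq_test(2)[OF \<zeta>]] mult_left_mono]) (rule \<Lambda>_nonneg)
  moreover have "- \<kappa> * sqnorm M \<zeta> \<le> \<bar>\<kappa>\<bar> * ((inverse e)\<^sup>2 * sqnorm M \<eta>)"
  proof -
    have "sqnorm M \<zeta> \<le> sqnorm M (\<lambda>x. inverse e *\<^sub>R \<eta> x)"
    proof (rule sqnorm_mono[OF square_integrable_scaleR[OF sq_test(1)[OF \<eta>]] square_integrable_measurable[OF sq_test(1)[OF \<zeta>]]])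
      have "norm (\<zeta> x) \<le> norm (inverse e *\<^sub>R \<eta> x)" for x
      proof -
        have "\<bar>\<eta> x * q x\<bar> * \<bar>\<eta> x\<bar> \<le> \<bar>inverse e\<bar> * \<bar>\<eta> x\<bar>"
          using \<eta>q[of x] e by (intro mult_right_mono) auto
        then show ?thesis by (simp only: \<zeta>_eq real_norm_def real_scaleR_def abs_mult)
      qed
      then show "AE x in M. norm (\<zeta> x) \<le> norm (inverse e *\<^sub>R \<eta> x)" by simp
    qed
    then have 1: "sqnorm M \<zeta> \<le> (inverse e)\<^sup>2 * sqnorm M \<eta>" by (simp only: sqnorm_scaleR)
    have "- \<kappa> * sqnorm M \<zeta> \<le> \<bar>\<kappa>\<bar> * sqnorm M \<zeta>" by (rule mult_right_mono) (auto simp: sqnorm_nonneg)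
    also have "\<dots> \<le> \<bar>\<kappa>\<bar> * ((inverse e)\<^sup>2 * sqnorm M \<eta>)" by (rule mult_left_mono[OF 1]) simp
    finally show ?thesis .
  qed
  ultimately show "B \<zeta> \<zeta> \<le> \<Lambda> * (8 * (inverse e)\<^sup>2 * sqnorm M (grad \<eta>) + 2 * (inverse e) ^ 4 * sqnorm M (grad \<psi>))
      + \<bar>\<kappa>\<bar> * ((inverse e)\<^sup>2 * sqnorm M \<eta>)"
    by (simp add: B_diag)
qed

end

lemma AE_lebesgue_on_iff_negligible:
  assumes "S \<in> sets lebesgue"
  shows "(AE x in lebesgue_on S. P x) \<longleftrightarrow> negligible {x \<in> S. \<not> P x}"
proof -
  have "(AE x in lebesgue_on S. P x) \<longleftrightarrow> (AE x in lebesgue. x \<in> S \<longrightarrow> P x)"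
    using assms by (simp add: AE_restrict_space_iff)
  also have "\<dots> \<longleftrightarrow> negligible {x \<in> S. \<not> P x}"
  proof
    assume "AE x in lebesgue. x \<in> S \<longrightarrow> P x"
    then have "\<exists>N\<in>null_sets lebesgue. {x \<in> S. \<not> P x} \<subseteq> N"
      by (simp only: eventually_ae_filter space_completion space_lborel space_borel not_imp UNIV_I simp_thms)
    then show "negligible {x \<in> S. \<not> P x}"
      unfolding negligible_iff_null_sets[symmetric] by (rule bexE) (rule negligible_subset, simp add: negligible_iff_null_sets)
  next
    assume "negligible {x \<in> S. \<not> P x}"
    then have "AE x in lebesgue. x \<notin> {x \<in> S. \<not> P x}"
      by (intro AE_not_in) (simp add: negligible_iff_null_sets)
    then show "AE x in lebesgue. x \<in> S \<longrightarrow> P x" by (rule AE_mp) auto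
  qed
  finally show ?thesis .
qed

lemma open_locally_negligible_points:
  fixes S :: "'a::euclidean_space set"
  shows "open {p. \<exists>r>0. negligible (ball p r \<inter> S)}"
proof (rule openI)
  fix p assume "p \<in> {p. \<exists>r>0. negligible (ball p r \<inter> S)}"
  then obtain r where r: "0 < r" "negligible (ball p r \<inter> S)" by blast
  show "\<exists>e>0. ball p e \<subseteq> {p. \<exists>r>0. negligible (ball p r \<inter> S)}"
  proof (intro exI conjI subsetI CollectI)
    fix q assume q: "q \<in> ball p r"
    show "0 < r - dist p q" using q by simp
    have "ball q (r - dist p q) \<subseteq> ball p r"
    proof
      fix x assume "x \<in> ball q (r - dist p q)"
      then show "x \<in> ball p r" using dist_triangle[of p x q] by simp
    qed
    then show "negligible (ball q (r - dist p q) \<inter> S)"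
      by (intro negligible_subset[OF r(2)]) blast
  qed (rule r)
qed

context elliptic_ground_level
begin

lemma \<Omega>_lebesgue: "\<Omega> \<in> sets lebesgue"
  using open_\<Omega> by simp

lemma test_function_bounded_below_near:
  assumes "p \<in> \<Omega>"
  shows "\<exists>\<eta> r c. \<eta> \<in> test_functions \<Omega> \<and> (\<forall>x. 0 \<le> \<eta> x \<and> \<eta> x \<le> 1) \<and> 0 < r \<and> 0 < c \<and>
    ball p r \<subseteq> \<Omega> \<and> (\<forall>x\<in>ball p r. c \<le> \<eta> x)"
proof -
  obtain a b where ab: "cbox a b \<subseteq> \<Omega>" "p \<in> box a b" "\<forall>i\<in>Basis. a \<bullet> i < b \<bullet> i"
    by (rule open_contains_cbox[OF open_\<Omega> assms])
  define \<eta> where "\<eta> = box_bump 1 a b"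
  have \<eta>: "\<eta> \<in> test_functions \<Omega>" unfolding \<eta>_def by (rule test_function_box_bump[OF _ ab(1)]) simp
  have pos: "0 < \<eta> p" unfolding \<eta>_def by (rule box_bump_pos[OF _ ab(2)]) simp
  have "isCont \<eta> p" using test_function_continuous[OF \<eta>] by (simp add: continuous_on_eq_continuous_at)
  then obtain r where r: "0 < r" "\<And>x. dist x p < r \<Longrightarrow> dist (\<eta> x) (\<eta> p) < \<eta> p / 2"
    unfolding continuous_at_eps_delta using half_gt_zero[OF pos] by blast
  have low: "\<eta> p / 2 \<le> \<eta> x" if "x \<in> ball p r" for x
  proof -
    have "\<bar>\<eta> x - \<eta> p\<bar> < \<eta> p / 2"
      using r(2)[of x] that by (simp add: dist_commute[of p] dist_real_def)
    then show ?thesis unfolding abs_diff_less_iff by linarith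
  qed
  have "x \<in> \<Omega>" if "x \<in> ball p r" for x
  proof (rule ccontr)
    assume "x \<notin> \<Omega>"
    then have "x \<notin> box a b" using ab(1) box_subset_cbox by blast
    then have "\<eta> x = 0" unfolding \<eta>_def by (rule box_bump_eq_0[rotated]) simp
    then show False using low[OF that] pos by simp
  qed
  then show ?thesis
    using \<eta> r(1) pos low box_bump_bounds[of 1 a b]
    by (intro exI[of _ \<eta>] exI[of _ r] exI[of _ "\<eta> p / 2"]) (auto simp: \<eta>_def)
qed

text \<open>The logarithmic gradient estimate for nonnegative approximations, combined with the Poincare
inequality on the ball. The error term \<open>B \<psi> \<zeta>\<close> of that estimate tends to zero by the
Cauchy-Schwarz inequality for \<open>B\<close>, because \<open>B \<psi> \<psi>\<close> tends to zero along the approximations while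
\<open>B \<zeta> \<zeta>\<close> stays bounded. It is essential
that \<open>K\<close> does not depend on \<open>e\<close>.\<close>

lemma null_limit_log_oscillation:
  assumes w: "null_limit w" and w0: "\<And>x. 0 \<le> w x"
    and \<eta>: "\<eta> \<in> test_functions \<Omega>" "\<And>x. 0 \<le> \<eta> x \<and> \<eta> x \<le> 1"
    and r: "0 < r" "ball p r \<subseteq> \<Omega>" and c: "0 < c" "\<And>x. x \<in> ball p r \<Longrightarrow> c \<le> \<eta> x"
  shows "\<exists>K. \<forall>e>0. \<exists>a. square_integrable (lebesgue_on (ball p r)) (\<lambda>x. ln (1 + w x / e) - a) \<and>
    sqnorm (lebesgue_on (ball p r)) (\<lambda>x. ln (1 + w x / e) - a) \<le> K"
proof -
  let ?Q = "ball p r"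
  let ?N = "lebesgue_on ?Q"
  have Ql: "?Q \<in> sets lebesgue" "?Q \<in> sets borel" "bounded ?Q" by simp_all
  interpret N: finite_measure ?N by (rule finite_measure_lebesgue_on_bounded) simp_all
  obtain \<psi> where \<psi>: "\<And>k. \<psi> k \<in> test_functions \<Omega>" "\<And>k x. 0 \<le> \<psi> k x"
      "L2_tendsto M \<psi> (\<lambda>x. \<bar>w x\<bar>)" "(\<lambda>k. B (\<psi> k) (\<psi> k)) \<longlonglongrightarrow> 0"
    using null_limit_abs_approx[OF w] by blast
  have L: "L2_tendsto M \<psi> w" using \<psi>(3) w0 by simp
  define C0 where "C0 = 2 * \<Lambda>\<^sup>2 / \<mu> * sqnorm M (grad \<eta>) + \<bar>\<kappa>\<bar> * sqnorm M \<eta>"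
  define K1 where "K1 = 2 ^ CARD('n) * (2 * r)\<^sup>2 * ((inverse c)\<^sup>2 * (2 / \<mu>))"
  have K1: "0 \<le> K1" using \<mu>_pos by (simp add: K1_def)
  have "\<exists>a. square_integrable ?N (\<lambda>x. ln (1 + w x / e) - a) \<and>
    sqnorm ?N (\<lambda>x. ln (1 + w x / e) - a) \<le> K1 * C0" if e: "0 < e" for e
  proof -
    define z where "z k x = (\<eta> x * inverse (\<psi> k x + e)) * \<eta> x" for k x
    define H where "H k x = (\<eta> x * inverse (\<psi> k x + e)) *\<^sub>R grad (\<psi> k) x" for k x
    note est = log_gradient_estimate[OF \<psi>(1,2) \<eta> e, folded z_def H_def]
    define g where "g k x = ln (1 + \<psi> k x / e)" for k x
    define G where "G k x = inverse (\<psi> k x + e) *\<^sub>R grad (\<psi> k) x" for k x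
    have pos: "0 < \<psi> k x + e" "0 < 1 + \<psi> k x / e" for k x
      using \<psi>(2)[of k x] e by (auto intro: add_nonneg_pos add_pos_nonneg)
    have gG: "GDERIV (g k) x :> G k x" for k x
    proof -
      have "((\<lambda>t. ln (1 + t / e)) has_real_derivative inverse (\<psi> k x + e)) (at (\<psi> k x))"
        using pos[of k x] e by (auto intro!: derivative_eq_intros simp: field_simps)
      from GDERIV_DERIV_compose[OF test_function_GDERIV[OF \<psi>(1)] this]
      show ?thesis by (simp add: g_def[abs_def] G_def)
    qed
    have contG: "continuous_on UNIV (G k)" for k
      unfolding G_def[abs_def] using pos(1)[of k]
      by (intro continuous_on_scaleR continuous_on_inverse continuous_on_add continuous_on_const
          test_function_continuous[OF \<psi>(1)] test_function_grad_continuous[OF \<psi>(1)])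
        (auto simp: less_imp_neq[symmetric])
    have contg: "continuous_on UNIV (g k)" for k
      using gG by (auto simp: continuous_on_eq_continuous_at gderiv_def intro: has_derivative_continuous)
    have sqg: "square_integrable ?N (g k)" "square_integrable ?N (G k)" for k
      by (rule continuous_square_integrable_on_bounded[OF _ Ql(2,3)], rule contg contG)+
    have Gle: "sqnorm ?N (G k) \<le> (inverse c)\<^sup>2 * sqnorm M (H k)" for k
    proof -
      have sH: "square_integrable ?N (H k)" "sqnorm ?N (H k) \<le> sqnorm M (H k)"
        by (rule square_integrable_subset[OF est(2) Ql(1) r(2) \<Omega>_lebesgue])+
      have "sqnorm ?N (G k) \<le> sqnorm ?N (\<lambda>x. inverse c *\<^sub>R H k x)"
      proof (rule sqnorm_mono[OF square_integrable_scaleR[OF sH(1)] square_integrable_measurable[OF sqg(2)]], rule AE_I2)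
        fix x assume "x \<in> space ?N"
        then have "1 \<le> inverse c * \<eta> x" using c(2)[of x] c(1) by (simp add: field_simps)
        then have "1 * norm (G k x) \<le> (inverse c * \<eta> x) * norm (G k x)" by (rule mult_right_mono) simp
        moreover have "H k x = \<eta> x *\<^sub>R G k x" by (simp add: H_def G_def)
        ultimately show "norm (G k x) \<le> norm (inverse c *\<^sub>R H k x)"
          using c(1) \<eta>(2)[of x] by (simp add: mult.assoc)
      qed
      also have "\<dots> = (inverse c)\<^sup>2 * sqnorm ?N (H k)" by (rule sqnorm_scaleR)
      also have "\<dots> \<le> (inverse c)\<^sup>2 * sqnorm M (H k)" by (rule mult_left_mono[OF sH(2)]) simp
      finally show ?thesis .
    qed
    define a where "a k = (LINT x|?N. g k x) / measure lebesgue ?Q" for k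
    have osc: "sqnorm ?N (\<lambda>x. g k x - a k) \<le> K1 * (C0 + \<bar>B (\<psi> k) (z k)\<bar>)" for k
    proof -
      have "sqnorm ?N (\<lambda>x. g k x - a k) \<le> 2 ^ CARD('n) * (2 * r)\<^sup>2 * sqnorm ?N (G k)"
        unfolding a_def
      proof (rule poincare_convex[OF gG contG Ql(2,3) convex_ball])
        fix x y assume "x \<in> ?Q" "y \<in> ?Q"
        then show "norm (x - y) \<le> 2 * r"
          using dist_triangle[of x y p] by (simp add: dist_norm norm_minus_commute)
      qed
      also have "\<dots> \<le> 2 ^ CARD('n) * (2 * r)\<^sup>2 * ((inverse c)\<^sup>2 * (2 / \<mu> * (C0 + \<bar>B (\<psi> k) (z k)\<bar>)))"
      proof (rule mult_left_mono[OF order_trans[OF Gle mult_left_mono]])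
        have "\<mu> / 2 * sqnorm M (H k) \<le> C0 + \<bar>B (\<psi> k) (z k)\<bar>" using est(3)[of k] by (simp add: C0_def)
        then show "sqnorm M (H k) \<le> 2 / \<mu> * (C0 + \<bar>B (\<psi> k) (z k)\<bar>)"
          using \<mu>_pos by (simp add: field_simps)
      qed simp_all
      finally show ?thesis by (simp only: K1_def mult.assoc)
    qed
    have B0: "(\<lambda>k. \<bar>B (\<psi> k) (z k)\<bar>) \<longlonglongrightarrow> 0"
    proof -
      have "(\<lambda>k. inverse \<mu> * (B (\<psi> k) (\<psi> k) + \<kappa> * sqnorm M (\<psi> k))) \<longlonglongrightarrow> inverse \<mu> * (0 + \<kappa> * sqnorm M w)"
        by (intro tendsto_intros \<psi>(4) L2_tendsto_sqnorm[OF L])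
      then have "Bseq (\<lambda>k. inverse \<mu> * (B (\<psi> k) (\<psi> k) + \<kappa> * sqnorm M (\<psi> k)))"
        by (intro convergent_imp_Bseq convergentI)
      then obtain R where R: "\<And>k. norm (inverse \<mu> * (B (\<psi> k) (\<psi> k) + \<kappa> * sqnorm M (\<psi> k))) \<le> R"
        by (auto simp: Bseq_def)
      have gradb: "sqnorm M (grad (\<psi> k)) \<le> R" for k
      proof -
        have "\<mu> * sqnorm M (grad (\<psi> k)) \<le> B (\<psi> k) (\<psi> k) + \<kappa> * sqnorm M (\<psi> k)"
          using energy_ge[OF sq_test(2)[OF \<psi>(1)[of k]]] by (simp add: B_diag)
        then have "sqnorm M (grad (\<psi> k)) \<le> inverse \<mu> * (B (\<psi> k) (\<psi> k) + \<kappa> * sqnorm M (\<psi> k))"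
          using \<mu>_pos by (simp add: field_simps)
        then show ?thesis using R[of k] by simp
      qed
      define D where "D = \<Lambda> * (8 * (inverse e)\<^sup>2 * sqnorm M (grad \<eta>) + 2 * (inverse e) ^ 4 * R)
        + \<bar>\<kappa>\<bar> * ((inverse e)\<^sup>2 * sqnorm M \<eta>)"
      have BD: "B (z k) (z k) \<le> D" for k
      proof (rule order_trans[OF est(4)])
        show "\<Lambda> * (8 * (inverse e)\<^sup>2 * sqnorm M (grad \<eta>) + 2 * (inverse e) ^ 4 * sqnorm M (grad (\<psi> k)))
            + \<bar>\<kappa>\<bar> * ((inverse e)\<^sup>2 * sqnorm M \<eta>) \<le> D"
          unfolding D_def using gradb[of k]
          by (intro add_mono mult_left_mono \<Lambda>_nonneg order_refl) simp_all
      qed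
      have lim: "(\<lambda>k. sqrt (B (\<psi> k) (\<psi> k)) * sqrt D) \<longlonglongrightarrow> 0"
        using tendsto_mult_left_zero[OF tendsto_real_sqrt[OF \<psi>(4), simplified], of "sqrt D"] .
      show ?thesis
      proof (rule tendsto_sandwich[OF always_eventually always_eventually tendsto_const lim]; rule allI)
        show "\<bar>B (\<psi> k) (z k)\<bar> \<le> sqrt (B (\<psi> k) (\<psi> k)) * sqrt D" for k
          using B_Cauchy_Schwarz[OF \<psi>(1) est(1), of k k]
            mult_left_mono[OF real_sqrt_le_mono[OF BD[of k]], of "sqrt (B (\<psi> k) (\<psi> k))"]
            B_nonneg[OF \<psi>(1)[of k]] by simp
      qed simp
    qed
    define g' where "g' x = ln (1 + w x / e)" for x
    have LQ: "L2_tendsto ?N \<psi> w" by (rule L2_tendsto_subset[OF L Ql(1) r(2) \<Omega>_lebesgue])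
    have lip: "norm (ln (1 + s / e) - ln (1 + t / e)) \<le> inverse e * norm (s - t)" if "0 \<le> s" "0 \<le> t" for s t
      using ln_one_plus_lipschitz[OF that e] by simp
    have sqg': "square_integrable ?N g'"
    proof (rule square_integrable_bound[OF L2_tendstoD(2)[OF LQ]])
      have [measurable]: "w \<in> borel_measurable ?N" using L2_tendstoD(2)[OF LQ] by (rule square_integrable_measurable)
      show "g' \<in> borel_measurable ?N" unfolding g'_def by measurable
      show "AE x in ?N. norm (g' x) \<le> inverse e * norm (w x)"
        using lip[OF w0 order_refl] by (simp add: g'_def)
    qed
    have Lg: "L2_tendsto ?N g g'"
      by (rule L2_tendsto_bound[OF LQ sqg(1) sqg', where C="inverse e"]) (use lip[OF \<psi>(2) w0] in \<open>simp add: g_def g'_def\<close>)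
    define a' where "a' = (LINT x|?N. g' x) / measure lebesgue ?Q"
    have Lc: "L2_tendsto ?N (\<lambda>k x. 1 :: real) (\<lambda>x. 1)"
      by (rule L2_tendstoI) (simp_all add: N.square_integrable_const sqnorm_def)
    have "(\<lambda>k. LINT x|?N. g k x \<bullet> 1) \<longlonglongrightarrow> (LINT x|?N. g' x \<bullet> 1)" by (rule L2_tendsto_inner[OF Lg Lc])
    then have a: "a \<longlonglongrightarrow> a'" unfolding a_def a'_def divide_inverse by (simp add: tendsto_mult_right)
    have La: "L2_tendsto ?N (\<lambda>k x. - a k) (\<lambda>x. - a')"
    proof (rule L2_tendstoI)
      have "(\<lambda>k. measure ?N (space ?N) * (a' - a k)\<^sup>2) \<longlonglongrightarrow> measure ?N (space ?N) * (a' - a')\<^sup>2"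
        by (intro tendsto_intros a)
      then show "(\<lambda>k. sqnorm ?N (\<lambda>x. - a k - - a')) \<longlonglongrightarrow> 0" by (simp add: sqnorm_def)
    qed (rule N.square_integrable_const)+
    have Lga: "L2_tendsto ?N (\<lambda>k x. g k x - a k) (\<lambda>x. g' x - a')"
      using L2_tendsto_add[OF Lg La] by simp
    have "sqnorm ?N (\<lambda>x. g' x - a') \<le> K1 * (C0 + 0)"
      by (rule LIMSEQ_le[OF L2_tendsto_sqnorm[OF Lga] tendsto_mult[OF tendsto_const tendsto_add[OF tendsto_const B0]]])
        (use osc in blast)
    then show ?thesis
      using L2_tendstoD(2)[OF Lga] by (intro exI[of _ a']) (simp add: g'_def)
  qed
  then show ?thesis by blast
qed

lemma null_limit_local_dichotomy:
  assumes w: "null_limit w" and w0: "\<And>x. 0 \<le> w x" and p: "p \<in> \<Omega>"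
  shows "\<exists>r>0. negligible (ball p r \<inter> {x. w x \<noteq> 0}) \<or> negligible (ball p r \<inter> {x. w x = 0})"
proof -
  obtain \<eta> r c where \<eta>: "\<eta> \<in> test_functions \<Omega>" "\<And>x. 0 \<le> \<eta> x \<and> \<eta> x \<le> 1"
    and r: "0 < r" "ball p r \<subseteq> \<Omega>" and c: "0 < c" "\<And>x. x \<in> ball p r \<Longrightarrow> c \<le> \<eta> x"
    using test_function_bounded_below_near[OF p] by blast
  obtain K where K: "\<And>e. 0 < e \<Longrightarrow> \<exists>a. square_integrable (lebesgue_on (ball p r)) (\<lambda>x. ln (1 + w x / e) - a) \<and>
      sqnorm (lebesgue_on (ball p r)) (\<lambda>x. ln (1 + w x / e) - a) \<le> K"
    using null_limit_log_oscillation[OF w w0 \<eta> r c] by blast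
  have "w \<in> borel_measurable (lebesgue_on (ball p r))"
    using square_integrable_subset(1)[OF square_integrable_null_limit[OF w] _ r(2) \<Omega>_lebesgue]
    by (simp add: square_integrable_measurable)
  then have "(AE x in lebesgue_on (ball p r). w x = 0) \<or> (AE x in lebesgue_on (ball p r). 0 < w x)"
    by (intro log_oscillation_dichotomy[OF finite_measure_lebesgue_on_bounded _ w0 K]) simp_all
  then have "negligible {x \<in> ball p r. \<not> w x = 0} \<or> negligible {x \<in> ball p r. \<not> 0 < w x}"
    by (simp only: AE_lebesgue_on_iff_negligible[OF fmeasurableD[OF lmeasurable_ball]])
  then have "negligible (ball p r \<inter> {x. w x \<noteq> 0}) \<or> negligible (ball p r \<inter> {x. w x = 0})"
  proof
    assume "negligible {x \<in> ball p r. \<not> w x = 0}"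
    then have "negligible (ball p r \<inter> {x. w x \<noteq> 0})" by (rule negligible_subset) blast
    then show ?thesis ..
  next
    assume "negligible {x \<in> ball p r. \<not> 0 < w x}"
    then have "negligible (ball p r \<inter> {x. w x = 0})"
    proof (rule negligible_subset)
      show "ball p r \<inter> {x. w x = 0} \<subseteq> {x \<in> ball p r. \<not> 0 < w x}" by force
    qed
    then show ?thesis by (rule disjI2)
  qed
  with r(1) have "0 < r \<and> (negligible (ball p r \<inter> {x. w x \<noteq> 0}) \<or> negligible (ball p r \<inter> {x. w x = 0}))"
    by (rule conjI)
  then show ?thesis by (rule exI)
qed

lemma negligible_of_locally_negligible:
  assumes "\<And>p. p \<in> \<Omega> \<Longrightarrow> \<exists>r>0. negligible (ball p r \<inter> S)"
  shows "negligible (\<Omega> \<inter> S)"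
proof (rule locally_negligible_alt[THEN iffD2], rule ballI)
  fix x assume x: "x \<in> \<Omega> \<inter> S"
  obtain r where r: "0 < r" "negligible (ball x r \<inter> S)" using assms x by blast
  have "openin (top_of_set (\<Omega> \<inter> S)) (\<Omega> \<inter> S \<inter> ball x r)" by (rule openin_open_Int) simp
  moreover have "negligible (\<Omega> \<inter> S \<inter> ball x r)" by (rule negligible_subset[OF r(2)]) blast
  ultimately show "\<exists>U. openin (top_of_set (\<Omega> \<inter> S)) U \<and> x \<in> U \<and> negligible U"
    using x r(1) by (intro exI[of _ "\<Omega> \<inter> S \<inter> ball x r"]) simp
qed

text \<open>Every point has a neighbourhood in which \<open>w\<close> vanishes almost everywhere or is positive almost
everywhere. The two kinds of points form disjoint open sets, and one of them is empty by
connectedness.\<close>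

theorem strong_maximum_principle:
  assumes "connected \<Omega>" and w: "null_limit w" and w0: "\<And>x. 0 \<le> w x"
  shows "(AE x in M. w x = 0) \<or> (AE x in M. 0 < w x)"
proof -
  define near_zero where "near_zero p \<longleftrightarrow> (\<exists>r>0. negligible (ball p r \<inter> {x. w x \<noteq> 0}))" for p
  define near_pos where "near_pos p \<longleftrightarrow> (\<exists>r>0. negligible (ball p r \<inter> {x. w x = 0}))" for p
  have dich: "near_zero p \<or> near_pos p" if p: "p \<in> \<Omega>" for p
  proof -
    obtain r where "0 < r" "negligible (ball p r \<inter> {x. w x \<noteq> 0}) \<or> negligible (ball p r \<inter> {x. w x = 0})"
      using null_limit_local_dichotomy[OF w w0 p] by (elim exE conjE)
    then show ?thesis unfolding near_zero_def near_pos_def by (elim disjE) (intro disjI1 exI conjI, assumption+, intro disjI2 exI conjI)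
  qed
  have "{p. near_zero p} \<inter> \<Omega> = {} \<or> {p. near_pos p} \<inter> \<Omega> = {}"
  proof (rule connectedD[OF assms(1)])
    show "open {p. near_zero p}" "open {p. near_pos p}"
      unfolding near_zero_def near_pos_def by (rule open_locally_negligible_points)+
    show "\<Omega> \<subseteq> {p. near_zero p} \<union> {p. near_pos p}"
      using dich by blast
    have "\<not> (near_zero p \<and> near_pos p)" for p
    proof
      assume p: "near_zero p \<and> near_pos p"
      obtain r where r: "0 < r" "negligible (ball p r \<inter> {x. w x \<noteq> 0})"
        using p[THEN conjunct1] unfolding near_zero_def by (elim exE conjE)
      obtain s where s: "0 < s" "negligible (ball p s \<inter> {x. w x = 0})"
        using p[THEN conjunct2] unfolding near_pos_def by (elim exE conjE)
      have "negligible (ball p (min r s))"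
        by (rule negligible_subset[OF negligible_Un[OF r(2) s(2)]]) auto
      moreover have "\<not> negligible (ball p (min r s))"
        using r(1) s(1) by (intro open_not_negligible) auto
      ultimately show False by contradiction
    qed
    then show "{p. near_zero p} \<inter> {p. near_pos p} \<inter> \<Omega> = {}" by blast
  qed
  then consider "\<And>p. p \<in> \<Omega> \<Longrightarrow> near_pos p" | "\<And>p. p \<in> \<Omega> \<Longrightarrow> near_zero p"
    using dich by blast
  then show ?thesis
  proof cases
    case 1
    have "negligible (\<Omega> \<inter> {x. w x = 0})"
      by (rule negligible_of_locally_negligible) (rule 1[unfolded near_pos_def])
    then have "negligible {x \<in> \<Omega>. \<not> 0 < w x}"
      by (rule negligible_subset) (use w0 in \<open>auto simp: less_le\<close>)
    then show ?thesis by (simp only: AE_lebesgue_on_iff_negligible[OF \<Omega>_lebesgue] simp_thms)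
  next
    case 2
    have "negligible (\<Omega> \<inter> {x. w x \<noteq> 0})"
      by (rule negligible_of_locally_negligible) (rule 2[unfolded near_zero_def])
    then have "negligible {x \<in> \<Omega>. \<not> w x = 0}"
      by (rule negligible_subset) auto
    then show ?thesis by (simp only: AE_lebesgue_on_iff_negligible[OF \<Omega>_lebesgue] simp_thms)
  qed
qed

end

section \<open>Simplicity of the ground state and stability of minimizing sequences\<close>

context elliptic_ground_level
begin

lemma not_AE_False:
  assumes "\<Omega> \<noteq> {}" shows "\<not> (AE x in M. False)"
  using open_not_negligible[OF open_\<Omega> assms] by (simp add: AE_lebesgue_on_iff_negligible[OF \<Omega>_lebesgue])

text \<open>Twice the positive part of \<open>u - c y\<close>, written as \<open>\<bar>v\<bar> + v\<close>, belongs to the kernel as well, so it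
vanishes or is positive.\<close>

lemma null_limit_comparison:
  assumes "connected \<Omega>" "null_limit u" "null_limit y"
  shows "(AE x in M. u x \<le> c * y x) \<or> (AE x in M. c * y x < u x)"
proof -
  have v: "null_limit (\<lambda>x. u x + (- c) * y x)" by (rule null_limit_combination[OF assms(2,3)])
  have "null_limit (\<lambda>x. \<bar>u x + (- c) * y x\<bar> + 1 * (u x + (- c) * y x))"
    by (rule null_limit_combination[OF null_limit_abs[OF v] v])
  then have "(AE x in M. \<bar>u x + (- c) * y x\<bar> + 1 * (u x + (- c) * y x) = 0) \<or>
      (AE x in M. 0 < \<bar>u x + (- c) * y x\<bar> + 1 * (u x + (- c) * y x))"
    by (rule strong_maximum_principle[OF assms(1)]) simp
  then show ?thesis
  proof
    assume "AE x in M. \<bar>u x + (- c) * y x\<bar> + 1 * (u x + (- c) * y x) = 0"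
    then have "AE x in M. u x \<le> c * y x" by eventually_elim simp
    then show ?thesis by (rule disjI1)
  next
    assume "AE x in M. 0 < \<bar>u x + (- c) * y x\<bar> + 1 * (u x + (- c) * y x)"
    then have "AE x in M. c * y x < u x" by eventually_elim simp
    then show ?thesis by (rule disjI2)
  qed
qed

text \<open>The constant is the infimum of all \<open>c\<close> with \<open>u \<le> c y\<close>. Below it the alternative \<open>u > c y\<close> holds,
and positivity of \<open>y\<close> makes the infimum finite.\<close>

theorem null_limit_unique:
  assumes conn: "connected \<Omega>" and ne: "\<Omega> \<noteq> {}" and u: "null_limit u" and y: "null_limit y"
    and ypos: "AE x in M. 0 < y x"
  shows "\<exists>c. AE x in M. u x = c * y x"
proof -
  define S where "S = {c. AE x in M. u x \<le> c * y x}"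
  have up: "d \<in> S" if "c \<in> S" "c \<le> d" for c d
  proof -
    have "AE x in M. u x \<le> c * y x" using that(1) by (simp add: S_def)
    with ypos have "AE x in M. u x \<le> d * y x"
    proof eventually_elim
      case (elim x)
      then show ?case using mult_right_mono[OF that(2), of "y x"] by linarith
    qed
    then show ?thesis by (simp add: S_def)
  qed
  have notS: "AE x in M. c * y x < u x" if "c \<notin> S" for c
    using null_limit_comparison[OF conn u y, of c] that by (simp add: S_def)
  have "\<exists>n. real n \<in> S"
  proof (rule ccontr)
    assume "\<not> (\<exists>n. real n \<in> S)"
    then have "AE x in M. \<forall>n. real n * y x < u x"
      by (subst AE_all_countable) (simp add: notS)
    with ypos have "AE x in M. False"
    proof eventually_elim
      case (elim x)
      obtain n where "u x / y x < real n" using reals_Archimedean2 by blast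
      then show ?case using elim(1) elim(2)[rule_format, of n] by (simp add: field_simps)
    qed
    then show False using not_AE_False[OF ne] by simp
  qed
  then have Sne: "S \<noteq> {}" by blast
  have "\<exists>n. - real n \<notin> S"
  proof (rule ccontr)
    assume "\<not> (\<exists>n. - real n \<notin> S)"
    then have "AE x in M. \<forall>n. u x \<le> - real n * y x"
      by (subst AE_all_countable) (simp add: S_def)
    with ypos have "AE x in M. False"
    proof eventually_elim
      case (elim x)
      obtain n where "- u x / y x < real n" using reals_Archimedean2 by blast
      then show ?case using elim(1) elim(2)[rule_format, of n] by (simp add: field_simps)
    qed
    then show False using not_AE_False[OF ne] by simp
  qed
  then obtain n where n: "- real n \<notin> S" by blast
  have bdd: "bdd_below S"
  proof (rule bdd_belowI[of _ "- real n"])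
    fix d assume "d \<in> S"
    then show "- real n \<le> d" using up[of d "- real n"] n by linarith
  qed
  define c where "c = Inf S"
  have "c + inverse (real (Suc m)) \<in> S" for m
  proof -
    have "Inf S < c + inverse (real (Suc m))" by (simp add: c_def del: of_nat_Suc)
    then obtain d where "d \<in> S" "d < c + inverse (real (Suc m))"
      unfolding cInf_less_iff[OF Sne bdd] by (elim bexE)
    then show ?thesis by (rule up[OF _ less_imp_le])
  qed
  then have 1: "AE x in M. \<forall>m. u x \<le> (c + inverse (real (Suc m))) * y x"
    by (subst AE_all_countable) (simp add: S_def del: of_nat_Suc)
  have "c - inverse (real (Suc m)) \<notin> S" for m
  proof
    assume "c - inverse (real (Suc m)) \<in> S"
    then have "c \<le> c - inverse (real (Suc m))" unfolding c_def by (rule cInf_lower[OF _ bdd])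
    then show False by (simp del: of_nat_Suc)
  qed
  then have 2: "AE x in M. \<forall>m. (c - inverse (real (Suc m))) * y x < u x"
    by (subst AE_all_countable) (simp add: notS del: of_nat_Suc)
  from 1 2 have "AE x in M. u x = c * y x"
  proof eventually_elim
    case (elim x)
    have l1: "(\<lambda>m. (c + inverse (real (Suc m))) * y x) \<longlonglongrightarrow> (c + 0) * y x"
      by (intro tendsto_intros LIMSEQ_inverse_real_of_nat)
    have l2: "(\<lambda>m. (c - inverse (real (Suc m))) * y x) \<longlonglongrightarrow> (c - 0) * y x"
      by (intro tendsto_intros LIMSEQ_inverse_real_of_nat)
    have "u x \<le> (c + 0) * y x"
      by (rule LIMSEQ_le_const[OF l1]) (use elim(1) in blast)
    moreover have "(c - 0) * y x \<le> u x"
      by (rule LIMSEQ_le_const2[OF l2]) (use elim(2) in \<open>blast intro: less_imp_le\<close>)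
    ultimately show ?case by simp
  qed
  then show ?thesis by blast
qed

lemma L2_limit_AE_unique:
  assumes "L2_tendsto M f g" "square_integrable M h" "AE x in M. g x = h x"
  shows "L2_tendsto M f h"
proof (rule L2_tendstoI)
  note f = L2_tendstoD[OF assms(1)]
  show "square_integrable M (f k)" for k by (rule f(1))
  show "square_integrable M h" by (rule assms(2))
  have "sqnorm M (\<lambda>x. f k x - h x) = sqnorm M (\<lambda>x. f k x - g x)" for k
    unfolding sqnorm_def
  proof (rule integral_cong_AE)
    have "(\<lambda>x. f k x - h x) \<in> borel_measurable M" "(\<lambda>x. f k x - g x) \<in> borel_measurable M"
      using square_integrable_diff[OF f(1) assms(2)] square_integrable_diff[OF f(1,2)]
      by (auto intro: square_integrable_measurable)
    then show "(\<lambda>x. (norm (f k x - h x))\<^sup>2) \<in> borel_measurable M" "(\<lambda>x. (norm (f k x - g x))\<^sup>2) \<in> borel_measurable M"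
      by measurable
    show "AE x in M. (norm (f k x - h x))\<^sup>2 = (norm (f k x - g x))\<^sup>2"
      using assms(3) by eventually_elim simp
  qed
  then show "(\<lambda>k. sqnorm M (\<lambda>x. f k x - h x)) \<longlonglongrightarrow> 0" using f(3) by simp
qed

text \<open>A subsequence converges in \<open>L\<^sup>2\<close> by Rellich compactness, and its limit is a multiple \<open>c y\<close> since it
lies in the kernel. For the differences between \<open>\<phi>\<close> and \<open>c \<psi>\<close> both the form and the norm tend to
zero, and by coercivity so do the gradients. Passing through differences of test functions avoids
any statement about the gradient of the \<open>L\<^sup>2\<close> limit itself.\<close>

theorem minimizing_sequence_gradient_converges:
  assumes conn: "connected \<Omega>" and ne: "\<Omega> \<noteq> {}"
    and \<psi>: "\<And>k. \<psi> k \<in> test_functions \<Omega>" "L2_tendsto M \<psi> y" "L2_tendsto M (\<lambda>k. grad (\<psi> k)) Y"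
    and y: "sqnorm M y = 1" "energy Y Y = \<kappa>" "AE x in M. 0 < y x"
    and \<phi>: "\<And>k. \<phi> k \<in> test_functions \<Omega>" "\<And>k. sqnorm M (\<phi> k) = 1" "(\<lambda>k. B (\<phi> k) (\<phi> k)) \<longlonglongrightarrow> 0"
  shows "\<exists>r c. strict_mono r \<and> c\<^sup>2 = 1 \<and> L2_tendsto M (\<lambda>k. grad (\<phi> (r k))) (\<lambda>x. c *\<^sub>R Y x)"
proof -
  have "Bseq (\<lambda>k. B (\<phi> k) (\<phi> k))" using \<phi>(3) by (intro convergent_imp_Bseq convergentI)
  then obtain R where R: "\<And>k. norm (B (\<phi> k) (\<phi> k)) \<le> R" by (auto simp: Bseq_def)
  have gradb: "sqnorm M (grad (\<phi> k)) \<le> (R + \<kappa>) / \<mu>" for k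
  proof -
    have "\<mu> * sqnorm M (grad (\<phi> k)) \<le> B (\<phi> k) (\<phi> k) + \<kappa>"
      using energy_ge[OF sq_test(2)[OF \<phi>(1)[of k]]] by (simp add: B_diag \<phi>(2))
    also have "\<dots> \<le> R + \<kappa>" using R[of k] by simp
    finally show ?thesis using \<mu>_pos by (simp add: field_simps)
  qed
  obtain r :: "nat \<Rightarrow> nat" where r: "strict_mono r"
    and Cau: "\<And>e. 0 < e \<Longrightarrow> \<exists>N. \<forall>i\<ge>N. \<forall>j\<ge>N. sqnorm M (\<lambda>x. \<phi> (r i) x - \<phi> (r j) x) < e"
  proof -
    have "\<exists>r :: nat \<Rightarrow> nat. strict_mono r \<and> (\<forall>e>0. \<exists>N. \<forall>i\<ge>N. \<forall>j\<ge>N. sqnorm M (\<lambda>x. \<phi> (r i) x - \<phi> (r j) x) < e)"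
    proof (rule rellich[OF open_\<Omega> bounded_\<Omega> \<phi>(1)])
      show "sqnorm M (\<phi> k) \<le> max 1 ((R + \<kappa>) / \<mu>)" "sqnorm M (grad (\<phi> k)) \<le> max 1 ((R + \<kappa>) / \<mu>)" for k
        using gradb[of k] \<phi>(2)[of k] by simp_all
    qed
    then show thesis using that by blast
  qed
  obtain u s where u: "L2_tendsto M (\<lambda>k. \<phi> (r k)) u" and s: "strict_mono (s :: nat \<Rightarrow> nat)"
      "AE x in M. (\<lambda>k. \<phi> (r (s k)) x) \<longlonglongrightarrow> u x"
    by (rule L2_complete[of "\<lambda>k. \<phi> (r k)", OF sq_test(1)[OF \<phi>(1)] Cau])
  have B\<phi>: "(\<lambda>k. B (\<phi> (r k)) (\<phi> (r k))) \<longlonglongrightarrow> 0"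
    using LIMSEQ_subseq_LIMSEQ[OF \<phi>(3) r] by (simp add: o_def)
  have B\<psi>: "(\<lambda>k. B (\<psi> k) (\<psi> k)) \<longlonglongrightarrow> 0"
  proof -
    have "(\<lambda>k. energy (grad (\<psi> k)) (grad (\<psi> k)) - \<kappa> * sqnorm M (\<psi> k)) \<longlonglongrightarrow> energy Y Y - \<kappa> * sqnorm M y"
      by (intro tendsto_intros energy_tendsto L2_tendsto_sqnorm \<psi>)
    then show ?thesis by (simp add: B_diag y)
  qed
  have nu: "null_limit u" unfolding null_limit_def
    using \<phi>(1) u B\<phi> by (intro exI[of _ "\<lambda>k. \<phi> (r k)"]) simp
  have ny: "null_limit y" unfolding null_limit_def
    using \<psi> B\<psi> by (intro exI[of _ \<psi>]) simp
  obtain c where c: "AE x in M. u x = c * y x"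
    using null_limit_unique[OF conn ne nu ny y(3)] by blast
  have sqcy: "square_integrable M (\<lambda>x. c * y x)" by (rule square_integrable_cmult[OF L2_tendstoD(2)[OF \<psi>(2)]])
  have ucy: "L2_tendsto M (\<lambda>k. \<phi> (r k)) (\<lambda>x. c * y x)"
    by (rule L2_limit_AE_unique[OF u sqcy c])
  have c2: "c\<^sup>2 = 1"
  proof -
    have "(\<lambda>k. sqnorm M (\<phi> (r k))) \<longlonglongrightarrow> sqnorm M (\<lambda>x. c *\<^sub>R y x)"
      using L2_tendsto_sqnorm[OF ucy] by simp
    then have "sqnorm M (\<lambda>x. c *\<^sub>R y x) = 1" by (simp add: \<phi>(2) LIMSEQ_const_iff del: real_scaleR_def)
    then show ?thesis by (simp only: sqnorm_scaleR y(1) mult_1_right)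
  qed
  define d where "d k = (\<lambda>x. \<phi> (r k) x + (- c) * \<psi> k x)" for k
  have d: "d k \<in> test_functions \<Omega>" for k
    unfolding d_def by (intro test_function_add test_function_cmult \<phi> \<psi>)
  have "L2_tendsto M (\<lambda>k x. \<phi> (r k) x + (- c) *\<^sub>R \<psi> k x) (\<lambda>x. c * y x + (- c) *\<^sub>R y x)"
    by (intro L2_tendsto_add ucy L2_tendsto_scaleR \<psi>)
  then have d0: "(\<lambda>k. sqnorm M (d k)) \<longlonglongrightarrow> 0"
    using L2_tendsto_sqnorm[of M d "\<lambda>x. 0"] by (simp add: d_def[abs_def] sqnorm_def)
  have limB: "(\<lambda>k. 2 * B (\<phi> (r k)) (\<phi> (r k)) + 2 * (- c)\<^sup>2 * B (\<psi> k) (\<psi> k)) \<longlonglongrightarrow> 0"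
    using tendsto_add[OF tendsto_mult_right_zero[OF B\<phi>, of 2] tendsto_mult_right_zero[OF B\<psi>, of "2 * (- c)\<^sup>2"]]
    by simp
  have Bd: "(\<lambda>k. B (d k) (d k)) \<longlonglongrightarrow> 0"
    by (rule tendsto_sandwich[OF always_eventually always_eventually tendsto_const limB])
      (intro allI B_nonneg d, intro allI, unfold d_def, intro B_combination_le \<phi> \<psi>)
  have gd: "(\<lambda>k. sqnorm M (grad (d k))) \<longlonglongrightarrow> 0"
  proof (rule tendsto_sandwich[OF always_eventually always_eventually tendsto_const])
    show "\<forall>k. 0 \<le> sqnorm M (grad (d k))" by (simp add: sqnorm_nonneg)
    show "\<forall>k. sqnorm M (grad (d k)) \<le> inverse \<mu> * (B (d k) (d k) + \<kappa> * sqnorm M (d k))"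
    proof
      fix k
      have "\<mu> * sqnorm M (grad (d k)) \<le> B (d k) (d k) + \<kappa> * sqnorm M (d k)"
        using energy_ge[OF sq_test(2)[OF d[of k]]] by (simp add: B_diag)
      then show "sqnorm M (grad (d k)) \<le> inverse \<mu> * (B (d k) (d k) + \<kappa> * sqnorm M (d k))"
        using \<mu>_pos by (simp add: field_simps)
    qed
    have "(\<lambda>k. inverse \<mu> * (B (d k) (d k) + \<kappa> * sqnorm M (d k))) \<longlonglongrightarrow> inverse \<mu> * (0 + \<kappa> * 0)"
      by (intro tendsto_intros Bd d0)
    then show "(\<lambda>k. inverse \<mu> * (B (d k) (d k) + \<kappa> * sqnorm M (d k))) \<longlonglongrightarrow> 0" by simp
  qed
  have "L2_tendsto M (\<lambda>k. grad (d k)) (\<lambda>x. 0)"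
    by (rule L2_tendstoI) (use sq_test(2)[OF d] gd square_integrable_const in simp_all)
  from L2_tendsto_add[OF this L2_tendsto_scaleR[OF \<psi>(3), of c]]
  have "L2_tendsto M (\<lambda>k x. grad (d k) x + c *\<^sub>R grad (\<psi> k) x) (\<lambda>x. c *\<^sub>R Y x)" by simp
  moreover have "grad (d k) x + c *\<^sub>R grad (\<psi> k) x = grad (\<phi> (r k)) x" for k x
    unfolding d_def grad_add[OF \<phi>(1) test_function_cmult[OF \<psi>(1)]] grad_cmult[OF \<psi>(1)] by simp
  ultimately have "L2_tendsto M (\<lambda>k. grad (\<phi> (r k))) (\<lambda>x. c *\<^sub>R Y x)" by simp
  with r c2 show ?thesis by (intro exI[of _ r] exI[of _ c] conjI)
qed

end

section \<open>The principal eigenvalue of a mixture\<close>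

lemma mat_mult_vec: "mat k *v v = k *\<^sub>R (v :: real ^ 'n)"
proof -
  have "(mat k *v v) $ i = k * v $ i" for i
    by (simp add: matrix_vector_mult_def mat_def if_distrib[of "\<lambda>c. c * _"] sum.delta cong: if_cong)
  then show ?thesis by (simp add: vec_eq_iff)
qed

lemma elliptic_matricesD:
  fixes A :: "real ^ 'n ^ 'n"
  assumes "A \<in> elliptic_matrices a b"
  shows "(A *v v) \<bullet> w = (A *v w) \<bullet> v" and "a * (norm v)\<^sup>2 \<le> (A *v v) \<bullet> v"
proof -
  have tr: "transpose A = A" and le: "mat a \<preceq> A" using assms by (auto simp: elliptic_matrices_def)
  have "(transpose A *v v) \<bullet> w = v \<bullet> (A *v w)"
    by (simp only: transpose_matrix_vector dot_lmul_matrix)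
  then show "(A *v v) \<bullet> w = (A *v w) \<bullet> v" by (simp add: tr inner_commute)
  have "0 \<le> ((A - mat a) *v v) \<bullet> v" using le by (simp add: loewner_le_def)
  then show "a * (norm v)\<^sup>2 \<le> (A *v v) \<bullet> v"
    by (simp add: matrix_vector_mult_diff_rdistrib mat_mult_vec inner_diff_left power2_norm_eq_inner)
qed

lemma mixture_mult_vec:
  "mixture A\<^sub>0 A\<^sub>1 \<sigma> x *v v = A\<^sub>0 *v v + \<sigma> x *\<^sub>R ((A\<^sub>1 - A\<^sub>0) *v v)"
  by (simp add: mixture_def matrix_vector_mult_add_rdistrib scaleR_matrix_vector_assoc)

lemma borel_measurable_matrix_vector_mult:
  fixes C :: "real ^ 'n ^ 'm"
  assumes "F \<in> borel_measurable M" shows "(\<lambda>x. C *v F x) \<in> borel_measurable M"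
proof -
  have "(\<lambda>v. C *v v) \<in> borel_measurable borel"
    by (intro borel_measurable_continuous_onI linear_continuous_on matrix_vector_mul_bounded_linear)
  from measurable_compose[OF assms this] show ?thesis .
qed

locale mixture_problem =
  fixes \<Omega> :: "(real ^ 'n) set" and A\<^sub>0 A\<^sub>1 :: "real ^ 'n ^ 'n" and \<mu>\<^sub>0 \<mu>\<^sub>1 \<alpha> \<beta> :: real
  assumes open_\<Omega>: "open \<Omega>" and bounded_\<Omega>: "bounded \<Omega>" and connected_\<Omega>: "connected \<Omega>"
    and nonempty_\<Omega>: "\<Omega> \<noteq> {}"
    and \<mu>\<^sub>0_pos: "0 < \<mu>\<^sub>0"
    and A\<^sub>0: "A\<^sub>0 \<in> elliptic_matrices \<mu>\<^sub>0 \<mu>\<^sub>1" and A\<^sub>1: "A\<^sub>1 \<in> elliptic_matrices \<mu>\<^sub>0 \<mu>\<^sub>1"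
    and \<alpha>\<beta>: "0 \<le> \<alpha>" "\<alpha> \<le> \<beta>" "\<beta> \<le> 1"
begin

abbreviation M where "M \<equiv> lebesgue_on \<Omega>"

sublocale finite_measure M by (rule finite_measure_lebesgue_on_bounded[OF open_\<Omega> bounded_\<Omega>])

definition \<Lambda> where "\<Lambda> = onorm ((*v) A\<^sub>0) + onorm ((*v) A\<^sub>1)"

definition fraction :: "(real ^ 'n \<Rightarrow> real) \<Rightarrow> bool" where
  "fraction \<sigma> \<longleftrightarrow> \<sigma> \<in> borel_measurable M \<and> (\<forall>x\<in>\<Omega>. 0 \<le> \<sigma> x \<and> \<sigma> x \<le> 1)"

definition level :: "(real ^ 'n \<Rightarrow> real) \<Rightarrow> real" where
  "level \<sigma> = principal_eigenvalue \<Omega> (mixture A\<^sub>0 A\<^sub>1 \<sigma>)"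

definition competitors :: "(real ^ 'n \<Rightarrow> real) set" where
  "competitors = {y \<in> W12_0 \<Omega>. \<not> (AE x in M. y x = 0)}"

text \<open>The integrand of the first variation: the Rayleigh quotient depends on \<open>\<sigma>\<close> through the integral of
\<open>\<sigma>\<close> against this function.\<close>

definition contrast :: "(real ^ 'n \<Rightarrow> real ^ 'n) \<Rightarrow> real ^ 'n \<Rightarrow> real" where
  "contrast G x = ((A\<^sub>1 - A\<^sub>0) *v G x) \<bullet> G x"

lemma mixture_elliptic_coefficient:
  assumes "fraction \<sigma>"
  shows "elliptic_coefficient \<Omega> (mixture A\<^sub>0 A\<^sub>1 \<sigma>) \<mu>\<^sub>0 \<Lambda>"
proof
  have [measurable]: "\<sigma> \<in> borel_measurable M" and \<sigma>: "\<And>x. x \<in> \<Omega> \<Longrightarrow> 0 \<le> \<sigma> x \<and> \<sigma> x \<le> 1"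
    using assms by (auto simp: fraction_def)
  have mix: "mixture A\<^sub>0 A\<^sub>1 \<sigma> x *v v = (1 - \<sigma> x) *\<^sub>R (A\<^sub>0 *v v) + \<sigma> x *\<^sub>R (A\<^sub>1 *v v)" for x v
    by (simp add: mixture_mult_vec matrix_vector_mult_diff_rdistrib algebra_simps)
  show "open \<Omega>" "bounded \<Omega>" "0 < \<mu>\<^sub>0" by (rule open_\<Omega> bounded_\<Omega> \<mu>\<^sub>0_pos)+
  have on: "0 \<le> onorm ((*v) A\<^sub>0)" "0 \<le> onorm ((*v) A\<^sub>1)"
    by (intro onorm_pos_le matrix_vector_mul_bounded_linear)+
  then show "0 \<le> \<Lambda>" by (simp add: \<Lambda>_def)
  show "(\<lambda>x. mixture A\<^sub>0 A\<^sub>1 \<sigma> x *v F x) \<in> borel_measurable M" if F: "F \<in> borel_measurable M" for F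
    unfolding mixture_mult_vec
    using borel_measurable_matrix_vector_mult[OF F, of A\<^sub>0] borel_measurable_matrix_vector_mult[OF F, of "A\<^sub>1 - A\<^sub>0"]
    by measurable
  fix x v w assume x: "x \<in> \<Omega>"
  show "(mixture A\<^sub>0 A\<^sub>1 \<sigma> x *v v) \<bullet> w = (mixture A\<^sub>0 A\<^sub>1 \<sigma> x *v w) \<bullet> v"
    unfolding mix inner_add_left inner_scaleR_left
    by (simp only: elliptic_matricesD(1)[OF A\<^sub>0, of v w] elliptic_matricesD(1)[OF A\<^sub>1, of v w])
  have "(1 - \<sigma> x) * (\<mu>\<^sub>0 * (norm v)\<^sup>2) + \<sigma> x * (\<mu>\<^sub>0 * (norm v)\<^sup>2) \<le>
      (1 - \<sigma> x) * ((A\<^sub>0 *v v) \<bullet> v) + \<sigma> x * ((A\<^sub>1 *v v) \<bullet> v)"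
    using \<sigma>[OF x] by (intro add_mono mult_left_mono elliptic_matricesD(2)[OF A\<^sub>0] elliptic_matricesD(2)[OF A\<^sub>1]) auto
  then show "\<mu>\<^sub>0 * (norm v)\<^sup>2 \<le> (mixture A\<^sub>0 A\<^sub>1 \<sigma> x *v v) \<bullet> v"
    unfolding mix inner_add_left inner_scaleR_left by (simp add: algebra_simps)
  have "norm (mixture A\<^sub>0 A\<^sub>1 \<sigma> x *v v) \<le> norm ((1 - \<sigma> x) *\<^sub>R (A\<^sub>0 *v v)) + norm (\<sigma> x *\<^sub>R (A\<^sub>1 *v v))"
    unfolding mix by (rule norm_triangle_ineq)
  also have "\<dots> \<le> 1 * (onorm ((*v) A\<^sub>0) * norm v) + 1 * (onorm ((*v) A\<^sub>1) * norm v)"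
    unfolding norm_scaleR using \<sigma>[OF x] on
    by (intro add_mono mult_mono onorm matrix_vector_mul_bounded_linear) auto
  finally show "norm (mixture A\<^sub>0 A\<^sub>1 \<sigma> x *v v) \<le> \<Lambda> * norm v" by (simp add: \<Lambda>_def distrib_right)
qed

lemma W12_0_approx:
  assumes "y \<in> W12_0 \<Omega>"
  shows "\<exists>\<phi>. (\<forall>k. \<phi> k \<in> test_functions \<Omega>) \<and> L2_tendsto M \<phi> y \<and>
    L2_tendsto M (\<lambda>k. grad (\<phi> k)) (weak_gradient \<Omega> y)"
proof -
  note sq = test_function_square_integrable[OF finite_measure_lebesgue_on_bounded[OF open_\<Omega> bounded_\<Omega>]]
  have "\<exists>G. has_weak_gradient \<Omega> y G" using assms by (simp add: W12_0_def W12_def)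
  then have "has_weak_gradient \<Omega> y (weak_gradient \<Omega> y)"
    unfolding weak_gradient_def by (rule someI_ex)
  then have y: "square_integrable M y" "square_integrable M (weak_gradient \<Omega> y)"
    by (simp_all add: has_weak_gradient_def L2_iff)
  obtain \<phi> where \<phi>: "\<And>k. \<phi> k \<in> test_functions \<Omega>"
    "(\<lambda>k. LINT x|M. (y x - \<phi> k x)\<^sup>2) \<longlonglongrightarrow> 0"
    "(\<lambda>k. LINT x|M. (norm (weak_gradient \<Omega> y x - grad (\<phi> k) x))\<^sup>2) \<longlonglongrightarrow> 0"
    using assms unfolding W12_0_def by blast
  have "L2_tendsto M \<phi> y"
    by (rule L2_tendstoI[OF sq(1)[OF \<phi>(1)] y(1)])
      (use \<phi>(2) in \<open>simp add: sqnorm_minus_commute[of M _ y] sqnorm_def[of M "\<lambda>x. y x - _ x"]\<close>)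
  moreover have "L2_tendsto M (\<lambda>k. grad (\<phi> k)) (weak_gradient \<Omega> y)"
    by (rule L2_tendstoI[OF sq(2)[OF \<phi>(1)] y(2)])
      (use \<phi>(3) in \<open>simp add: sqnorm_minus_commute[of M _ "weak_gradient \<Omega> y"] sqnorm_def[of M "\<lambda>x. weak_gradient \<Omega> y x - _ x"]\<close>)
  ultimately show ?thesis using \<phi>(1) by (intro exI[of _ \<phi>]) simp
qed

lemma W12_0_square_integrable:
  assumes "y \<in> W12_0 \<Omega>"
  shows "square_integrable M y" and "square_integrable M (weak_gradient \<Omega> y)"
  using W12_0_approx[OF assms] by (auto simp: L2_tendsto_def)

lemma test_function_in_W12_0:
  assumes "\<phi> \<in> test_functions \<Omega>" shows "\<phi> \<in> W12_0 \<Omega>"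
proof -
  have "(LINT x|M. (norm (weak_gradient \<Omega> \<phi> x - grad \<phi> x))\<^sup>2) = 0"
  proof (rule integral_eq_zero_AE)
    show "AE x in M. (norm (weak_gradient \<Omega> \<phi> x - grad \<phi> x))\<^sup>2 = 0"
      using weak_gradient_test_function[OF open_\<Omega> bounded_\<Omega> assms] by eventually_elim simp
  qed
  moreover have "\<phi> \<in> W12 \<Omega>"
    unfolding W12_def using test_function_has_weak_gradient[OF open_\<Omega> bounded_\<Omega> assms] by blast
  ultimately show ?thesis
    unfolding W12_0_def using assms by (intro CollectI conjI exI[of _ "\<lambda>k. \<phi>"]) simp_all
qed

lemma contrast_integrable:
  assumes "square_integrable M G" "\<sigma> \<in> borel_measurable M" "\<And>x. x \<in> \<Omega> \<Longrightarrow> \<bar>\<sigma> x\<bar> \<le> 1"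
  shows "integrable M (\<lambda>x. \<sigma> x * contrast G x)"
proof -
  have "square_integrable M (\<lambda>x. (A\<^sub>1 - A\<^sub>0) *v G x)"
    by (rule square_integrable_bound[OF assms(1), of _ "onorm ((*v) (A\<^sub>1 - A\<^sub>0))"])
      (auto intro!: borel_measurable_matrix_vector_mult square_integrable_measurable[OF assms(1)]
        onorm matrix_vector_mul_bounded_linear)
  then have int: "integrable M (contrast G)" unfolding contrast_def[abs_def] by (rule integrable_inner[OF _ assms(1)])
  then show ?thesis
  proof (rule Bochner_Integration.integrable_bound)
    show "(\<lambda>x. \<sigma> x * contrast G x) \<in> borel_measurable M" using assms(2) int by measurable
    show "AE x in M. norm (\<sigma> x * contrast G x) \<le> norm (contrast G x)"
      using assms(3) by (intro AE_I2) (simp add: abs_mult mult_left_le_one_le)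
  qed
qed

lemma dirichlet_form_eq:
  assumes \<sigma>: "fraction \<sigma>" and y: "y \<in> W12_0 \<Omega>"
  shows "dirichlet_form \<Omega> (mixture A\<^sub>0 A\<^sub>1 \<sigma>) y y =
    (LINT x|M. (A\<^sub>0 *v weak_gradient \<Omega> y x) \<bullet> weak_gradient \<Omega> y x) + (LINT x|M. \<sigma> x * contrast (weak_gradient \<Omega> y) x)"
proof -
  let ?G = "weak_gradient \<Omega> y"
  note sG = W12_0_square_integrable(2)[OF y]
  have "square_integrable M (\<lambda>x. A\<^sub>0 *v ?G x)"
    by (rule square_integrable_bound[OF sG, of _ "onorm ((*v) A\<^sub>0)"])
      (auto intro!: borel_measurable_matrix_vector_mult square_integrable_measurable[OF sG]
        onorm matrix_vector_mul_bounded_linear)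
  then have 1: "integrable M (\<lambda>x. (A\<^sub>0 *v ?G x) \<bullet> ?G x)" by (rule integrable_inner[OF _ sG])
  have 2: "integrable M (\<lambda>x. \<sigma> x * contrast ?G x)"
    by (rule contrast_integrable[OF sG]) (use \<sigma> in \<open>auto simp: fraction_def\<close>)
  show ?thesis
    using 1 2 by (simp add: dirichlet_form_def mixture_mult_vec inner_add_left contrast_def)
qed

definition rayleigh :: "(real ^ 'n \<Rightarrow> real) \<Rightarrow> (real ^ 'n \<Rightarrow> real) \<Rightarrow> real" where
  "rayleigh \<sigma> y = dirichlet_form \<Omega> (mixture A\<^sub>0 A\<^sub>1 \<sigma>) y y / sqnorm M y"

lemma level_eq: "level \<sigma> = (INF y\<in>competitors. rayleigh \<sigma> y)"
  by (simp add: level_def principal_eigenvalue_def competitors_def rayleigh_def sqnorm_def)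

lemma sqnorm_pos_iff:
  assumes "square_integrable M y" shows "0 < sqnorm M y \<longleftrightarrow> \<not> (AE x in M. y x = 0)"
proof -
  have "sqnorm M y = 0 \<longleftrightarrow> (AE x in M. (norm (y x))\<^sup>2 = 0)"
    unfolding sqnorm_def using square_integrable_sq[OF assms] by (intro integral_nonneg_eq_0_iff_AE) auto
  then show ?thesis using sqnorm_nonneg[of M y] by (auto simp: less_le)
qed

lemma dirichlet_form_energy:
  assumes "fraction \<sigma>"
  shows "dirichlet_form \<Omega> (mixture A\<^sub>0 A\<^sub>1 \<sigma>) y y =
    elliptic_coefficient.energy \<Omega> (mixture A\<^sub>0 A\<^sub>1 \<sigma>) (weak_gradient \<Omega> y) (weak_gradient \<Omega> y)"
proof -
  interpret E: elliptic_coefficient \<Omega> "mixture A\<^sub>0 A\<^sub>1 \<sigma>" \<mu>\<^sub>0 \<Lambda> by (rule mixture_elliptic_coefficient[OF assms])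
  show ?thesis by (simp add: dirichlet_form_def E.energy_def)
qed

lemma rayleigh_bounds:
  assumes \<sigma>: "fraction \<sigma>" and y: "y \<in> competitors"
  shows "0 \<le> rayleigh \<sigma> y" and "rayleigh \<sigma> y \<le> \<Lambda> * sqnorm M (weak_gradient \<Omega> y) / sqnorm M y"
proof -
  interpret E: elliptic_coefficient \<Omega> "mixture A\<^sub>0 A\<^sub>1 \<sigma>" \<mu>\<^sub>0 \<Lambda> by (rule mixture_elliptic_coefficient[OF \<sigma>])
  have sG: "square_integrable M (weak_gradient \<Omega> y)"
    using y W12_0_square_integrable(2) by (simp add: competitors_def)
  have "0 \<le> \<mu>\<^sub>0 * sqnorm M (weak_gradient \<Omega> y)" using \<mu>\<^sub>0_pos by (simp add: sqnorm_nonneg)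
  then show "0 \<le> rayleigh \<sigma> y"
    using E.energy_ge[OF sG] by (simp add: rayleigh_def dirichlet_form_energy[OF \<sigma>] sqnorm_nonneg)
  show "rayleigh \<sigma> y \<le> \<Lambda> * sqnorm M (weak_gradient \<Omega> y) / sqnorm M y"
    using E.energy_le[OF sG] by (simp add: rayleigh_def dirichlet_form_energy[OF \<sigma>] sqnorm_nonneg divide_right_mono)
qed

lemma level_le:
  assumes "fraction \<sigma>" "y \<in> competitors" shows "level \<sigma> \<le> rayleigh \<sigma> y"
  unfolding level_eq
  by (rule cINF_lower[OF _ assms(2)]) (use rayleigh_bounds(1)[OF assms(1)] in \<open>auto intro!: bdd_belowI[of _ 0]\<close>)

lemma mixture_ground_level:
  assumes \<sigma>: "fraction \<sigma>"
  shows "elliptic_ground_level \<Omega> (mixture A\<^sub>0 A\<^sub>1 \<sigma>) \<mu>\<^sub>0 \<Lambda> (level \<sigma>)"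
proof -
  interpret E: elliptic_coefficient \<Omega> "mixture A\<^sub>0 A\<^sub>1 \<sigma>" \<mu>\<^sub>0 \<Lambda> by (rule mixture_elliptic_coefficient[OF \<sigma>])
  show ?thesis
  proof
    fix \<phi> assume \<phi>: "\<phi> \<in> test_functions \<Omega>"
    note sq = E.sq_test[OF \<phi>]
    have en: "E.energy (weak_gradient \<Omega> \<phi>) (weak_gradient \<Omega> \<phi>) = E.energy (grad \<phi>) (grad \<phi>)"
      unfolding E.energy_def
    proof (rule integral_cong_AE)
      show "(\<lambda>x. (mixture A\<^sub>0 A\<^sub>1 \<sigma> x *v weak_gradient \<Omega> \<phi> x) \<bullet> weak_gradient \<Omega> \<phi> x) \<in> borel_measurable M"
        by (intro borel_measurable_integrable E.energy_integrable W12_0_square_integrable(2) test_function_in_W12_0 \<phi>)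
      show "(\<lambda>x. (mixture A\<^sub>0 A\<^sub>1 \<sigma> x *v grad \<phi> x) \<bullet> grad \<phi> x) \<in> borel_measurable M"
        by (intro borel_measurable_integrable E.energy_integrable sq)
      show "AE x in M. (mixture A\<^sub>0 A\<^sub>1 \<sigma> x *v weak_gradient \<Omega> \<phi> x) \<bullet> weak_gradient \<Omega> \<phi> x =
          (mixture A\<^sub>0 A\<^sub>1 \<sigma> x *v grad \<phi> x) \<bullet> grad \<phi> x"
        using weak_gradient_test_function[OF open_\<Omega> bounded_\<Omega> \<phi>] by eventually_elim simp
    qed
    show "level \<sigma> * sqnorm M \<phi> \<le> E.energy (grad \<phi>) (grad \<phi>)"
    proof (cases "AE x in M. \<phi> x = 0")
      case True
      then have "sqnorm M \<phi> = 0" using sqnorm_pos_iff[OF sq(1)] sqnorm_nonneg[of M \<phi>] by simp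
      moreover have "0 \<le> \<mu>\<^sub>0 * sqnorm M (grad \<phi>)" using \<mu>\<^sub>0_pos by (simp add: sqnorm_nonneg)
      ultimately show ?thesis using E.energy_ge[OF sq(2)] by simp
    next
      case False
      then have "\<phi> \<in> competitors" using test_function_in_W12_0[OF \<phi>] by (simp add: competitors_def)
      from level_le[OF \<sigma> this] have "level \<sigma> \<le> E.energy (grad \<phi>) (grad \<phi>) / sqnorm M \<phi>"
        by (simp add: rayleigh_def dirichlet_form_energy[OF \<sigma>] en)
      moreover have "0 < sqnorm M \<phi>" using sqnorm_pos_iff[OF sq(1)] False by simp
      ultimately show ?thesis by (simp add: field_simps)
    qed
  qed
qed

text \<open>Test functions are dense in \<open>W12_0\<close> and the Rayleigh quotient is continuous along approximating
sequences.\<close>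

lemma near_minimizing_test_function:
  assumes \<sigma>: "fraction \<sigma>" and ne: "competitors \<noteq> {}" and t: "level \<sigma> < t"
  shows "\<exists>\<phi>\<in>test_functions \<Omega>. sqnorm M \<phi> = 1 \<and>
    elliptic_coefficient.energy \<Omega> (mixture A\<^sub>0 A\<^sub>1 \<sigma>) (grad \<phi>) (grad \<phi>) < t"
proof -
  interpret E: elliptic_coefficient \<Omega> "mixture A\<^sub>0 A\<^sub>1 \<sigma>" \<mu>\<^sub>0 \<Lambda> by (rule mixture_elliptic_coefficient[OF \<sigma>])
  have bdd: "bdd_below (rayleigh \<sigma> ` competitors)"
    using rayleigh_bounds(1)[OF \<sigma>] by (auto intro!: bdd_belowI[of _ 0])
  obtain y where y: "y \<in> competitors" "rayleigh \<sigma> y < t"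
    using t unfolding level_eq cINF_less_iff[OF ne bdd] by (elim bexE)
  have yW: "y \<in> W12_0 \<Omega>" and ypos: "0 < sqnorm M y"
    using y(1) sqnorm_pos_iff[of y] W12_0_square_integrable(1) by (auto simp: competitors_def)
  obtain \<phi> where \<phi>: "\<And>k. \<phi> k \<in> test_functions \<Omega>" "L2_tendsto M \<phi> y"
      "L2_tendsto M (\<lambda>k. grad (\<phi> k)) (weak_gradient \<Omega> y)"
    using W12_0_approx[OF yW] by blast
  have lims: "(\<lambda>k. sqnorm M (\<phi> k)) \<longlonglongrightarrow> sqnorm M y" by (rule L2_tendsto_sqnorm[OF \<phi>(2)])
  have "(\<lambda>k. E.energy (grad (\<phi> k)) (grad (\<phi> k)) / sqnorm M (\<phi> k)) \<longlonglongrightarrow> rayleigh \<sigma> y"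
    unfolding rayleigh_def dirichlet_form_energy[OF \<sigma>]
    using ypos by (intro tendsto_divide E.energy_tendsto \<phi> lims) simp
  then have ev1: "eventually (\<lambda>k. E.energy (grad (\<phi> k)) (grad (\<phi> k)) / sqnorm M (\<phi> k) < t) sequentially"
    using y(2) by (rule order_tendstoD(2))
  have ev2: "eventually (\<lambda>k. 0 < sqnorm M (\<phi> k)) sequentially" using lims ypos by (rule order_tendstoD(1))
  obtain k where k: "E.energy (grad (\<phi> k)) (grad (\<phi> k)) / sqnorm M (\<phi> k) < t" "0 < sqnorm M (\<phi> k)"
    using eventually_happens'[OF sequentially_bot eventually_conj[OF ev1 ev2]] by blast
  define c where "c = inverse (sqrt (sqnorm M (\<phi> k)))"
  have c2: "c\<^sup>2 = inverse (sqnorm M (\<phi> k))" using k(2) by (simp add: c_def power_inverse)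
  have "sqnorm M (\<lambda>x. c * \<phi> k x) = c\<^sup>2 * sqnorm M (\<phi> k)"
    using sqnorm_scaleR[of M c "\<phi> k"] by simp
  then have 1: "sqnorm M (\<lambda>x. c * \<phi> k x) = 1" using k(2) by (simp add: c2)
  have "E.energy (grad (\<lambda>x. c * \<phi> k x)) (grad (\<lambda>x. c * \<phi> k x)) =
      E.energy (\<lambda>x. c *\<^sub>R grad (\<phi> k) x) (\<lambda>x. c *\<^sub>R grad (\<phi> k) x)"
    by (simp add: E.energy_def grad_cmult[OF \<phi>(1)])
  also have "\<dots> = c\<^sup>2 * E.energy (grad (\<phi> k)) (grad (\<phi> k))"
    by (simp add: E.energy_scaleR_left E.energy_commute[of "grad (\<phi> k)" "\<lambda>x. c *\<^sub>R grad (\<phi> k) x"] power2_eq_square)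
  finally have 2: "E.energy (grad (\<lambda>x. c * \<phi> k x)) (grad (\<lambda>x. c * \<phi> k x)) < t"
    using k(1) by (simp add: c2 field_simps)
  show ?thesis
    using 1 2 by (intro bexI[of _ "\<lambda>x. c * \<phi> k x"] conjI test_function_cmult \<phi>)
qed

end

section \<open>Existence of optimal controls\<close>

context mixture_problem
begin

lemma controls_iff:
  "\<sigma> \<in> controls \<Omega> \<alpha> \<beta> \<longleftrightarrow> fraction \<sigma> \<and> \<alpha> * measure lebesgue \<Omega> \<le> (LINT x|M. \<sigma> x) \<and>
    (LINT x|M. \<sigma> x) \<le> \<beta> * measure lebesgue \<Omega>"
  by (auto simp: controls_def fraction_def)

lemma measure_M: "measure M (space M) = measure lebesgue \<Omega>"
  using open_\<Omega> by (simp add: measure_restrict_space)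

lemma fraction_square_integrable:
  assumes "fraction \<sigma>" shows "square_integrable M \<sigma>"
  by (rule square_integrable_bound[OF square_integrable_const[of "1 :: real"], of _ 1])
    (use assms in \<open>auto simp: fraction_def\<close>)

lemma fraction_integrable: "fraction \<sigma> \<Longrightarrow> integrable M \<sigma>"
  by (rule integrable_L2[OF fraction_square_integrable])

lemma fraction_convex:
  assumes "fraction \<sigma>" "fraction \<tau>" "0 \<le> t" "t \<le> 1"
  shows "fraction (\<lambda>x. (1 - t) * \<sigma> x + t * \<tau> x)"
  using assms by (auto simp: fraction_def intro!: convex_bound_le add_nonneg_nonneg)

lemma controls_convex:
  assumes \<sigma>: "\<sigma> \<in> controls \<Omega> \<alpha> \<beta>" and \<tau>: "\<tau> \<in> controls \<Omega> \<alpha> \<beta>" and t: "0 \<le> t" "t \<le> 1"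
  shows "(\<lambda>x. (1 - t) * \<sigma> x + t * \<tau> x) \<in> controls \<Omega> \<alpha> \<beta>"
proof -
  let ?V = "measure lebesgue \<Omega>"
  have fr: "fraction \<sigma>" "fraction \<tau>" using \<sigma> \<tau> by (simp_all add: controls_iff)
  have eq: "(LINT x|M. (1 - t) * \<sigma> x + t * \<tau> x) = (1 - t) * (LINT x|M. \<sigma> x) + t * (LINT x|M. \<tau> x)"
    using fraction_integrable[OF fr(1)] fraction_integrable[OF fr(2)] by simp
  have "(1 - t) * (\<alpha> * ?V) + t * (\<alpha> * ?V) \<le> (1 - t) * (LINT x|M. \<sigma> x) + t * (LINT x|M. \<tau> x)"
    using \<sigma> \<tau> t by (intro add_mono mult_left_mono) (auto simp: controls_iff)
  moreover have "(1 - t) * (LINT x|M. \<sigma> x) + t * (LINT x|M. \<tau> x) \<le> (1 - t) * (\<beta> * ?V) + t * (\<beta> * ?V)"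
    using \<sigma> \<tau> t by (intro add_mono mult_left_mono) (auto simp: controls_iff)
  moreover have "(1 - t) * c + t * c = c" for c :: real by (simp add: algebra_simps)
  ultimately show ?thesis
    using fraction_convex[OF fr t] by (simp add: controls_iff eq)
qed

lemma constant_control: "(\<lambda>x. \<alpha>) \<in> controls \<Omega> \<alpha> \<beta>"
  using \<alpha>\<beta> mult_right_mono[OF \<alpha>\<beta>(2), of "measure lebesgue \<Omega>"]
    measure_M
  by (simp add: controls_iff fraction_def mult.commute)

lemma rayleigh_convex:
  assumes fr: "fraction \<sigma>" "fraction \<tau>" and t: "0 \<le> t" "t \<le> 1" and y: "y \<in> competitors"
  shows "rayleigh (\<lambda>x. (1 - t) * \<sigma> x + t * \<tau> x) y = (1 - t) * rayleigh \<sigma> y + t * rayleigh \<tau> y"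
proof -
  let ?G = "weak_gradient \<Omega> y"
  have yW: "y \<in> W12_0 \<Omega>" using y by (simp add: competitors_def)
  have int: "integrable M (\<lambda>x. \<rho> x * contrast ?G x)" if "fraction \<rho>" for \<rho>
    by (rule contrast_integrable[OF W12_0_square_integrable(2)[OF yW]]) (use that in \<open>auto simp: fraction_def\<close>)
  have "(LINT x|M. ((1 - t) * \<sigma> x + t * \<tau> x) * contrast ?G x) =
      (LINT x|M. (1 - t) * (\<sigma> x * contrast ?G x) + t * (\<tau> x * contrast ?G x))"
    by (rule Bochner_Integration.integral_cong) (simp_all add: algebra_simps)
  also have "\<dots> = (1 - t) * (LINT x|M. \<sigma> x * contrast ?G x) + t * (LINT x|M. \<tau> x * contrast ?G x)"
    using int[OF fr(1)] int[OF fr(2)] by simp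
  finally have I: "(LINT x|M. ((1 - t) * \<sigma> x + t * \<tau> x) * contrast ?G x) =
      (1 - t) * (LINT x|M. \<sigma> x * contrast ?G x) + t * (LINT x|M. \<tau> x * contrast ?G x)" .
  have affine: "a + i = (1 - t) * (a + i\<^sub>1) + t * (a + i\<^sub>2)" if "i = (1 - t) * i\<^sub>1 + t * i\<^sub>2" for a i i\<^sub>1 i\<^sub>2
    using that by (simp add: algebra_simps)
  have "dirichlet_form \<Omega> (mixture A\<^sub>0 A\<^sub>1 (\<lambda>x. (1 - t) * \<sigma> x + t * \<tau> x)) y y =
      (1 - t) * dirichlet_form \<Omega> (mixture A\<^sub>0 A\<^sub>1 \<sigma>) y y + t * dirichlet_form \<Omega> (mixture A\<^sub>0 A\<^sub>1 \<tau>) y y"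
    unfolding dirichlet_form_eq[OF fraction_convex[OF fr t] yW] dirichlet_form_eq[OF fr(1) yW]
        dirichlet_form_eq[OF fr(2) yW] by (rule affine[OF I])
  then show ?thesis by (simp add: rayleigh_def add_divide_distrib)
qed

text \<open>Concavity of the eigenvalue, as an infimum of functions that are affine in the control. Midpoints
suffice for the parallelogram argument.\<close>

lemma level_midpoint:
  assumes fr: "fraction \<sigma>" "fraction \<tau>" and ne: "competitors \<noteq> {}" and s: "s < level \<sigma>" "s < level \<tau>"
  shows "s < level (\<lambda>x. (1 - 1 / 2) * \<sigma> x + 1 / 2 * \<tau> x)"
proof -
  have "(level \<sigma> + level \<tau>) / 2 \<le> level (\<lambda>x. (1 - 1 / 2) * \<sigma> x + 1 / 2 * \<tau> x)"
    unfolding level_eq[of "\<lambda>x. (1 - 1 / 2) * \<sigma> x + 1 / 2 * \<tau> x"]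
  proof (rule cINF_greatest[OF ne])
    fix y assume y: "y \<in> competitors"
    have "rayleigh (\<lambda>x. (1 - 1 / 2) * \<sigma> x + 1 / 2 * \<tau> x) y = (1 - 1 / 2) * rayleigh \<sigma> y + 1 / 2 * rayleigh \<tau> y"
      by (rule rayleigh_convex[OF fr _ _ y]) simp_all
    then show "(level \<sigma> + level \<tau>) / 2 \<le> rayleigh (\<lambda>x. (1 - 1 / 2) * \<sigma> x + 1 / 2 * \<tau> x) y"
      using level_le[OF fr(1) y] level_le[OF fr(2) y] by simp
  qed
  moreover have "r < (a + b) / 2" if "r < a" "r < b" for r a b :: real using that by simp
  from this[OF s] have "s < (level \<sigma> + level \<tau>) / 2" .
  ultimately show ?thesis by (rule less_le_trans[rotated])
qed

lemma level_bdd_above: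
  assumes "competitors \<noteq> {}" shows "bdd_above (level ` controls \<Omega> \<alpha> \<beta>)"
proof -
  obtain y where y: "y \<in> competitors" using assms by blast
  show ?thesis
  proof (rule bdd_aboveI2)
    fix \<sigma> assume "\<sigma> \<in> controls \<Omega> \<alpha> \<beta>"
    then have "fraction \<sigma>" by (simp add: controls_iff)
    from order_trans[OF level_le[OF this y] rayleigh_bounds(2)[OF this y]]
    show "level \<sigma> \<le> \<Lambda> * sqnorm M (weak_gradient \<Omega> y) / sqnorm M y" .
  qed
qed

lemma rayleigh_tendsto:
  assumes fr: "\<And>k. fraction (\<sigma> k)" "fraction \<tau>" and lim: "AE x in M. (\<lambda>k. \<sigma> k x) \<longlonglongrightarrow> \<tau> x"
    and y: "y \<in> competitors"
  shows "(\<lambda>k. rayleigh (\<sigma> k) y) \<longlonglongrightarrow> rayleigh \<tau> y"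
proof -
  let ?G = "weak_gradient \<Omega> y"
  have yW: "y \<in> W12_0 \<Omega>" and ypos: "0 < sqnorm M y"
    using y sqnorm_pos_iff[of y] W12_0_square_integrable(1) by (auto simp: competitors_def)
  note sG = W12_0_square_integrable(2)[OF yW]
  have int: "integrable M (\<lambda>x. \<rho> x * contrast ?G x)" if "fraction \<rho>" for \<rho>
    by (rule contrast_integrable[OF sG]) (use that in \<open>auto simp: fraction_def\<close>)
  have int1: "integrable M (\<lambda>x. 1 * contrast ?G x)" by (rule contrast_integrable[OF sG]) simp_all
  have "(\<lambda>k. LINT x|M. \<sigma> k x * contrast ?G x) \<longlonglongrightarrow> (LINT x|M. \<tau> x * contrast ?G x)"
  proof (rule integral_dominated_convergence[where w="\<lambda>x. norm (1 * contrast ?G x)"])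
    show "(\<lambda>x. \<tau> x * contrast ?G x) \<in> borel_measurable M" "(\<lambda>x. \<sigma> k x * contrast ?G x) \<in> borel_measurable M" for k
      using int[OF fr(2)] int[OF fr(1)] by (auto intro: borel_measurable_integrable)
    show "integrable M (\<lambda>x. norm (1 * contrast ?G x))" by (rule integrable_norm[OF int1])
    show "AE x in M. (\<lambda>k. \<sigma> k x * contrast ?G x) \<longlonglongrightarrow> \<tau> x * contrast ?G x"
      using lim by eventually_elim (rule tendsto_mult_right)
    show "AE x in M. norm (\<sigma> k x * contrast ?G x) \<le> norm (1 * contrast ?G x)" for k
      using fr(1)[of k] by (intro AE_I2) (auto simp: fraction_def abs_mult mult_left_le_one_le)
  qed
  then show ?thesis
    unfolding rayleigh_def using ypos
    by (intro tendsto_divide) (auto simp: dirichlet_form_eq[OF fr(1) yW] dirichlet_form_eq[OF fr(2) yW] intro!: tendsto_add)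
qed

text \<open>Let \<open>C k\<close> be the convex set of controls within \<open>e k\<close> of the supremum and choose \<open>\<sigma> k\<close> in \<open>C k\<close> with
almost minimal norm. Midpoints of late members again lie in \<open>C N\<close>, so their norms are not much
smaller, and the parallelogram law shows that the sequence is Cauchy. Along an almost everywhere
convergent subsequence all Rayleigh quotients converge, hence the limit attains the supremum. If
\<open>W12_0\<close> had no nonzero element, all eigenvalues would be the same infimum over the empty set.\<close>

theorem optimal_control_exists: "\<exists>\<sigma>. optimal_control \<Omega> A\<^sub>0 A\<^sub>1 \<alpha> \<beta> \<sigma>"
proof (cases "competitors = {}")
  case True
  have "level \<sigma> = level (\<lambda>x. \<alpha>)" for \<sigma> unfolding level_eq True by simp
  then have "(SUP \<tau>\<in>controls \<Omega> \<alpha> \<beta>. level \<tau>) = (SUP \<tau>\<in>controls \<Omega> \<alpha> \<beta>. level (\<lambda>x. \<alpha>))" by (rule SUP_cong[OF refl])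
  also have "\<dots> = level (\<lambda>x. \<alpha>)" using constant_control by (intro cSUP_const) blast
  finally show ?thesis
    unfolding optimal_control_def level_def[symmetric]
    by (intro exI[of _ "\<lambda>x. \<alpha>"] conjI constant_control) simp
next
  case ne: False
  let ?\<Sigma> = "controls \<Omega> \<alpha> \<beta>"
  define s where "s = (SUP \<tau>\<in>?\<Sigma>. level \<tau>)"
  note bdd = level_bdd_above[OF ne]
  define e where "e k = inverse (real (Suc k))" for k
  have e: "0 < e k" for k by (simp add: e_def)
  have emono: "e j \<le> e k" if "k \<le> j" for j k using that by (simp add: e_def)
  have e0: "e \<longlonglongrightarrow> 0" unfolding e_def by (rule LIMSEQ_inverse_real_of_nat)
  define C where "C k = {\<sigma>\<in>?\<Sigma>. s - e k < level \<sigma>}" for k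
  have Cne: "C k \<noteq> {}" for k
  proof -
    have "s - e k < s" using e[of k] by simp
    then obtain \<sigma> where "\<sigma> \<in> ?\<Sigma>" "s - e k < level \<sigma>"
      unfolding s_def using less_cSUP_iff[OF _ bdd] constant_control by blast
    then show ?thesis unfolding C_def by blast
  qed
  have Cmono: "C j \<subseteq> C k" if "k \<le> j" for j k using emono[OF that] unfolding C_def by force
  have frC: "fraction \<sigma>" if "\<sigma> \<in> C k" for \<sigma> k using that by (simp add: C_def controls_iff)
  define d where "d k = (INF \<sigma>\<in>C k. sqnorm M \<sigma>)" for k
  have bddN: "bdd_below (sqnorm M ` C k)" for k by (rule bdd_belowI[of _ 0]) (auto simp: sqnorm_nonneg)
  have d_le: "d k \<le> sqnorm M \<sigma>" if "\<sigma> \<in> C k" for \<sigma> k unfolding d_def by (rule cINF_lower[OF bddN that])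
  have "\<exists>\<sigma>\<in>C k. sqnorm M \<sigma> < d k + e k" for k
  proof -
    have "d k < d k + e k" using e[of k] by simp
    then show ?thesis unfolding d_def cINF_less_iff[OF Cne bddN] by simp
  qed
  then obtain \<sigma> where \<sigma>: "\<And>k. \<sigma> k \<in> C k" "\<And>k. sqnorm M (\<sigma> k) < d k + e k" by metis
  have fr: "fraction (\<sigma> k)" for k by (rule frC[OF \<sigma>(1)])
  note sq = fraction_square_integrable[OF fr]
  have d_mono: "d k \<le> d j" if "k \<le> j" for j k
    unfolding d_def[of j] by (rule cINF_greatest[OF Cne]) (use d_le Cmono[OF that] in blast)
  have "d k \<le> measure M (space M)" for k
  proof -
    have "sqnorm M (\<sigma> k) \<le> sqnorm M (\<lambda>x. 1 :: real)"
      by (rule sqnorm_mono[OF square_integrable_const]) (use fr[of k] in \<open>auto simp: fraction_def\<close>)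
    also have "\<dots> = measure M (space M)" by (simp add: sqnorm_def)
    finally show ?thesis using d_le[OF \<sigma>(1), of k] by linarith
  qed
  then obtain L where L: "d \<longlonglongrightarrow> L" "\<And>k. d k \<le> L"
    using incseq_convergent[of d "measure M (space M)"] d_mono by (auto simp: incseq_def)
  have Cauchy: "\<exists>N. \<forall>i\<ge>N. \<forall>j\<ge>N. sqnorm M (\<lambda>x. \<sigma> i x - \<sigma> j x) < \<epsilon>" if \<epsilon>: "0 < \<epsilon>" for \<epsilon>
  proof -
    have "eventually (\<lambda>k. L - \<epsilon> / 16 < d k) sequentially" using L(1) \<epsilon> by (intro order_tendstoD(1)) auto
    moreover have "eventually (\<lambda>k. e k < \<epsilon> / 16) sequentially" using e0 \<epsilon> by (intro order_tendstoD(2)) auto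
    ultimately obtain N where N: "L - \<epsilon> / 16 < d N" "e N < \<epsilon> / 16"
      using eventually_happens'[OF sequentially_bot eventually_conj] by blast
    have "sqnorm M (\<lambda>x. \<sigma> i x - \<sigma> j x) < \<epsilon>" if ij: "N \<le> i" "N \<le> j" for i j
    proof -
      define m where "m x = (1 - 1 / 2) * \<sigma> i x + 1 / 2 * \<sigma> j x" for x
      have inN: "\<sigma> i \<in> C N" "\<sigma> j \<in> C N" using \<sigma>(1) Cmono ij by blast+
      have "m \<in> C N"
        unfolding C_def m_def
        using level_midpoint[OF fr fr ne, of "s - e N" i j] controls_convex[of "\<sigma> i" "\<sigma> j" "1 / 2"] inN
        by (simp add: C_def)
      then have dm: "d N \<le> sqnorm M m" by (rule d_le)
      \<comment> \<open>the parallelogram law\<close>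
      have par: "sqnorm M (\<lambda>x. \<sigma> i x - \<sigma> j x) = 2 * sqnorm M (\<sigma> i) + 2 * sqnorm M (\<sigma> j) - 4 * sqnorm M m"
      proof -
        have "sqnorm M (\<lambda>x. \<sigma> i x + 1 *\<^sub>R \<sigma> j x) = sqnorm M (\<sigma> i) + 2 * (LINT x|M. \<sigma> i x \<bullet> (1 *\<^sub>R \<sigma> j x)) + sqnorm M (\<lambda>x. 1 *\<^sub>R \<sigma> j x)"
          by (rule sqnorm_add[OF sq square_integrable_scaleR[OF sq]])
        moreover have "sqnorm M (\<lambda>x. \<sigma> i x + (-1) *\<^sub>R \<sigma> j x) = sqnorm M (\<sigma> i) + 2 * (LINT x|M. \<sigma> i x \<bullet> ((-1) *\<^sub>R \<sigma> j x)) + sqnorm M (\<lambda>x. (-1) *\<^sub>R \<sigma> j x)"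
          by (rule sqnorm_add[OF sq square_integrable_scaleR[OF sq]])
        moreover have "sqnorm M m = (1 / 2)\<^sup>2 * sqnorm M (\<lambda>x. \<sigma> i x + 1 *\<^sub>R \<sigma> j x)"
          unfolding sqnorm_scaleR[symmetric] by (simp add: m_def[abs_def] algebra_simps)
        ultimately show ?thesis unfolding sqnorm_scaleR by (simp add: power2_eq_square)
      qed
      have "sqnorm M (\<sigma> i) < L + \<epsilon> / 16" "sqnorm M (\<sigma> j) < L + \<epsilon> / 16"
        using \<sigma>(2)[of i] \<sigma>(2)[of j] L(2)[of i] L(2)[of j] emono[OF ij(1)] emono[OF ij(2)] N(2) by linarith+
      then show ?thesis using par dm N(1) \<epsilon> by linarith
    qed
    then show ?thesis by blast
  qed
  obtain u r where u: "L2_tendsto M \<sigma> u" "strict_mono (r :: nat \<Rightarrow> nat)" "AE x in M. (\<lambda>k. \<sigma> (r k) x) \<longlonglongrightarrow> u x"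
    by (rule L2_complete[OF sq Cauchy])
  \<comment> \<open>The limit has values in the unit interval only almost everywhere, whereas controls must obey
     the bounds at every point of the domain.\<close>
  define \<tau> where "\<tau> x = max 0 (min 1 (u x))" for x
  have clamp: "max 0 (min 1 (\<sigma> k x)) = \<sigma> k x" if "x \<in> \<Omega>" for k x
    using fr[of k] that by (auto simp: fraction_def min_def max_def intro: order_antisym)
  have [measurable]: "u \<in> borel_measurable M" using L2_tendstoD(2)[OF u(1)] by (rule square_integrable_measurable)
  have fr\<tau>: "fraction \<tau>" unfolding fraction_def \<tau>_def[abs_def] by simp
  have L\<tau>: "L2_tendsto M \<sigma> \<tau>"
  proof (rule L2_tendsto_bound[OF u(1) sq fraction_square_integrable[OF fr\<tau>], where C=1])
    fix k x assume "x \<in> space M"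
    then show "norm (\<sigma> k x - \<tau> x) \<le> 1 * norm (\<sigma> k x - u x)"
      using clamp[of x k] by (simp add: \<tau>_def min_def max_def split: if_splits)
  qed
  have "(\<lambda>k. LINT x|M. \<sigma> k x \<bullet> 1) \<longlonglongrightarrow> (LINT x|M. \<tau> x \<bullet> 1)"
    by (rule L2_tendsto_inner[OF L\<tau>]) (rule L2_tendstoI, simp_all add: square_integrable_const sqnorm_def)
  then have lim: "(\<lambda>k. LINT x|M. \<sigma> k x) \<longlonglongrightarrow> (LINT x|M. \<tau> x)" by simp
  have con: "\<sigma> k \<in> ?\<Sigma>" for k using \<sigma>(1)[of k] by (simp add: C_def)
  have \<tau>: "\<tau> \<in> ?\<Sigma>"
    unfolding controls_iff
  proof (intro conjI fr\<tau>)
    show "\<alpha> * measure lebesgue \<Omega> \<le> (LINT x|M. \<tau> x)"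
      by (rule LIMSEQ_le_const[OF lim]) (use con in \<open>auto simp: controls_iff\<close>)
    show "(LINT x|M. \<tau> x) \<le> \<beta> * measure lebesgue \<Omega>"
      by (rule LIMSEQ_le_const2[OF lim]) (use con in \<open>auto simp: controls_iff\<close>)
  qed
  have AE\<tau>: "AE x in M. (\<lambda>k. \<sigma> (r k) x) \<longlonglongrightarrow> \<tau> x"
    using u(3) AE_space
  proof eventually_elim
    case (elim x)
    have "(\<lambda>k. max 0 (min 1 (\<sigma> (r k) x))) \<longlonglongrightarrow> \<tau> x" unfolding \<tau>_def by (intro tendsto_intros elim(1))
    then show ?case using clamp elim(2) by simp
  qed
  have "s \<le> level \<tau>"
    unfolding level_eq
  proof (rule cINF_greatest[OF ne])
    fix y assume y: "y \<in> competitors"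
    have l1: "(\<lambda>k. rayleigh (\<sigma> (r k)) y) \<longlonglongrightarrow> rayleigh \<tau> y" by (rule rayleigh_tendsto[OF fr fr\<tau> AE\<tau> y])
    have l2: "(\<lambda>k. s - e (r k)) \<longlonglongrightarrow> s - 0"
      using LIMSEQ_subseq_LIMSEQ[OF e0 u(2)] by (intro tendsto_intros) (simp add: o_def)
    have "s - e (r k) \<le> rayleigh (\<sigma> (r k)) y" for k
      using \<sigma>(1)[of "r k"] level_le[OF fr[of "r k"] y] by (simp add: C_def)
    then show "s \<le> rayleigh \<tau> y" using LIMSEQ_le[OF l2 l1] by simp
  qed
  moreover have "level \<tau> \<le> s" unfolding s_def by (rule cSUP_upper[OF \<tau> bdd])
  ultimately have "level \<tau> = s" by simp
  then show ?thesis
    unfolding optimal_control_def level_def[symmetric] s_def using \<tau> by blast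
qed

end

section \<open>Optimality conditions\<close>

lemma quadratic_form_tendsto:
  fixes C :: "real ^ 'n ^ 'n"
  assumes G: "L2_tendsto (lebesgue_on \<Omega>) G G'"
    and \<eta>: "\<eta> \<in> borel_measurable (lebesgue_on \<Omega>)" "\<And>x. x \<in> \<Omega> \<Longrightarrow> \<bar>\<eta> x\<bar> \<le> 1"
  shows "(\<lambda>k. LINT x|lebesgue_on \<Omega>. \<eta> x * ((C *v G k x) \<bullet> G k x)) \<longlonglongrightarrow>
    (LINT x|lebesgue_on \<Omega>. \<eta> x * ((C *v G' x) \<bullet> G' x))"
proof -
  let ?M = "lebesgue_on \<Omega>"
  note G1 = L2_tendstoD[OF G]
  have le: "norm (\<eta> x *\<^sub>R (C *v v)) \<le> onorm ((*v) C) * norm v" if "x \<in> \<Omega>" for x v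
  proof -
    have "norm (\<eta> x *\<^sub>R (C *v v)) \<le> 1 * norm (C *v v)"
      unfolding norm_scaleR by (rule mult_right_mono) (use \<eta>(2)[OF that] in simp_all)
    also have "\<dots> \<le> onorm ((*v) C) * norm v"
      using onorm[OF matrix_vector_mul_bounded_linear, of C v] by simp
    finally show ?thesis .
  qed
  have sq: "square_integrable ?M (\<lambda>x. \<eta> x *\<^sub>R (C *v F x))" if F: "square_integrable ?M F" for F
  proof (rule square_integrable_bound[OF F])
    show "(\<lambda>x. \<eta> x *\<^sub>R (C *v F x)) \<in> borel_measurable ?M"
      using \<eta>(1) borel_measurable_matrix_vector_mult[OF square_integrable_measurable[OF F]] by measurable
    show "AE x in ?M. norm (\<eta> x *\<^sub>R (C *v F x)) \<le> onorm ((*v) C) * norm (F x)"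
      by (rule AE_I2) (simp only: le space_restrict_space space_completion space_lborel space_borel Int_UNIV_right)
  qed
  have "L2_tendsto ?M (\<lambda>k x. \<eta> x *\<^sub>R (C *v G k x)) (\<lambda>x. \<eta> x *\<^sub>R (C *v G' x))"
  proof (rule L2_tendsto_bound[OF G sq[OF G1(1)] sq[OF G1(2)], where C="onorm ((*v) C)"])
    fix k x assume "x \<in> space ?M"
    then have "x \<in> \<Omega>" by simp
    from le[OF this, of "G k x - G' x"]
    show "norm (\<eta> x *\<^sub>R (C *v G k x) - \<eta> x *\<^sub>R (C *v G' x)) \<le> onorm ((*v) C) * norm (G k x - G' x)"
      by (simp only: matrix_vector_mult_diff_distrib scaleR_diff_right)
  qed
  from L2_tendsto_inner[OF this G] show ?thesis by (simp only: inner_scaleR_left)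
qed

context mixture_problem
begin

text \<open>For \<open>\<rho> k = \<sigma> + e k (\<tau> - \<sigma>)\<close> choose normalized test functions \<open>\<phi> k\<close> whose energy for \<open>\<rho> k\<close> is less
than \<open>\<lambda>(\<sigma>) + (e k)\<^sup>2\<close>. That energy equals the energy for \<open>\<sigma>\<close>, which is at least \<open>\<lambda>(\<sigma>)\<close>, plus \<open>e k\<close>
times the first variation \<open>b\<close> at \<open>\<phi> k\<close>. Hence \<open>b\<close> is at most \<open>e k\<close>, and convergence of the gradients
carries this over to the eigenfunction. The sign of the limit is irrelevant, as \<open>b\<close> is quadratic.\<close>

theorem optimal_variational_inequality:
  assumes opt: "optimal_control \<Omega> A\<^sub>0 A\<^sub>1 \<alpha> \<beta> \<sigma>" and eig: "principal_eigenfunction \<Omega> (mixture A\<^sub>0 A\<^sub>1 \<sigma>) y"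
    and \<tau>: "\<tau> \<in> controls \<Omega> \<alpha> \<beta>"
  shows "(LINT x|M. (\<tau> x - \<sigma> x) * contrast (weak_gradient \<Omega> y) x) \<le> 0"
proof (rule ccontr)
  assume contra: "\<not> (LINT x|M. (\<tau> x - \<sigma> x) * contrast (weak_gradient \<Omega> y) x) \<le> 0"
  have \<sigma>: "\<sigma> \<in> controls \<Omega> \<alpha> \<beta>" and level: "level \<sigma> = (SUP \<tau>\<in>controls \<Omega> \<alpha> \<beta>. level \<tau>)"
    using opt by (simp_all add: optimal_control_def level_def)
  have fr: "fraction \<sigma>" "fraction \<tau>" using \<sigma> \<tau> by (simp_all add: controls_iff)
  interpret E: elliptic_ground_level \<Omega> "mixture A\<^sub>0 A\<^sub>1 \<sigma>" \<mu>\<^sub>0 \<Lambda> "level \<sigma>" by (rule mixture_ground_level[OF fr(1)])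
  let ?Y = "weak_gradient \<Omega> y"
  have yW: "y \<in> W12_0 \<Omega>" and ypos: "AE x in M. 0 < y x" and y1: "sqnorm M y = 1"
    and weak: "dirichlet_form \<Omega> (mixture A\<^sub>0 A\<^sub>1 \<sigma>) y y = level \<sigma> * (LINT x|M. y x * y x)"
    using eig by (simp_all add: principal_eigenfunction_def sqnorm_def level_def)
  have enY: "E.energy ?Y ?Y = level \<sigma>"
    using weak y1 by (simp add: dirichlet_form_energy[OF fr(1)] sqnorm_def power2_eq_square)
  have comp: "y \<in> competitors"
    using yW y1 sqnorm_pos_iff[OF W12_0_square_integrable(1)[OF yW]] by (simp add: competitors_def)
  then have ne: "competitors \<noteq> {}" by blast
  define b where "b G = (LINT x|M. (\<tau> x - \<sigma> x) * contrast G x)" for G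
  have bY: "0 < b ?Y" using contra by (simp add: b_def)
  have \<eta>: "(\<lambda>x. \<tau> x - \<sigma> x) \<in> borel_measurable M" "\<bar>\<tau> x - \<sigma> x\<bar> \<le> 1" if "x \<in> \<Omega>" for x
  proof -
    show "(\<lambda>x. \<tau> x - \<sigma> x) \<in> borel_measurable M"
    using fr by (auto simp: fraction_def intro: borel_measurable_diff)
    have "0 \<le> \<sigma> x" "\<sigma> x \<le> 1" "0 \<le> \<tau> x" "\<tau> x \<le> 1" using fr that by (auto simp: fraction_def)
    then show "\<bar>\<tau> x - \<sigma> x\<bar> \<le> 1" by linarith
  qed
  have \<eta>m: "(\<lambda>x. \<tau> x - \<sigma> x) \<in> borel_measurable M"
    using fr by (auto simp: fraction_def intro: borel_measurable_diff)
  define e where "e k = inverse (real (Suc k))" for k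
  have e: "0 < e k" "e k \<le> 1" for k by (simp_all add: e_def field_simps)
  have e0: "e \<longlonglongrightarrow> 0" unfolding e_def by (rule LIMSEQ_inverse_real_of_nat)
  define \<rho> where "\<rho> k x = (1 - e k) * \<sigma> x + e k * \<tau> x" for k x
  have \<rho>: "\<rho> k \<in> controls \<Omega> \<alpha> \<beta>" for k
    unfolding \<rho>_def[abs_def] using e(1)[of k] e(2)[of k] by (intro controls_convex \<sigma> \<tau>) auto
  have fr\<rho>: "fraction (\<rho> k)" for k using \<rho>[of k] by (simp add: controls_iff)
  have level\<rho>: "level (\<rho> k) \<le> level \<sigma>" for k
    unfolding level by (rule cSUP_upper[OF \<rho> level_bdd_above[OF ne]])
  have ex: "\<exists>\<phi>. \<phi> \<in> test_functions \<Omega> \<and> sqnorm M \<phi> = 1 \<and>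
      elliptic_coefficient.energy \<Omega> (mixture A\<^sub>0 A\<^sub>1 (\<rho> k)) (grad \<phi>) (grad \<phi>) < level \<sigma> + (e k)\<^sup>2" for k
  proof -
    have "0 < (e k)\<^sup>2" using e(1)[of k] by simp
    then have "level (\<rho> k) < level \<sigma> + (e k)\<^sup>2" using level\<rho>[of k] by linarith
    from near_minimizing_test_function[OF fr\<rho> ne this] show ?thesis by blast
  qed
  define \<phi> where "\<phi> k = (SOME \<phi>. \<phi> \<in> test_functions \<Omega> \<and> sqnorm M \<phi> = 1 \<and>
      elliptic_coefficient.energy \<Omega> (mixture A\<^sub>0 A\<^sub>1 (\<rho> k)) (grad \<phi>) (grad \<phi>) < level \<sigma> + (e k)\<^sup>2)" for k
  note \<phi>' = someI_ex[OF ex, folded \<phi>_def]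
  have \<phi>: "\<phi> k \<in> test_functions \<Omega>" "sqnorm M (\<phi> k) = 1"
    "elliptic_coefficient.energy \<Omega> (mixture A\<^sub>0 A\<^sub>1 (\<rho> k)) (grad (\<phi> k)) (grad (\<phi> k)) < level \<sigma> + (e k)\<^sup>2" for k
    using \<phi>'[of k] by blast+
  note sG = E.sq_test(2)[OF \<phi>(1)]
  have split: "elliptic_coefficient.energy \<Omega> (mixture A\<^sub>0 A\<^sub>1 (\<rho> k)) (grad (\<phi> k)) (grad (\<phi> k)) =
      E.energy (grad (\<phi> k)) (grad (\<phi> k)) + e k * b (grad (\<phi> k))" for k
  proof -
    interpret R: elliptic_coefficient \<Omega> "mixture A\<^sub>0 A\<^sub>1 (\<rho> k)" \<mu>\<^sub>0 \<Lambda> by (rule mixture_elliptic_coefficient[OF fr\<rho>])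
    have i1: "integrable M (\<lambda>x. (mixture A\<^sub>0 A\<^sub>1 \<sigma> x *v grad (\<phi> k) x) \<bullet> grad (\<phi> k) x)"
      by (rule E.energy_integrable[OF sG sG])
    have i2: "integrable M (\<lambda>x. (\<tau> x - \<sigma> x) * contrast (grad (\<phi> k)) x)"
      by (rule contrast_integrable[OF sG \<eta>m \<eta>(2)])
    have "R.energy (grad (\<phi> k)) (grad (\<phi> k)) =
        (LINT x|M. (mixture A\<^sub>0 A\<^sub>1 \<sigma> x *v grad (\<phi> k) x) \<bullet> grad (\<phi> k) x + e k * ((\<tau> x - \<sigma> x) * contrast (grad (\<phi> k)) x))"
      unfolding R.energy_def
      by (rule Bochner_Integration.integral_cong)
        (simp_all add: mixture_mult_vec \<rho>_def contrast_def inner_add_left algebra_simps)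
    also have "\<dots> = E.energy (grad (\<phi> k)) (grad (\<phi> k)) + e k * b (grad (\<phi> k))"
      using i1 i2 by (simp add: E.energy_def b_def)
    finally show ?thesis .
  qed
  have gl: "level \<sigma> \<le> E.energy (grad (\<phi> k)) (grad (\<phi> k))" for k
    using E.ground_level[OF \<phi>(1)[of k]] \<phi>(2)[of k] by simp
  have b_le: "b (grad (\<phi> k)) \<le> e k" for k
  proof -
    have "e k * b (grad (\<phi> k)) < (e k)\<^sup>2" using gl[of k] \<phi>(3)[of k] split[of k] by linarith
    then show ?thesis using e(1)[of k] by (simp add: power2_eq_square)
  qed
  define c where "c = onorm ((*v) (A\<^sub>1 - A\<^sub>0))"
  have gradb: "sqnorm M (grad (\<phi> k)) \<le> (level \<sigma> + 1) / \<mu>\<^sub>0" for k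
  proof -
    interpret R: elliptic_coefficient \<Omega> "mixture A\<^sub>0 A\<^sub>1 (\<rho> k)" \<mu>\<^sub>0 \<Lambda> by (rule mixture_elliptic_coefficient[OF fr\<rho>])
    have "(e k)\<^sup>2 \<le> 1" using e[of k] by (simp add: power_le_one)
    then have "\<mu>\<^sub>0 * sqnorm M (grad (\<phi> k)) \<le> level \<sigma> + 1"
      using R.energy_ge[OF sG[of k]] \<phi>(3)[of k] by linarith
    then show ?thesis using \<mu>\<^sub>0_pos by (simp add: field_simps)
  qed
  have b_bound: "\<bar>b (grad (\<phi> k))\<bar> \<le> c * ((level \<sigma> + 1) / \<mu>\<^sub>0)" for k
  proof -
    have i2: "integrable M (\<lambda>x. (\<tau> x - \<sigma> x) * contrast (grad (\<phi> k)) x)"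
      by (rule contrast_integrable[OF sG \<eta>m \<eta>(2)])
    have "\<bar>b (grad (\<phi> k))\<bar> \<le> (LINT x|M. \<bar>(\<tau> x - \<sigma> x) * contrast (grad (\<phi> k)) x\<bar>)"
      unfolding b_def by (rule integral_abs_bound)
    also have "\<dots> \<le> (LINT x|M. c * (norm (grad (\<phi> k) x))\<^sup>2)"
    proof (intro integral_mono integrable_abs i2 integrable_mult_right square_integrable_sq sG)
      fix x assume "x \<in> space M"
      then have x: "x \<in> \<Omega>" by simp
      let ?g = "grad (\<phi> k) x"
      have "\<bar>contrast (grad (\<phi> k)) x\<bar> \<le> norm ((A\<^sub>1 - A\<^sub>0) *v ?g) * norm ?g"
        unfolding contrast_def by (rule Cauchy_Schwarz_ineq2)
      also have "\<dots> \<le> c * norm ?g * norm ?g"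
        unfolding c_def by (rule mult_right_mono[OF onorm[OF matrix_vector_mul_bounded_linear]]) simp
      finally have "\<bar>\<tau> x - \<sigma> x\<bar> * \<bar>contrast (grad (\<phi> k)) x\<bar> \<le> 1 * (c * norm ?g * norm ?g)"
        using \<eta>(2)[OF x] by (intro mult_mono) auto
      then show "\<bar>(\<tau> x - \<sigma> x) * contrast (grad (\<phi> k)) x\<bar> \<le> c * (norm ?g)\<^sup>2"
        by (simp add: abs_mult power2_eq_square mult.assoc)
    qed
    also have "\<dots> = c * sqnorm M (grad (\<phi> k))" by (simp add: sqnorm_def)
    also have "\<dots> \<le> c * ((level \<sigma> + 1) / \<mu>\<^sub>0)"
      unfolding c_def by (rule mult_left_mono[OF gradb]) (intro onorm_pos_le matrix_vector_mul_bounded_linear)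
    finally show ?thesis .
  qed
  have B0: "(\<lambda>k. E.B (\<phi> k) (\<phi> k)) \<longlonglongrightarrow> 0"
  proof (rule tendsto_sandwich[OF always_eventually always_eventually tendsto_const])
    show "\<forall>k. 0 \<le> E.B (\<phi> k) (\<phi> k)" using E.B_nonneg[OF \<phi>(1)] by blast
    show "\<forall>k. E.B (\<phi> k) (\<phi> k) \<le> (e k)\<^sup>2 + e k * (c * ((level \<sigma> + 1) / \<mu>\<^sub>0))"
    proof
      fix k
      have "e k * (- b (grad (\<phi> k))) \<le> e k * (c * ((level \<sigma> + 1) / \<mu>\<^sub>0))"
        using b_bound[of k] e(1)[of k] by (intro mult_left_mono) auto
      then show "E.B (\<phi> k) (\<phi> k) \<le> (e k)\<^sup>2 + e k * (c * ((level \<sigma> + 1) / \<mu>\<^sub>0))"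
        using split[of k] \<phi>(3)[of k] by (simp add: E.B_diag \<phi>(2))
    qed
    have "(\<lambda>k. (e k)\<^sup>2 + e k * (c * ((level \<sigma> + 1) / \<mu>\<^sub>0))) \<longlonglongrightarrow> 0\<^sup>2 + 0 * (c * ((level \<sigma> + 1) / \<mu>\<^sub>0))"
      by (intro tendsto_intros e0)
    then show "(\<lambda>k. (e k)\<^sup>2 + e k * (c * ((level \<sigma> + 1) / \<mu>\<^sub>0))) \<longlonglongrightarrow> 0" by simp
  qed
  obtain \<psi> where \<psi>: "\<And>k. \<psi> k \<in> test_functions \<Omega>" "L2_tendsto M \<psi> y" "L2_tendsto M (\<lambda>k. grad (\<psi> k)) ?Y"
    using W12_0_approx[OF yW] by blast
  obtain r d where r: "strict_mono r" "d\<^sup>2 = (1 :: real)" "L2_tendsto M (\<lambda>k. grad (\<phi> (r k))) (\<lambda>x. d *\<^sub>R ?Y x)"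
    using E.minimizing_sequence_gradient_converges[OF connected_\<Omega> nonempty_\<Omega> \<psi> y1 enY ypos \<phi>(1,2) B0] by blast
  have "(\<lambda>k. b (grad (\<phi> (r k)))) \<longlonglongrightarrow> b (\<lambda>x. d *\<^sub>R ?Y x)"
    unfolding b_def contrast_def by (rule quadratic_form_tendsto[OF r(3) \<eta>m \<eta>(2)])
  moreover have "b (\<lambda>x. d *\<^sub>R ?Y x) = d\<^sup>2 * b ?Y"
    unfolding b_def contrast_def by (simp add: matrix_vector_mult_scaleR power2_eq_square mult.left_commute mult.assoc)
  ultimately have lim: "(\<lambda>k. b (grad (\<phi> (r k)))) \<longlonglongrightarrow> b ?Y" using r(2) by simp
  have "(\<lambda>k. e (r k)) \<longlonglongrightarrow> 0" using LIMSEQ_subseq_LIMSEQ[OF e0 r(1)] by (simp add: o_def)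
  from LIMSEQ_le[OF lim this] have "b ?Y \<le> 0" using b_le by blast
  then show False using bY by simp
qed

end

section \<open>From the variational inequality to pointwise conditions\<close>

text \<open>The situation left by the first variation: \<open>\<sigma>\<close> maximizes the integral of \<open>\<tau> q\<close> among all
\<open>\<tau>\<close> with values in the unit interval and total mass between \<open>a\<close> and \<open>b\<close>.\<close>

locale bathtub = finite_measure M for M :: "'a measure" +
  fixes \<sigma> q :: "'a \<Rightarrow> real" and a b :: real
  assumes \<sigma>_meas: "\<sigma> \<in> borel_measurable M" and \<sigma>_range: "\<And>x. x \<in> space M \<Longrightarrow> 0 \<le> \<sigma> x \<and> \<sigma> x \<le> 1"
    and q_int: "integrable M q"
    and \<sigma>_ge: "a \<le> (LINT x|M. \<sigma> x)" and \<sigma>_le: "(LINT x|M. \<sigma> x) \<le> b"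
    and variational: "\<And>\<tau>. \<tau> \<in> borel_measurable M \<Longrightarrow> (\<And>x. x \<in> space M \<Longrightarrow> 0 \<le> \<tau> x \<and> \<tau> x \<le> 1) \<Longrightarrow>
      a \<le> (LINT x|M. \<tau> x) \<Longrightarrow> (LINT x|M. \<tau> x) \<le> b \<Longrightarrow> (LINT x|M. (\<tau> x - \<sigma> x) * q x) \<le> 0"
begin

lemma \<sigma>_integrable: "integrable M \<sigma>"
  by (rule integrable_const_bound[of _ 1]) (use \<sigma>_meas \<sigma>_range in auto)

text \<open>An admissible change \<open>\<eta>\<close> of the control cannot increase the integral of \<open>\<sigma> q\<close>. If nevertheless its
gain density, measured relative to a level \<open>c\<close> of \<open>q\<close>, is nonnegative everywhere, then it vanishes.
Levels other than zero are allowed when \<open>\<eta>\<close> preserves the mass.\<close>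

lemma no_gain:
  assumes \<eta>: "integrable M \<eta>" and bd: "\<And>x. x \<in> space M \<Longrightarrow> \<bar>\<eta> x\<bar> \<le> B"
    and range: "\<And>x. x \<in> space M \<Longrightarrow> 0 \<le> \<sigma> x + \<eta> x \<and> \<sigma> x + \<eta> x \<le> 1"
    and mass: "a \<le> (LINT x|M. \<sigma> x) + (LINT x|M. \<eta> x)" "(LINT x|M. \<sigma> x) + (LINT x|M. \<eta> x) \<le> b"
    and c: "0 \<le> c * (LINT x|M. \<eta> x)"
    and nonneg: "\<And>x. x \<in> space M \<Longrightarrow> 0 \<le> \<eta> x * (q x - c)"
  shows "AE x in M. \<eta> x * (q x - c) = 0"
proof -
  have int: "integrable M (\<lambda>x. \<eta> x * q x)"
  proof (rule Bochner_Integration.integrable_bound[OF integrable_mult_right[OF q_int, of B]])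
    show "(\<lambda>x. \<eta> x * q x) \<in> borel_measurable M" using \<eta> q_int by measurable
    show "AE x in M. norm (\<eta> x * q x) \<le> norm (B * q x)"
    proof (rule AE_I2)
      fix x assume "x \<in> space M"
      then have "\<bar>\<eta> x\<bar> \<le> \<bar>B\<bar>" using bd[of x] by linarith
      then show "norm (\<eta> x * q x) \<le> norm (B * q x)" by (simp add: abs_mult mult_right_mono)
    qed
  qed
  have "(LINT x|M. ((\<sigma> x + \<eta> x) - \<sigma> x) * q x) \<le> 0"
    using \<sigma>_integrable \<eta> mass range by (intro variational) auto
  then have le: "(LINT x|M. \<eta> x * q x) \<le> 0" by simp
  have int': "integrable M (\<lambda>x. \<eta> x * (q x - c))"
    using int \<eta> by (simp add: right_diff_distrib)
  have "(LINT x|M. \<eta> x * (q x - c)) = (LINT x|M. \<eta> x * q x) - c * (LINT x|M. \<eta> x)"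
    using int \<eta> by (simp add: right_diff_distrib mult.commute)
  then have "(LINT x|M. \<eta> x * (q x - c)) \<le> 0" using le c by linarith
  moreover have "0 \<le> (LINT x|M. \<eta> x * (q x - c))"
    using nonneg by (intro integral_nonneg_AE) auto
  ultimately have "(LINT x|M. \<eta> x * (q x - c)) = 0" by simp
  then show ?thesis
    using integral_nonneg_eq_0_iff_AE[OF int'] nonneg by auto
qed

text \<open>Exhausts the set where \<open>s < 1\<close> by sets on which a fixed positive increase is admissible.\<close>

lemma AE_all_Suc:
  assumes "\<And>n. AE x in M. P x \<longrightarrow> s x + inverse (real (Suc n)) \<le> 1 \<longrightarrow> Q x"
  shows "AE x in M. P x \<longrightarrow> s x < 1 \<longrightarrow> Q x"
proof -
  have "AE x in M. \<forall>n. P x \<longrightarrow> s x + inverse (real (Suc n)) \<le> 1 \<longrightarrow> Q x"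
    using assms by (subst AE_all_countable) blast
  then show ?thesis
  proof (rule AE_mp, intro AE_I2 impI)
    fix x assume x: "\<forall>n. P x \<longrightarrow> s x + inverse (real (Suc n)) \<le> 1 \<longrightarrow> Q x" "P x" "s x < 1"
    then obtain n where "inverse (real (Suc n)) < 1 - s x" using reals_Archimedean[of "1 - s x"] by auto
    then have "s x + inverse (real (Suc n)) \<le> 1" by linarith
    then show "Q x" using x(1)[rule_format, of n] x(2) by blast
  qed
qed

text \<open>Otherwise volume could be moved with profit from the set where \<open>\<sigma> > 0\<close> and \<open>q < c\<close> to the set where
\<open>\<sigma> < 1\<close> and \<open>q > c\<close>. Amounts that are inversely proportional to the measures of the two sets
preserve the mass.\<close>

lemma swap:
  "(AE x in M. \<sigma> x < 1 \<longrightarrow> q x \<le> c) \<or> (AE x in M. 0 < \<sigma> x \<longrightarrow> c \<le> q x)"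
proof (rule disjCI)
  note [measurable] = \<sigma>_meas borel_measurable_integrable[OF q_int]
  assume nF: "\<not> (AE x in M. 0 < \<sigma> x \<longrightarrow> c \<le> q x)"
  have "\<exists>m. \<not> (AE x in M. True \<longrightarrow> (1 - \<sigma> x) + inverse (real (Suc m)) \<le> 1 \<longrightarrow> c \<le> q x)"
  proof (rule ccontr)
    assume "\<nexists>m. \<not> (AE x in M. True \<longrightarrow> (1 - \<sigma> x) + inverse (real (Suc m)) \<le> 1 \<longrightarrow> c \<le> q x)"
    then have "AE x in M. True \<longrightarrow> 1 - \<sigma> x < 1 \<longrightarrow> c \<le> q x"
      by (intro AE_all_Suc) blast
    with nF show False by simp
  qed
  then obtain m where m: "\<not> (AE x in M. inverse (real (Suc m)) \<le> \<sigma> x \<longrightarrow> c \<le> q x)"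
    by (auto simp del: of_nat_Suc)
  define F where "F = {x \<in> space M. inverse (real (Suc m)) \<le> \<sigma> x \<and> q x < c}"
  have [measurable]: "F \<in> sets M" unfolding F_def by measurable
  have Fpos: "0 < measure M F"
  proof (rule ccontr)
    assume "\<not> 0 < measure M F"
    then have "F \<in> null_sets M" by (auto simp: emeasure_eq_measure zero_less_measure_iff)
    then have "AE x in M. x \<notin> F" by (rule AE_not_in)
    then have "AE x in M. inverse (real (Suc m)) \<le> \<sigma> x \<longrightarrow> c \<le> q x"
      by (rule AE_mp) (auto simp: F_def not_less simp del: of_nat_Suc)
    with m show False by contradiction
  qed
  have "AE x in M. True \<longrightarrow> \<sigma> x < 1 \<longrightarrow> q x \<le> c"
  proof (rule AE_all_Suc)
    fix n
    define E where "E = {x \<in> space M. \<sigma> x + inverse (real (Suc n)) \<le> 1 \<and> c < q x}"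
    have [measurable]: "E \<in> sets M" unfolding E_def by measurable
    define \<delta> where "\<delta> = min (inverse (real (Suc m))) (inverse (real (Suc n)))"
    have \<delta>: "0 < \<delta>" by (simp add: \<delta>_def)
    define t where "t = \<delta> / (measure M (space M) + 1)"
    have sp: "0 < measure M (space M) + 1" by (simp add: add_nonneg_pos)
    have t: "0 < t" using \<delta> sp by (simp add: t_def)
    have small: "0 \<le> t * measure M S \<and> t * measure M S \<le> \<delta>" if "S \<in> sets M" for S
    proof
      show "0 \<le> t * measure M S" using t by simp
      have "measure M S \<le> measure M (space M) + 1"
        using bounded_measure[of S] by simp
      then have "t * measure M S \<le> t * (measure M (space M) + 1)" using t by (intro mult_left_mono) auto
      also have "\<dots> = \<delta>" using sp by (simp add: t_def)
      finally show "t * measure M S \<le> \<delta>" .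
    qed
    define \<eta> where "\<eta> x = (t * measure M F) * indicator E x - (t * measure M E) * indicator F x" for x
    have disj: "x \<notin> F" if "x \<in> E" for x using that by (auto simp: E_def F_def)
    have \<eta>int: "integrable M \<eta>" unfolding \<eta>_def[abs_def]
      by (intro Bochner_Integration.integrable_diff integrable_mult_right integrable_real_indicator) (auto simp: emeasure_eq_measure)
    have \<eta>0: "(LINT x|M. \<eta> x) = 0"
    proof -
      have "(LINT x|M. \<eta> x) = (LINT x|M. (t * measure M F) * indicator E x) - (LINT x|M. (t * measure M E) * indicator F x)"
        unfolding \<eta>_def
        by (intro Bochner_Integration.integral_diff integrable_mult_right integrable_real_indicator) (auto simp: emeasure_eq_measure)
      then show ?thesis by (simp add: mult.commute mult.left_commute)
    qed
    have "AE x in M. \<eta> x * (q x - c) = 0"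
    proof (rule no_gain[OF \<eta>int, where B="2 * \<delta>"])
      fix x assume x: "x \<in> space M"
      show "\<bar>\<eta> x\<bar> \<le> 2 * \<delta>"
        using small[of E] small[of F] \<delta> by (auto simp: \<eta>_def indicator_def abs_le_iff)
      show "0 \<le> \<sigma> x + \<eta> x \<and> \<sigma> x + \<eta> x \<le> 1"
      proof -
        consider "x \<in> E" "x \<notin> F" | "x \<notin> E" "x \<in> F" | "x \<notin> E" "x \<notin> F" using disj by blast
        then show ?thesis
        proof cases
          case 1
          then have "\<sigma> x + inverse (real (Suc n)) \<le> 1" by (simp add: E_def)
          then show ?thesis using 1 small[of F] \<sigma>_range[OF x] by (simp add: \<eta>_def \<delta>_def del: of_nat_Suc)
        next
          case 2
          then have "inverse (real (Suc m)) \<le> \<sigma> x" by (simp add: F_def)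
          then show ?thesis using 2 small[of E] \<sigma>_range[OF x] by (simp add: \<eta>_def \<delta>_def del: of_nat_Suc)
        qed (use \<sigma>_range[OF x] in \<open>simp add: \<eta>_def\<close>)
      qed
      show "0 \<le> \<eta> x * (q x - c)"
      proof -
        consider "x \<in> E" "x \<notin> F" | "x \<notin> E" "x \<in> F" | "x \<notin> E" "x \<notin> F" using disj by blast
        then show ?thesis
        proof cases
          case 1
          then have "c < q x" by (simp add: E_def)
          then show ?thesis using 1 t by (simp add: \<eta>_def)
        next
          case 2
          then have "q x < c" by (simp add: F_def)
          then show ?thesis using 2 t by (simp add: \<eta>_def mult_nonneg_nonpos)
        qed (simp add: \<eta>_def)
      qed
    qed (use \<sigma>_ge \<sigma>_le \<eta>0 in simp_all)
    then show "AE x in M. True \<longrightarrow> \<sigma> x + inverse (real (Suc n)) \<le> 1 \<longrightarrow> q x \<le> c"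
    proof (rule AE_mp, intro AE_I2 impI)
      fix x assume x: "x \<in> space M" "\<eta> x * (q x - c) = 0" "\<sigma> x + inverse (real (Suc n)) \<le> 1"
      show "q x \<le> c"
      proof (rule ccontr)
        assume "\<not> q x \<le> c"
        then have "x \<in> E" "c < q x" using x by (auto simp: E_def)
        then show False using x(2) disj t Fpos by (simp add: \<eta>_def)
      qed
    qed
  qed
  then show "AE x in M. \<sigma> x < 1 \<longrightarrow> q x \<le> c" by simp
qed

text \<open>The constant is the supremum of the levels \<open>c\<close> with \<open>q \<ge> c\<close> wherever \<open>\<sigma> > 0\<close>; above it, the other
alternative of the exchange argument gives \<open>q \<le> c\<close> wherever \<open>\<sigma> < 1\<close>. Both alternatives constrain
\<open>q\<close> on the set where \<open>0 < \<sigma> < 1\<close>, and since this set is not null, the supremum is finite.\<close>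

lemma multiplier_exists:
  assumes pos: "\<not> (AE x in M. \<not> (0 < \<sigma> x \<and> \<sigma> x < 1))"
  shows "\<exists>C. (AE x in M. \<sigma> x < 1 \<longrightarrow> q x \<le> C) \<and> (AE x in M. 0 < \<sigma> x \<longrightarrow> C \<le> q x)"
proof -
  define L where "L = {c. AE x in M. 0 < \<sigma> x \<longrightarrow> c \<le> q x}"
  have notL: "AE x in M. \<sigma> x < 1 \<longrightarrow> q x \<le> c" if "c \<notin> L" for c
    using swap[of c] that by (simp add: L_def)
  have down: "d \<in> L" if "c \<in> L" "d \<le> c" for c d
  proof -
    have "AE x in M. 0 < \<sigma> x \<longrightarrow> c \<le> q x" using that(1) by (simp add: L_def)
    then have "AE x in M. 0 < \<sigma> x \<longrightarrow> d \<le> q x" by (rule AE_mp) (use that(2) in auto)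
    then show ?thesis by (simp add: L_def)
  qed
  have "\<exists>n. - real n \<in> L"
  proof (rule ccontr)
    assume "\<nexists>n. - real n \<in> L"
    then have "AE x in M. \<forall>n. \<sigma> x < 1 \<longrightarrow> q x \<le> - real n" by (subst AE_all_countable) (simp add: notL)
    then have "AE x in M. \<not> (0 < \<sigma> x \<and> \<sigma> x < 1)"
    proof (rule AE_mp, intro AE_I2 impI notI)
      fix x assume x: "\<forall>n. \<sigma> x < 1 \<longrightarrow> q x \<le> - real n" "0 < \<sigma> x \<and> \<sigma> x < 1"
      obtain n where "- q x < real n" using reals_Archimedean2 by blast
      then show False using x(1)[rule_format, of n] x(2) by simp
    qed
    with pos show False by contradiction
  qed
  then have Lne: "L \<noteq> {}" by blast
  have "\<exists>n. real n \<notin> L"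
  proof (rule ccontr)
    assume "\<nexists>n. real n \<notin> L"
    then have "AE x in M. \<forall>n. 0 < \<sigma> x \<longrightarrow> real n \<le> q x" by (subst AE_all_countable) (simp add: L_def)
    then have "AE x in M. \<not> (0 < \<sigma> x \<and> \<sigma> x < 1)"
    proof (rule AE_mp, intro AE_I2 impI notI)
      fix x assume x: "\<forall>n. 0 < \<sigma> x \<longrightarrow> real n \<le> q x" "0 < \<sigma> x \<and> \<sigma> x < 1"
      obtain n where "q x < real n" using reals_Archimedean2 by blast
      then show False using x(1)[rule_format, of n] x(2) by simp
    qed
    with pos show False by contradiction
  qed
  then obtain n where n: "real n \<notin> L" by blast
  have bdd: "bdd_above L"
  proof (rule bdd_aboveI[of _ "real n"])
    fix d assume "d \<in> L"
    then show "d \<le> real n" using down[of d "real n"] n by linarith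
  qed
  define C where "C = Sup L"
  have "C - inverse (real (Suc m)) \<in> L" for m
  proof -
    have "C - inverse (real (Suc m)) < Sup L" by (simp add: C_def del: of_nat_Suc)
    then obtain d where "d \<in> L" "C - inverse (real (Suc m)) < d"
      unfolding less_cSup_iff[OF Lne bdd] by (elim bexE)
    then show ?thesis by (rule down[OF _ less_imp_le])
  qed
  then have 1: "AE x in M. \<forall>m. 0 < \<sigma> x \<longrightarrow> C - inverse (real (Suc m)) \<le> q x"
    by (subst AE_all_countable) (simp add: L_def del: of_nat_Suc)
  have "C + inverse (real (Suc m)) \<notin> L" for m
  proof
    assume "C + inverse (real (Suc m)) \<in> L"
    then have "C + inverse (real (Suc m)) \<le> C" unfolding C_def by (rule cSup_upper[OF _ bdd])
    then show False by (simp del: of_nat_Suc)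
  qed
  then have 2: "AE x in M. \<forall>m. \<sigma> x < 1 \<longrightarrow> q x \<le> C + inverse (real (Suc m))"
    by (subst AE_all_countable) (simp add: notL del: of_nat_Suc)
  have l1: "(\<lambda>m. C - inverse (real (Suc m))) \<longlonglongrightarrow> C - 0" and l2: "(\<lambda>m. C + inverse (real (Suc m))) \<longlonglongrightarrow> C + 0"
    by (intro tendsto_intros LIMSEQ_inverse_real_of_nat)+
  have "AE x in M. 0 < \<sigma> x \<longrightarrow> C \<le> q x"
    using 1
  proof (rule AE_mp, intro AE_I2 impI)
    fix x assume "\<forall>m. 0 < \<sigma> x \<longrightarrow> C - inverse (real (Suc m)) \<le> q x" "0 < \<sigma> x"
    then have "C - 0 \<le> q x" by (intro LIMSEQ_le_const2[OF l1]) blast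
    then show "C \<le> q x" by simp
  qed
  moreover have "AE x in M. \<sigma> x < 1 \<longrightarrow> q x \<le> C"
    using 2
  proof (rule AE_mp, intro AE_I2 impI)
    fix x assume "\<forall>m. \<sigma> x < 1 \<longrightarrow> q x \<le> C + inverse (real (Suc m))" "\<sigma> x < 1"
    then have "q x \<le> C + 0" by (intro LIMSEQ_le_const[OF l2]) blast
    then show "q x \<le> C" by simp
  qed
  ultimately show ?thesis by blast
qed

text \<open>If the mass may grow, adding volume where \<open>q > 0\<close> is admissible and must not be profitable.\<close>

lemma nonpos_where_increasable:
  assumes "(LINT x|M. \<sigma> x) < b"
  shows "AE x in M. \<sigma> x < 1 \<longrightarrow> q x \<le> 0"
proof -
  note [measurable] = \<sigma>_meas borel_measurable_integrable[OF q_int]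
  have "AE x in M. True \<longrightarrow> \<sigma> x < 1 \<longrightarrow> q x \<le> 0"
  proof (rule AE_all_Suc)
    fix n
    define E where "E = {x \<in> space M. \<sigma> x + inverse (real (Suc n)) \<le> 1 \<and> 0 < q x}"
    have [measurable]: "E \<in> sets M" unfolding E_def by measurable
    define t where "t = min (inverse (real (Suc n))) ((b - (LINT x|M. \<sigma> x)) / (measure M (space M) + 1))"
    have sp: "0 < measure M (space M) + 1" by (simp add: add_nonneg_pos)
    have t: "0 < t" "t \<le> inverse (real (Suc n))" "t \<le> (b - (LINT x|M. \<sigma> x)) / (measure M (space M) + 1)"
      using assms sp by (auto simp: t_def)
    have \<eta>int: "integrable M (\<lambda>x. t * indicator E x)"
      by (intro integrable_mult_right integrable_real_indicator) (auto simp: emeasure_eq_measure)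
    have I: "(LINT x|M. t * indicator E x) = t * measure M E" by simp
    have "t * measure M E \<le> t * (measure M (space M) + 1)"
      using t(1) bounded_measure[of E] by (intro mult_left_mono) auto
    also have "\<dots> \<le> b - (LINT x|M. \<sigma> x)" using t(3) sp by (simp add: pos_le_divide_eq)
    finally have I2: "t * measure M E \<le> b - (LINT x|M. \<sigma> x)" .
    have I1: "0 \<le> t * measure M E" using t(1) by simp
    have "AE x in M. (t * indicator E x) * (q x - 0) = 0"
    proof (rule no_gain[OF \<eta>int, where B=t])
      fix x assume x: "x \<in> space M"
      show "\<bar>t * indicator E x\<bar> \<le> t" using t(1) by (simp add: indicator_def)
      show "0 \<le> \<sigma> x + t * indicator E x \<and> \<sigma> x + t * indicator E x \<le> 1"
        using \<sigma>_range[OF x] t(1,2) by (auto simp: indicator_def E_def simp del: of_nat_Suc)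
      show "0 \<le> (t * indicator E x) * (q x - 0)" using t(1) by (auto simp: indicator_def E_def)
    qed (use \<sigma>_ge I I1 I2 in simp_all)
    then show "AE x in M. True \<longrightarrow> \<sigma> x + inverse (real (Suc n)) \<le> 1 \<longrightarrow> q x \<le> 0"
      by (rule AE_mp) (use t(1) in \<open>auto simp: E_def indicator_def not_less simp del: of_nat_Suc\<close>)
  qed
  then show ?thesis by simp
qed

text \<open>The problem is symmetric under exchanging \<open>\<sigma>\<close> with \<open>1 - \<sigma>\<close> and \<open>q\<close> with \<open>- q\<close>.\<close>

lemma nonneg_where_decreasable:
  assumes "a < (LINT x|M. \<sigma> x)"
  shows "AE x in M. 0 < \<sigma> x \<longrightarrow> 0 \<le> q x"
proof -
  interpret dual: bathtub M "\<lambda>x. 1 - \<sigma> x" "\<lambda>x. - q x" "measure M (space M) - b" "measure M (space M) - a"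
  proof
    have int: "(LINT x|M. 1 - \<tau> x) = measure M (space M) - (LINT x|M. \<tau> x)" if "integrable M \<tau>" for \<tau>
      using that by simp
    show "(\<lambda>x. 1 - \<sigma> x) \<in> borel_measurable M" using \<sigma>_meas by measurable
    show "0 \<le> 1 - \<sigma> x \<and> 1 - \<sigma> x \<le> 1" if "x \<in> space M" for x using \<sigma>_range[OF that] by simp
    show "integrable M (\<lambda>x. - q x)" using q_int by simp
    show "measure M (space M) - b \<le> (LINT x|M. 1 - \<sigma> x)" "(LINT x|M. 1 - \<sigma> x) \<le> measure M (space M) - a"
      using \<sigma>_le \<sigma>_ge by (simp_all add: int[OF \<sigma>_integrable])
    fix \<tau> assume \<tau>: "\<tau> \<in> borel_measurable M" "\<And>x. x \<in> space M \<Longrightarrow> 0 \<le> \<tau> x \<and> \<tau> x \<le> 1"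
      "measure M (space M) - b \<le> (LINT x|M. \<tau> x)" "(LINT x|M. \<tau> x) \<le> measure M (space M) - a"
    have \<tau>int: "integrable M \<tau>" by (rule integrable_const_bound[of _ 1]) (use \<tau>(1,2) in auto)
    have "(LINT x|M. ((1 - \<tau> x) - \<sigma> x) * q x) \<le> 0"
      by (rule variational) (use \<tau> in \<open>auto simp: int[OF \<tau>int]\<close>)
    moreover have "((1 - \<tau> x) - \<sigma> x) * q x = (\<tau> x - (1 - \<sigma> x)) * - q x" for x by (simp add: algebra_simps)
    ultimately show "(LINT x|M. (\<tau> x - (1 - \<sigma> x)) * - q x) \<le> 0" by (simp only:)
  qed
  have "(LINT x|M. 1 - \<sigma> x) < measure M (space M) - a" using assms \<sigma>_integrable by simp
  from dual.nonpos_where_increasable[OF this] show ?thesis by simp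
qed

end

section \<open>The optimality theorem\<close>

theorem theorem3p1:
  fixes \<Omega> :: "(real ^ 'n) set" and A\<^sub>0 A\<^sub>1 :: "real ^ 'n ^ 'n" and \<mu>\<^sub>0 \<mu>\<^sub>1 \<alpha> \<beta> :: real
  assumes "bounded_lipschitz_domain \<Omega>"
    and "0 < \<mu>\<^sub>0" and "\<mu>\<^sub>0 \<le> \<mu>\<^sub>1"
    and "A\<^sub>0 \<in> elliptic_matrices \<mu>\<^sub>0 \<mu>\<^sub>1" and "A\<^sub>1 \<in> elliptic_matrices \<mu>\<^sub>0 \<mu>\<^sub>1" and "A\<^sub>0 \<noteq> A\<^sub>1"
    and "(0 < \<alpha> \<and> \<alpha> \<le> \<beta> \<and> \<beta> < 1) \<or> (\<alpha> = 0 \<and> \<beta> = 1 \<and> \<not> A\<^sub>0 \<preceq> A\<^sub>1 \<and> \<not> A\<^sub>1 \<preceq> A\<^sub>0)"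
  shows "(\<exists>\<sigma>. optimal_control \<Omega> A\<^sub>0 A\<^sub>1 \<alpha> \<beta> \<sigma>) \<and>
    (\<forall>\<sigma> y. optimal_control \<Omega> A\<^sub>0 A\<^sub>1 \<alpha> \<beta> \<sigma> \<longrightarrow>
       measure lebesgue {x \<in> \<Omega>. 0 < \<sigma> x \<and> \<sigma> x < 1} > 0 \<longrightarrow>
       principal_eigenfunction \<Omega> (mixture A\<^sub>0 A\<^sub>1 \<sigma>) y \<longrightarrow>
       (let q = (\<lambda>x. ((A\<^sub>1 - A\<^sub>0) *v weak_gradient \<Omega> y x) \<bullet> weak_gradient \<Omega> y x);
            V = measure lebesgue \<Omega>; m = (LINT x|lebesgue_on \<Omega>. \<sigma> x)
        in
         (\<exists>C. AE x in lebesgue_on \<Omega>. 0 < \<sigma> x \<and> \<sigma> x < 1 \<longrightarrow> q x = C) \<and>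
         (AE x' in lebesgue_on \<Omega>. \<sigma> x' = 0 \<longrightarrow>
            (AE x in lebesgue_on \<Omega>. 0 < \<sigma> x \<and> \<sigma> x < 1 \<longrightarrow> q x' \<le> q x)) \<and>
         (AE x in lebesgue_on \<Omega>. 0 < \<sigma> x \<and> \<sigma> x < 1 \<longrightarrow>
            (AE x'' in lebesgue_on \<Omega>. \<sigma> x'' = 1 \<longrightarrow> q x \<le> q x'')) \<and>
         (m < \<beta> * V \<longrightarrow> (AE x in lebesgue_on \<Omega>. 0 \<le> \<sigma> x \<and> \<sigma> x < 1 \<longrightarrow> q x \<le> 0)) \<and>
         (m > \<alpha> * V \<longrightarrow> (AE x in lebesgue_on \<Omega>. 0 < \<sigma> x \<and> \<sigma> x \<le> 1 \<longrightarrow> q x \<ge> 0)) \<and>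
         (\<alpha> * V < m \<and> m < \<beta> * V \<longrightarrow>
            (AE x in lebesgue_on \<Omega>. 0 < \<sigma> x \<and> \<sigma> x < 1 \<longrightarrow> q x = 0))))"
proof -
  interpret mixture_problem \<Omega> A\<^sub>0 A\<^sub>1 \<mu>\<^sub>0 \<mu>\<^sub>1 \<alpha> \<beta>
    using assms by unfold_locales (auto simp: bounded_lipschitz_domain_def)
  let ?V = "measure lebesgue \<Omega>"
  show ?thesis
    unfolding Let_def
  proof (rule conjI[OF optimal_control_exists], intro allI impI)
    fix \<sigma> y
    assume opt: "optimal_control \<Omega> A\<^sub>0 A\<^sub>1 \<alpha> \<beta> \<sigma>"
      and pos: "measure lebesgue {x \<in> \<Omega>. 0 < \<sigma> x \<and> \<sigma> x < 1} > 0"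
      and eig: "principal_eigenfunction \<Omega> (mixture A\<^sub>0 A\<^sub>1 \<sigma>) y"
    let ?q = "\<lambda>x. ((A\<^sub>1 - A\<^sub>0) *v weak_gradient \<Omega> y x) \<bullet> weak_gradient \<Omega> y x"
    have contrast_eq: "contrast (weak_gradient \<Omega> y) = ?q" by (simp add: contrast_def[abs_def])
    have \<sigma>: "\<sigma> \<in> controls \<Omega> \<alpha> \<beta>" using opt by (simp add: optimal_control_def)
    then have fr: "fraction \<sigma>" by (simp add: controls_iff)
    have yW: "y \<in> W12_0 \<Omega>" using eig by (simp add: principal_eigenfunction_def)
    have qint: "integrable M (\<lambda>x. 1 * contrast (weak_gradient \<Omega> y) x)"
      by (rule contrast_integrable[OF W12_0_square_integrable(2)[OF yW]]) simp_all
    interpret bathtub M \<sigma> ?q "\<alpha> * ?V" "\<beta> * ?V"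
    proof
      show "\<sigma> \<in> borel_measurable M" using fr by (simp add: fraction_def)
      show "0 \<le> \<sigma> x \<and> \<sigma> x \<le> 1" if "x \<in> space M" for x using fr that by (simp add: fraction_def)
      show "integrable M ?q" using qint by (simp add: contrast_eq)
      show "\<alpha> * ?V \<le> (LINT x|M. \<sigma> x)" "(LINT x|M. \<sigma> x) \<le> \<beta> * ?V" using \<sigma> by (simp_all add: controls_iff)
      fix \<tau> assume "\<tau> \<in> borel_measurable M" "\<And>x. x \<in> space M \<Longrightarrow> 0 \<le> \<tau> x \<and> \<tau> x \<le> 1"
        "\<alpha> * ?V \<le> (LINT x|M. \<tau> x)" "(LINT x|M. \<tau> x) \<le> \<beta> * ?V"
      then have "\<tau> \<in> controls \<Omega> \<alpha> \<beta>" by (simp add: controls_iff fraction_def)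
      from optimal_variational_inequality[OF opt eig this]
      show "(LINT x|M. (\<tau> x - \<sigma> x) * ?q x) \<le> 0" by (simp only: contrast_eq)
    qed
    have "\<not> (AE x in M. \<not> (0 < \<sigma> x \<and> \<sigma> x < 1))"
    proof
      assume "AE x in M. \<not> (0 < \<sigma> x \<and> \<sigma> x < 1)"
      then have "negligible {x \<in> \<Omega>. \<not> \<not> (0 < \<sigma> x \<and> \<sigma> x < 1)}"
        using AE_lebesgue_on_iff_negligible[of \<Omega> "\<lambda>x. \<not> (0 < \<sigma> x \<and> \<sigma> x < 1)"] open_\<Omega> by simp
      then have "measure lebesgue {x \<in> \<Omega>. 0 < \<sigma> x \<and> \<sigma> x < 1} = 0"
        by (simp add: negligible_imp_measure0)
      with pos show False by simp
    qed
    from multiplier_exists[OF this] obtain C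
      where le: "AE x in M. \<sigma> x < 1 \<longrightarrow> ?q x \<le> C" and ge: "AE x in M. 0 < \<sigma> x \<longrightarrow> C \<le> ?q x" by blast
    have eq: "AE x in M. 0 < \<sigma> x \<and> \<sigma> x < 1 \<longrightarrow> ?q x = C"
      using le ge by eventually_elim auto
    have nonpos: "AE x in M. \<sigma> x < 1 \<longrightarrow> ?q x \<le> 0" if "(LINT x|M. \<sigma> x) < \<beta> * ?V"
      using that by (rule nonpos_where_increasable)
    have nonneg: "AE x in M. 0 < \<sigma> x \<longrightarrow> 0 \<le> ?q x" if "\<alpha> * ?V < (LINT x|M. \<sigma> x)"
      using that by (rule nonneg_where_decreasable)
    show "(\<exists>C. AE x in M. 0 < \<sigma> x \<and> \<sigma> x < 1 \<longrightarrow> ?q x = C) \<and>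
      (AE x' in M. \<sigma> x' = 0 \<longrightarrow> (AE x in M. 0 < \<sigma> x \<and> \<sigma> x < 1 \<longrightarrow> ?q x' \<le> ?q x)) \<and>
      (AE x in M. 0 < \<sigma> x \<and> \<sigma> x < 1 \<longrightarrow> (AE x'' in M. \<sigma> x'' = 1 \<longrightarrow> ?q x \<le> ?q x'')) \<and>
      ((LINT x|M. \<sigma> x) < \<beta> * ?V \<longrightarrow> (AE x in M. 0 \<le> \<sigma> x \<and> \<sigma> x < 1 \<longrightarrow> ?q x \<le> 0)) \<and>
      (\<alpha> * ?V < (LINT x|M. \<sigma> x) \<longrightarrow> (AE x in M. 0 < \<sigma> x \<and> \<sigma> x \<le> 1 \<longrightarrow> 0 \<le> ?q x)) \<and>
      (\<alpha> * ?V < (LINT x|M. \<sigma> x) \<and> (LINT x|M. \<sigma> x) < \<beta> * ?V \<longrightarrow>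
        (AE x in M. 0 < \<sigma> x \<and> \<sigma> x < 1 \<longrightarrow> ?q x = 0))"
    proof (intro conjI impI)
      show "\<exists>C. AE x in M. 0 < \<sigma> x \<and> \<sigma> x < 1 \<longrightarrow> ?q x = C" using eq by (rule exI)
      show "AE x' in M. \<sigma> x' = 0 \<longrightarrow> (AE x in M. 0 < \<sigma> x \<and> \<sigma> x < 1 \<longrightarrow> ?q x' \<le> ?q x)"
        using le
      proof eventually_elim
        case (elim x')
        show ?case
        proof
          assume "\<sigma> x' = 0"
          then have x': "?q x' \<le> C" using elim by simp
          show "AE x in M. 0 < \<sigma> x \<and> \<sigma> x < 1 \<longrightarrow> ?q x' \<le> ?q x"
            using eq by eventually_elim (use x' in simp)
        qed
      qed
      show "AE x in M. 0 < \<sigma> x \<and> \<sigma> x < 1 \<longrightarrow> (AE x'' in M. \<sigma> x'' = 1 \<longrightarrow> ?q x \<le> ?q x'')"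
        using eq
      proof eventually_elim
        case (elim x)
        show ?case
        proof
          assume "0 < \<sigma> x \<and> \<sigma> x < 1"
          then have x: "?q x = C" using elim by simp
          show "AE x'' in M. \<sigma> x'' = 1 \<longrightarrow> ?q x \<le> ?q x''"
            using ge by eventually_elim (use x in simp)
        qed
      qed
      show "AE x in M. 0 \<le> \<sigma> x \<and> \<sigma> x < 1 \<longrightarrow> ?q x \<le> 0" if "(LINT x|M. \<sigma> x) < \<beta> * ?V"
        using nonpos[OF that] by eventually_elim simp
      show "AE x in M. 0 < \<sigma> x \<and> \<sigma> x \<le> 1 \<longrightarrow> 0 \<le> ?q x" if "\<alpha> * ?V < (LINT x|M. \<sigma> x)"
        using nonneg[OF that] by eventually_elim simp
      show "AE x in M. 0 < \<sigma> x \<and> \<sigma> x < 1 \<longrightarrow> ?q x = 0"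
        if "\<alpha> * ?V < (LINT x|M. \<sigma> x) \<and> (LINT x|M. \<sigma> x) < \<beta> * ?V"
        using nonpos[OF that[THEN conjunct2]] nonneg[OF that[THEN conjunct1]] by eventually_elim auto
    qed
  qed
qed

end
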